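(* Let $G$ be a compact connected abelian Polish group and $H$ a locally compact abelian Polish group. Then $E(G)\leq_B E(H)$ if and only if there is a continuous homomorphism $S:G\to H$ such that $\ker(S)$ is non-archimedean.
   Context: For a Polish group $G$, $E(G)$ is the equivalence relation on $G^\omega$ given by $x\,E(G)\,y$ iff the sequence $(x(n)y(n)^{-1})_{n}$ converges in $G$. For equivalence relations $E,F$ on Polish spaces $X,Y$, $E\leq_B F$ means there is a Borel map $\theta:X\to Y$ with $x E y\iff \theta(x) F \theta(y)$ for all $x,y\in X$. A Polish group is non-archimedean if it has a neighborhood base of the identity consisting of open subgroups. *)

theory Defs
  imports "HOL-Analysis.Analysis"
begin

text \<open>
  Polish groups are rendered as types of sort \<open>{topological_group_add, polish_space}\<close>, written
  additively, so \<open>x(n) y(n)\<^sup>-\<^sup>1\<close> becomes \<open>x n - y n = x n + (- y n)\<close>. The metric carried by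
  \<^class>\<open>polish_space\<close> is an arbitrary complete compatible one, unrelated to the group structure;
  all notions below depend on the topology only. The space \<open>G\<^sup>\<omega>\<close> is \<open>nat \<Rightarrow> 'g\<close> with the
  product topology.
\<close>

definition E_grp ::
    "(nat \<Rightarrow> 'g::{topological_group_add, polish_space}) \<Rightarrow> (nat \<Rightarrow> 'g) \<Rightarrow> bool"
  where "E_grp x y \<longleftrightarrow> convergent (\<lambda>n. x n - y n)"

lemma equivp_E_grp:
  "equivp (E_grp :: (nat \<Rightarrow> 'g::{topological_group_add, polish_space}) \<Rightarrow> (nat \<Rightarrow> 'g) \<Rightarrow> bool)"
proof (rule equivpI)
  show "reflp (E_grp :: (nat \<Rightarrow> 'g) \<Rightarrow> _)"
    by (auto simp: reflp_def E_grp_def convergent_const)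
  show "symp (E_grp :: (nat \<Rightarrow> 'g) \<Rightarrow> _)"
  proof (rule sympI)
    fix x y :: "nat \<Rightarrow> 'g"
    assume "E_grp x y"
    then obtain l where "(\<lambda>n. x n - y n) \<longlonglongrightarrow> l"
      by (auto simp: E_grp_def convergent_def)
    then have "(\<lambda>n. - (x n - y n)) \<longlonglongrightarrow> - l"
      by (rule tendsto_minus)
    then show "E_grp y x"
      by (auto simp: E_grp_def convergent_def)
  qed
  show "transp (E_grp :: (nat \<Rightarrow> 'g) \<Rightarrow> _)"
  proof (rule transpI)
    fix x y z :: "nat \<Rightarrow> 'g"
    assume "E_grp x y" "E_grp y z"
    then obtain l m where "(\<lambda>n. x n - y n) \<longlonglongrightarrow> l" "(\<lambda>n. y n - z n) \<longlonglongrightarrow> m"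
      by (auto simp: E_grp_def convergent_def)
    then have "(\<lambda>n. (x n - y n) + (y n - z n)) \<longlonglongrightarrow> l + m"
      by (rule tendsto_add)
    moreover have "(x n - y n) + (y n - z n) = x n - z n" for n
      by (simp add: diff_conv_add_uminus add.assoc del: add_uminus_conv_diff)
    ultimately show "E_grp x z"
      by (auto simp: E_grp_def convergent_def)
  qed
qed

definition borel_reducible ::
    "('a::polish_space \<Rightarrow> 'a \<Rightarrow> bool) \<Rightarrow> ('b::polish_space \<Rightarrow> 'b \<Rightarrow> bool) \<Rightarrow> bool"
    (infix "\<le>\<^sub>B" 50)
  where "E \<le>\<^sub>B F \<longleftrightarrow>
    (\<exists>\<theta>. \<theta> \<in> borel_measurable borel \<and> (\<forall>x y. E x y \<longleftrightarrow> F (\<theta> x) (\<theta> y)))"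

definition is_subgroup :: "'g::group_add set \<Rightarrow> bool"
  where "is_subgroup V \<longleftrightarrow>
    0 \<in> V \<and> (\<forall>x\<in>V. \<forall>y\<in>V. x + y \<in> V) \<and> (\<forall>x\<in>V. - x \<in> V)"

text \<open>Applied to a subgroup \<open>K\<close>, regarded as a topological group with the subspace topology.\<close>

definition non_archimedean :: "'g::topological_group_add set \<Rightarrow> bool"
  where "non_archimedean K \<longleftrightarrow>
    neighbourhood_base_at 0 (\<lambda>V. openin (top_of_set K) V \<and> is_subgroup V) (top_of_set K)"

definition kernel_of :: "('g::group_add \<Rightarrow> 'h::group_add) \<Rightarrow> 'g set"
  where "kernel_of S = {x. S x = 0}"

end

theory Submission
  imports Defs
begin

text \<open>
  A Borel reduction of \<open>E(G)\<close> to \<open>E(H)\<close> gives \<open>S\<close> as follows. Passing to increments, \<open>x E(G) y\<close> says that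
  the series \<open>\<Sum> (x n - y n)\<close> converges. Let the terms range over a countable dense subgroup \<open>D\<close> of \<open>G\<close> with
  the discrete topology. By Baire category the reduction may be assumed to act blockwise, up to summable
  errors, the \<open>i\<close>-th term only influencing the \<open>i\<close>-th block of the image. The total change \<open>\<tau> i a\<close> of the
  image over block \<open>i\<close> caused by the term \<open>a\<close> clusters, since \<open>H\<close> is locally compact and \<open>G\<close> is connected, at
  some \<open>T a\<close>. Series whose partial sums stay small have images whose partial sums stay small; going from
  \<open>0\<close> to a point of \<open>D\<close> in small steps this forces \<open>T\<close> to be additive and continuous, so it extends to
  \<open>S\<close>. A chain of small steps inside the kernel that leaves a given neighbourhood of \<open>0\<close> would have an almost
  constant image; hence the points reachable from \<open>0\<close> by small steps in the kernel form small open subgroups.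

  Conversely, given \<open>S\<close> and \<open>z = x - y\<close>, compactness and the open subgroups of the kernel show that \<open>z\<close>
  converges iff \<open>S z\<close> converges and \<open>z (n + 1) - z n\<close> tends to \<open>0\<close>. The second condition is coded into
  \<open>H\<close> along an injective path, namely a piece of \<open>S \<circ> \<sigma>\<close> for a one-parameter subgroup \<open>\<sigma>\<close> of \<open>G\<close>. Such
  \<open>\<sigma>\<close> exist because the continuous characters of \<open>G\<close> separate points and form a torsion free group, which
  has a nonzero homomorphism to the reals.
\<close>

subsection \<open>Invariant norms on locally compact abelian groups\<close>

text \<open>Two obstacles shape the passage from a reduction to S. A reduction is only Borel, so it
  can be controlled on a comeagre set only. Taking D countable and discrete turns inputs into
  elements of nat => nat, where a category argument can freeze all but a sparse set of coordinates.
  The free coordinate number i admits only the values 0, ..., i: each stage then meets finitely many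
  patterns, yet every fixed value is eventually allowed. Moreover T is a mere cluster point of block
  changes and carries no algebraic structure; additivity has to be extracted from comparisons of
  convergent series.

  In the converse, characters arise as normalised extreme positive definite functions. The obstacle
  there is compactness: pointwise limits of continuous positive definite functions may be
  discontinuous, so the set \<open>cap\<close> carries penalties that force equicontinuity. The
  coding of increments into H uses distances to a dense sequence. It is not additive; its continuity
  and the separation of points are what count.\<close>

locale group_norm =
  fixes N :: "'a::{topological_ab_group_add, metric_space} \<Rightarrow> real"
  assumes zero [simp]: "N 0 = 0"
    and minus [simp]: "N (- x) = N x"
    and triangle: "N (x + y) \<le> N x + N y"
    and tendsto_iff: "((\<lambda>n::nat. N (u n)) \<longlonglongrightarrow> 0) \<longleftrightarrow> u \<longlonglongrightarrow> 0"
    and compact_ball: "\<exists>r>0. \<exists>K. compact K \<and> {x. N x \<le> r} \<subseteq> K"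
begin

lemma nonneg [simp]: "0 \<le> N x"
  using triangle[of x "- x"] by simp

lemma diff_triangle: "N (x - z) \<le> N (x - y) + N (y - z)"
  using triangle[of "x - y" "y - z"] by simp

lemma diff_le: "N (x - y) \<le> N x + N y"
  using triangle[of x "- y"] by simp

lemma commute: "N (x - y) = N (y - x)"
  using minus[of "x - y"] by simp

lemma abs_diff_le: "\<bar>N x - N y\<bar> \<le> N (x - y)"
  using triangle[of "x - y" y] triangle[of "y - x" x] commute[of x y] by simp

lemma eq_zero_iff [simp]: "N x = 0 \<longleftrightarrow> x = 0"
proof
  assume "N x = 0"
  then have "(\<lambda>n::nat. N x) \<longlonglongrightarrow> 0" by simp
  then have "(\<lambda>n::nat. x) \<longlonglongrightarrow> 0" by (subst (asm) tendsto_iff)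
  then show "x = 0" by (simp add: LIMSEQ_const_iff)
qed simp

lemma sum_le: "N (\<Sum>i\<in>A. f i) \<le> (\<Sum>i\<in>A. N (f i))"
proof (induction A rule: infinite_finite_induct)
  case (insert a A)
  then show ?case using triangle[of "f a" "\<Sum>i\<in>A. f i"] by simp
qed auto

lemma tendsto_diff_iff: "u \<longlonglongrightarrow> l \<longleftrightarrow> (\<lambda>n::nat. N (u n - l)) \<longlonglongrightarrow> 0"
proof -
  have "u \<longlonglongrightarrow> l \<longleftrightarrow> (\<lambda>n. u n - l) \<longlonglongrightarrow> 0"
  proof
    assume "u \<longlonglongrightarrow> l" then show "(\<lambda>n. u n - l) \<longlonglongrightarrow> 0"
      using tendsto_diff[of u l sequentially "\<lambda>_. l" l] by simp
  next
    assume "(\<lambda>n. u n - l) \<longlonglongrightarrow> 0" then show "u \<longlonglongrightarrow> l"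
      using tendsto_add[of "\<lambda>n. u n - l" 0 sequentially "\<lambda>_. l" l] by simp
  qed
  then show ?thesis by (simp add: tendsto_iff)
qed

lemma continuous: "continuous_on UNIV N"
  unfolding continuous_on_sequentially
proof safe
  fix u :: "nat \<Rightarrow> 'a" and l assume "u \<longlonglongrightarrow> l"
  then have "(\<lambda>n. N (u n - l)) \<longlonglongrightarrow> 0" by (simp add: tendsto_diff_iff)
  then have "(\<lambda>n. N (u n) - N l) \<longlonglongrightarrow> 0"
    by (rule Lim_null_comparison[rotated]) (auto simp: abs_diff_le)
  then show "(N \<circ> u) \<longlonglongrightarrow> N l"
    by (simp add: comp_def LIM_zero_iff)
qed

lemma open_ball: "open {y. N (y - x) < r}"
proof -
  have "continuous_on UNIV (\<lambda>y. N (y - x))"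
    by (intro continuous_on_compose2[OF continuous] continuous_intros) auto
  then show ?thesis by (intro open_Collect_less continuous_intros) auto
qed

lemma ball_in_open:
  assumes "open U" "x \<in> U"
  obtains r where "r > 0" "{y. N (y - x) < r} \<subseteq> U"
proof (rule ccontr)
  assume "\<not> thesis"
  then have "\<forall>n. \<exists>y. N (y - x) < 1 / real (Suc n) \<and> y \<notin> U"
    using that[of "1 / real (Suc _)"] by fastforce
  then obtain y where y: "\<And>n. N (y n - x) < 1 / real (Suc n)" "\<And>n. y n \<notin> U" by metis
  have "(\<lambda>n. N (y n - x)) \<longlonglongrightarrow> 0"
    by (rule tendsto_sandwich[OF _ _ tendsto_const LIMSEQ_inverse_real_of_nat])
      (use y(1) in \<open>auto simp: inverse_eq_divide intro!: always_eventually less_imp_le\<close>)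
  then have "y \<longlonglongrightarrow> x" by (simp add: tendsto_diff_iff)
  then have "\<forall>\<^sub>F n in sequentially. y n \<in> U" using assms by (rule topological_tendstoD)
  then show False using y(2) by simp
qed

lemma continuous_at_0:
  assumes "continuous_on UNIV f" "f 0 = 0" "group_norm M" "e > 0"
  obtains r where "r > 0" "\<And>x. N x < r \<Longrightarrow> M (f x) < e"
proof -
  interpret M: group_norm M by fact
  have "open (f -` {y. M (y - 0) < e})"
    by (rule open_vimage[OF M.open_ball assms(1)])
  moreover have "0 \<in> f -` {y. M (y - 0) < e}" using assms by simp
  ultimately obtain r where "r > 0" "{y. N (y - 0) < r} \<subseteq> f -` {y. M (y - 0) < e}"
    by (rule ball_in_open)
  then show ?thesis using that by auto
qed

text \<open>Completeness comes from the compact ball and not from the given metric, which is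
  unrelated to the group: a Cauchy tail, translated by one of its terms, stays in a compact set and
  so has a cluster point.\<close>

lemma Cauchy_convergent:
  assumes "\<And>e. e > 0 \<Longrightarrow> \<exists>M. \<forall>m\<ge>M. \<forall>n\<ge>M. N (u m - u n) < e"
  shows "convergent u"
proof -
  obtain r K where r: "r > 0" and K: "compact K" "{x. N x \<le> r} \<subseteq> K" using compact_ball by blast
  obtain M where M: "\<And>m n. m \<ge> M \<Longrightarrow> n \<ge> M \<Longrightarrow> N (u m - u n) < r" using assms[OF r] by blast
  have "\<forall>n. u (n + M) - u M \<in> K" using less_imp_le[OF M] K(2) by auto
  then obtain l q where q: "strict_mono q" "((\<lambda>n. u (n + M) - u M) \<circ> q) \<longlonglongrightarrow> l"
    by (rule seq_compactE[OF compact_imp_seq_compact[OF K(1)]])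
  then have "(\<lambda>n. (u (q n + M) - u M) + u M) \<longlonglongrightarrow> l + u M"
    by (intro tendsto_add tendsto_const) (simp add: comp_def)
  then have lim: "(\<lambda>n. N (u (q n + M) - (l + u M))) \<longlonglongrightarrow> 0"
    by (simp add: tendsto_diff_iff)
  have "(\<lambda>n. N (u n - (l + u M))) \<longlonglongrightarrow> 0"
  proof (rule LIMSEQ_I)
    fix e :: real assume "e > 0"
    then obtain M' where M': "\<And>m n. m \<ge> M' \<Longrightarrow> n \<ge> M' \<Longrightarrow> N (u m - u n) < e / 2"
      using assms[of "e/2"] by auto
    have "\<forall>\<^sub>F n in sequentially. N (u (q n + M) - (l + u M)) < e / 2"
      using order_tendstoD(2)[OF lim, of "e/2"] \<open>e > 0\<close> by simp
    moreover have "\<forall>\<^sub>F n in sequentially. q n + M \<ge> M'"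
      unfolding eventually_sequentially using seq_suble[OF q(1)] by (meson order_trans trans_le_add1)
    ultimately have "\<forall>\<^sub>F n in sequentially. N (u (q n + M) - (l + u M)) < e / 2 \<and> q n + M \<ge> M'"
      by (rule eventually_conj)
    then obtain n where n: "N (u (q n + M) - (l + u M)) < e / 2" "q n + M \<ge> M'"
      unfolding eventually_sequentially by blast
    have "N (u m - (l + u M)) < e" if "m \<ge> M'" for m
      using diff_triangle[of "u m" "l + u M" "u (q n + M)"] M'[OF that n(2)] n(1) by linarith
    then show "\<exists>no. \<forall>n\<ge>no. norm (N (u n - (l + u M)) - 0) < e" by auto
  qed
  then show ?thesis unfolding convergent_def by (auto simp: tendsto_diff_iff)
qed

lemma convergent_CauchyD:
  assumes "convergent u" "e > 0"
  shows "\<exists>M. \<forall>m\<ge>M. \<forall>n\<ge>M. N (u m - u n) < e"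
proof -
  obtain l where "u \<longlonglongrightarrow> l" using assms by (auto simp: convergent_def)
  then have "(\<lambda>n. N (u n - l)) \<longlonglongrightarrow> 0" by (simp add: tendsto_diff_iff)
  then have "\<forall>\<^sub>F n in sequentially. N (u n - l) < e / 2"
    using order_tendstoD(2)[of _ 0 _ "e/2"] assms(2) by simp
  then obtain M where M: "\<And>n. n \<ge> M \<Longrightarrow> N (u n - l) < e / 2" by (auto simp: eventually_sequentially)
  have "N (u m - u n) < e" if "m \<ge> M" "n \<ge> M" for m n
    using diff_triangle[of "u m" "u n" l] M[OF that(1)] M[OF that(2)] commute[of l "u n"] by linarith
  then show ?thesis by blast
qed

text \<open>The convergence test of the block arguments: \<open>\<eta> k\<close> bounds the
  variation from one breakpoint up to and including the next, so its summability gives the Cauchy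
  property.\<close>

lemma convergent_breakpoints:
  assumes L: "strict_mono L" and \<eta>: "summable \<eta>"
    and var: "\<And>k m. L k \<le> m \<Longrightarrow> m \<le> L (Suc k) \<Longrightarrow> N (Y m - Y (L k)) \<le> \<eta> k"
  shows "convergent Y"
proof (rule Cauchy_convergent)
  have pos: "\<eta> k \<ge> 0" for k using var[of k "L k"] L by (simp add: strict_mono_less_eq)
  fix e :: real assume "e > 0"
  then obtain K where K: "\<And>m n. m \<ge> K \<Longrightarrow> norm (\<Sum>i=m..<n. \<eta> i) < e / 2"
    using \<eta> unfolding summable_Cauchy by (meson half_gt_zero)
  have tele: "N (Y (L k) - Y (L K)) \<le> (\<Sum>i=K..<k. \<eta> i)" if "k \<ge> K" for k
    using that
  proof (induction k rule: dec_induct)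
    case (step k)
    have "N (Y (L (Suc k)) - Y (L k)) \<le> \<eta> k"
      using L by (intro var) (auto simp: strict_mono_less_eq)
    then show ?case using step diff_triangle[of "Y (L (Suc k))" "Y (L K)" "Y (L k)"] by simp
  qed simp
  have main: "N (Y m - Y (L K)) < e / 2" if m: "m \<ge> L K" for m
  proof -
    define k where "k = (GREATEST k. L k \<le> m)"
    have bdd: "\<forall>j. L j \<le> m \<longrightarrow> j \<le> m" using L by (meson order_trans seq_suble)
    have k: "L k \<le> m" unfolding k_def by (rule GreatestI_nat[of _ K m]) (use m bdd in auto)
    have "K \<le> k" unfolding k_def by (rule Greatest_le_nat[of _ K m]) (use m bdd in auto)
    have "\<not> L (Suc k) \<le> m" unfolding k_def
      using Greatest_le_nat[of "\<lambda>k. L k \<le> m" _ m] bdd by (metis not_less_eq_eq order_refl)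
    then have "N (Y m - Y (L k)) \<le> \<eta> k" using k by (intro var) auto
    then have "N (Y m - Y (L K)) \<le> (\<Sum>i=K..<Suc k. \<eta> i)"
      using diff_triangle[of "Y m" "Y (L K)" "Y (L k)"] tele[OF \<open>K \<le> k\<close>] \<open>K \<le> k\<close> by simp
    also have "\<dots> < e / 2" using K[of K "Suc k"] by (simp add: abs_less_iff)
    finally show ?thesis .
  qed
  have "N (Y m - Y n) < e" if "m \<ge> L K" "n \<ge> L K" for m n
    using diff_triangle[of "Y m" "Y n" "Y (L K)"] main[OF that(1)] main[OF that(2)]
      commute[of "Y (L K)" "Y n"] by linarith
  then show "\<exists>M. \<forall>m\<ge>M. \<forall>n\<ge>M. N (Y m - Y n) < e" by blast
qed

end

lemma tendsto_0_subseq: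
  fixes f :: "nat \<Rightarrow> real"
  assumes "\<And>q::nat \<Rightarrow> nat. strict_mono q \<Longrightarrow> \<exists>p::nat \<Rightarrow> nat. strict_mono p \<and> (f \<circ> q \<circ> p) \<longlonglongrightarrow> 0"
  shows "f \<longlonglongrightarrow> 0"
proof (rule ccontr)
  assume "\<not> f \<longlonglongrightarrow> 0"
  then obtain e where e: "e > 0" "\<forall>M. \<exists>n\<ge>M. \<bar>f n\<bar> \<ge> e"
    unfolding lim_sequentially dist_real_def by (auto simp: not_less)
  then have "infinite {n. \<bar>f n\<bar> \<ge> e}"
    unfolding infinite_nat_iff_unbounded_le by simp
  then obtain q :: "nat \<Rightarrow> nat" where q: "strict_mono q" "\<And>n. q n \<in> {n. \<bar>f n\<bar> \<ge> e}"
    using infinite_enumerate by blast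
  obtain p where p: "strict_mono p" "(f \<circ> q \<circ> p) \<longlonglongrightarrow> 0" using assms[OF q(1)] by blast
  have "\<forall>\<^sub>F n in sequentially. \<bar>f (q (p n))\<bar> < e"
    using order_tendstoD(2)[OF tendsto_rabs_zero[OF p(2)] e(1)] by simp
  then show False using q(2) by (auto simp: not_less[symmetric] eventually_sequentially)
qed

text \<open>The norm of h is the uniform distance between a bump function f and its translate by h,
  so symmetry and the triangle inequality are automatic. At x = 0 the difference bounds N h below by
  the distance of h to 0, cut off at r; compact support of f makes translation continuous in the
  uniform norm.\<close>

lemma group_norm_exists:
  assumes lc: "locally_compact_space (euclidean :: 'a::{topological_ab_group_add, metric_space} topology)"
  obtains N :: "'a::{topological_ab_group_add, metric_space} \<Rightarrow> real" where "group_norm N"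
proof -
  obtain U K where UK: "open U" "compact K" "(0::'a) \<in> U" "U \<subseteq> K"
    using lc unfolding locally_compact_space_def by (auto dest!: spec[of _ "0::'a"])
  obtain r where r: "r > 0" "ball 0 r \<subseteq> U" using UK open_contains_ball by blast
  define f where "f x = max 0 (r - dist x 0)" for x :: 'a
  have f_bd: "0 \<le> f x" "f x \<le> r" for x using r by (auto simp: f_def)
  have f_K: "x \<in> K" if "f x \<noteq> 0" for x
    using that r(2) UK(4) by (auto simp: f_def max_def dist_commute subset_iff split: if_splits)
  have cf: "continuous_on UNIV f" unfolding f_def by (intro continuous_intros)
  define N where "N h = (SUP x. \<bar>f (x + h) - f x\<bar>)" for h
  have bdd: "bdd_above (range (\<lambda>x. \<bar>f (x + h) - f x\<bar>))" for h
  proof (rule bdd_aboveI[of _ r])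
    fix v assume "v \<in> range (\<lambda>x. \<bar>f (x + h) - f x\<bar>)"
    then obtain x where "v = \<bar>f (x + h) - f x\<bar>" by blast
    then show "v \<le> r" using f_bd[of x] f_bd[of "x + h"] by linarith
  qed
  have N_ge: "\<bar>f (x + h) - f x\<bar> \<le> N h" for x h
    unfolding N_def by (rule cSUP_upper[OF _ bdd]) simp
  have N_le: "N h \<le> c" if "\<And>x. \<bar>f (x + h) - f x\<bar> \<le> c" for h c
    unfolding N_def by (rule cSUP_least) (use that in auto)
  have N0: "0 \<le> N h" for h using N_ge[of 0 h] by linarith
  have zero: "N 0 = 0" using N_le[of 0 0] N0[of 0] by simp
  have m1: "N (- h) \<le> N h" for h
    by (rule N_le) (use N_ge[of "_ - h" h] in \<open>auto simp: abs_minus_commute\<close>)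
  have minus: "N (- h) = N h" for h using m1[of h] m1[of "- h"] by simp
  have tri: "N (h + k) \<le> N h + N k" for h k
  proof (rule N_le)
    fix x show "\<bar>f (x + (h + k)) - f x\<bar> \<le> N h + N k"
      using N_ge[of x h] N_ge[of "x + h" k] by (simp add: add.assoc)
  qed
  have lower: "min (dist h 0) r \<le> N h" for h
    using N_ge[of 0 h] r by (auto simp: f_def min_def max_def abs_if split: if_splits)
  have cont: "(\<lambda>n. N (u n)) \<longlonglongrightarrow> 0" if u: "u \<longlonglongrightarrow> 0" for u :: "nat \<Rightarrow> 'a"
  proof -
    have "\<exists>x. N h \<le> 2 * \<bar>f (x + h) - f x\<bar>" for h
    proof (cases "N h = 0")
      case False
      then have "N h / 2 < N h" using N0[of h] by simp
      then obtain x where "N h / 2 < \<bar>f (x + h) - f x\<bar>"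
        using N_le[of h "N h / 2"] by (meson not_less)
      then show ?thesis by (intro exI[of _ x]) simp
    qed auto
    then obtain x where x: "\<And>h. N h \<le> 2 * \<bar>f (x h + h) - f (x h)\<bar>" by metis
    \<comment> \<open>A near maximiser x may run off to infinity. If it contributes at all, then x
      or x + u lies in the support of f, and the difference is re-based at that point of K; the
      default 0 covers the case of no contribution.\<close>
    define y where "y n = (if f (x (u n)) = 0 \<and> f (x (u n) + u n) \<noteq> 0 then x (u n) + u n else if f (x (u n)) \<noteq> 0 then x (u n) else 0)" for n
    have yK: "y n \<in> K" for n using f_K UK by (auto simp: y_def)
    have yN: "N (u n) \<le> 2 * \<bar>f (y n + u n) - f (y n)\<bar> + 2 * \<bar>f (y n - u n) - f (y n)\<bar>" for n
      using x[of "u n"] N0[of "u n"] abs_ge_zero[of "f (x (u n) - u n) - f (x (u n))"]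
        abs_ge_zero[of "f (x (u n) + u n + u n) - f (x (u n) + u n)"]
      by (auto simp: y_def simp del: abs_ge_zero)
    show ?thesis
    proof (rule tendsto_0_subseq)
      fix q :: "nat \<Rightarrow> nat" assume q: "strict_mono q"
      obtain l p where p: "strict_mono p" "((y \<circ> q) \<circ> p) \<longlonglongrightarrow> l"
        by (rule seq_compactE[OF compact_imp_seq_compact[OF UK(2)], of "y \<circ> q"]) (use yK in auto)
      have yl: "(\<lambda>n. y (q (p n))) \<longlonglongrightarrow> l" using p(2) by (simp add: comp_def)
      have ul: "(\<lambda>n. u (q (p n))) \<longlonglongrightarrow> 0"
        using LIMSEQ_subseq_LIMSEQ[OF LIMSEQ_subseq_LIMSEQ[OF u q] p(1)] by (simp add: comp_def)
      have fl: "(\<lambda>n. f (v n)) \<longlonglongrightarrow> f l" if "v \<longlonglongrightarrow> l" for v :: "nat \<Rightarrow> 'a"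
        using continuous_on_tendsto_compose[OF cf that] by simp
      have 1: "(\<lambda>n. f (y (q (p n)) + u (q (p n)))) \<longlonglongrightarrow> f l"
        using fl[of "\<lambda>n. y (q (p n)) + u (q (p n))"] tendsto_add[OF yl ul] by simp
      have 2: "(\<lambda>n. f (y (q (p n)) - u (q (p n)))) \<longlonglongrightarrow> f l"
        using fl[of "\<lambda>n. y (q (p n)) - u (q (p n))"] tendsto_diff[OF yl ul] by simp
      have "(\<lambda>n. 2 * \<bar>f (y (q (p n)) + u (q (p n))) - f (y (q (p n)))\<bar>
          + 2 * \<bar>f (y (q (p n)) - u (q (p n))) - f (y (q (p n)))\<bar>) \<longlonglongrightarrow> 2 * \<bar>f l - f l\<bar> + 2 * \<bar>f l - f l\<bar>"
        by (intro tendsto_intros 1 2 fl yl)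
      then have "(\<lambda>n. N (u (q (p n)))) \<longlonglongrightarrow> 0"
        using N0 yN by (intro tendsto_sandwich[OF always_eventually always_eventually tendsto_const, of 0 "\<lambda>n. N (u (q (p n)))" "\<lambda>n. 2 * \<bar>f (y (q (p n)) + u (q (p n))) - f (y (q (p n)))\<bar>
          + 2 * \<bar>f (y (q (p n)) - u (q (p n))) - f (y (q (p n)))\<bar>"]) simp_all
      then show "\<exists>p. strict_mono p \<and> ((\<lambda>n. N (u n)) \<circ> q \<circ> p) \<longlonglongrightarrow> 0"
        using p(1) by (auto simp: comp_def)
    qed
  qed
  have "group_norm N"
  proof
    fix u :: "nat \<Rightarrow> 'a"
    show "((\<lambda>n::nat. N (u n)) \<longlonglongrightarrow> 0) \<longleftrightarrow> u \<longlonglongrightarrow> 0"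
    proof
      assume Nu: "(\<lambda>n. N (u n)) \<longlonglongrightarrow> 0"
      have "\<forall>\<^sub>F n in sequentially. N (u n) < r" using order_tendstoD(2)[OF Nu r(1)] .
      then have "\<forall>\<^sub>F n in sequentially. norm (dist (u n) 0) \<le> N (u n)"
      proof eventually_elim
        case (elim n)
        then show ?case using lower[of "u n"] by simp
      qed
      then have "(\<lambda>n. dist (u n) 0) \<longlonglongrightarrow> 0" by (rule Lim_null_comparison) (rule Nu)
      then show "u \<longlonglongrightarrow> 0" by (simp add: tendsto_dist_iff[of u])
    qed (rule cont)
    show "\<exists>r>0. \<exists>K. compact K \<and> {x. N x \<le> r} \<subseteq> K"
    proof (intro exI conjI)
      show "r / 2 > 0" using r by simp
      show "compact K" by (rule UK)
      show "{x. N x \<le> r / 2} \<subseteq> K"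
      proof
        fix x assume "x \<in> {x. N x \<le> r / 2}"
        then have "dist x 0 < r" using lower[of x] r by (auto simp: min_def split: if_splits)
        then show "x \<in> K" using r(2) UK(4) by (auto simp: dist_commute subset_iff)
      qed
    qed
  qed (use zero minus tri in auto)
  then show ?thesis by (rule that)
qed

subsection \<open>Baire category on sequences of natural numbers\<close>

text \<open>Modulo a meagre set every Borel set is open. The complement of an open U is replaced by
  its exterior, at the cost of one more dense open set, the complement of the boundary of U.\<close>

lemma borel_Baire_property:
  fixes A :: "'a::topological_space set"
  assumes "A \<in> sets borel"
  shows "\<exists>\<D> U. countable \<D> \<and> (\<forall>D\<in>\<D>. open D \<and> closure D = UNIV) \<and> open U \<and>
    (\<forall>z\<in>\<Inter>\<D>. z \<in> A \<longleftrightarrow> z \<in> U)"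
proof -
  have "A \<in> sigma_sets UNIV {S. open S}" using assms by (simp add: borel_def)
  then show ?thesis
  proof (induction rule: sigma_sets.induct)
    case (Basic A) then show ?case by (intro exI[of _ "{}"] exI[of _ A]) auto
  next
    case Empty show ?case by (intro exI[of _ "{}"]) auto
  next
    case (Compl A)
    then obtain \<D> U where D: "countable \<D>" "\<forall>D\<in>\<D>. open D \<and> closure D = UNIV" "open U"
      "\<forall>z\<in>\<Inter>\<D>. z \<in> A \<longleftrightarrow> z \<in> U" by blast
    have "closure (U \<union> - closure U) = UNIV"
      using closure_subset[of "- closure U"] by (auto simp: closure_Un)
    then show ?case using D
      by (intro exI[of _ "insert (U \<union> - closure U) \<D>"] exI[of _ "- closure U"])
        (use closure_subset[of U] in \<open>auto intro: open_Un\<close>)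
  next
    case (Union A)
    then obtain \<D> U where D: "\<And>i::nat. countable (\<D> i)" "\<And>i. \<forall>D\<in>\<D> i. open D \<and> closure D = UNIV"
      "\<And>i. open (U i)" "\<And>i. \<forall>z\<in>\<Inter>(\<D> i). z \<in> A i \<longleftrightarrow> z \<in> U i" by metis
    have "\<forall>z\<in>\<Inter>(\<Union>i. \<D> i). z \<in> (\<Union>i. A i) \<longleftrightarrow> z \<in> (\<Union>i. U i)"
    proof
      fix z assume "z \<in> \<Inter>(\<Union>i. \<D> i)"
      then have "z \<in> A i \<longleftrightarrow> z \<in> U i" for i using D(4)[of i] by blast
      then show "z \<in> (\<Union>i. A i) \<longleftrightarrow> z \<in> (\<Union>i. U i)" by simp
    qed
    moreover have "open (\<Union>i. U i)" "countable (\<Union>i. \<D> i)" using D by auto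
    ultimately show ?case using D(2)
      by (intro exI[of _ "\<Union>i. \<D> i"] exI[of _ "\<Union>i. U i"]) blast
  qed
qed

text \<open>For each member b of a countable basis, discard the meagre set on which the preimage of
  b differs from an open set.\<close>

lemma borel_continuous_on_generic:
  fixes f :: "'a::topological_space \<Rightarrow> 'b::second_countable_topology"
  assumes "f \<in> borel_measurable borel"
  obtains \<D> where "countable \<D>" "\<And>D. D \<in> \<D> \<Longrightarrow> open D" "\<And>D. D \<in> \<D> \<Longrightarrow> closure D = UNIV"
    "continuous_on (\<Inter>\<D>) f"
proof -
  obtain \<B> :: "'b set set" where B: "countable \<B>" "topological_basis \<B>"
    using ex_countable_basis by blast
  have "f -` b \<in> sets borel" if "b \<in> \<B>" for b
    using measurable_sets_borel[OF assms] topological_basis_open[OF B(2) that] by auto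
  then have "\<forall>b\<in>\<B>. \<exists>\<D> U. countable \<D> \<and> (\<forall>D\<in>\<D>. open D \<and> closure D = UNIV) \<and> open U \<and>
    (\<forall>z\<in>\<Inter>\<D>. z \<in> f -` b \<longleftrightarrow> z \<in> U)" using borel_Baire_property by blast
  then obtain \<D> U where D: "\<And>b. b \<in> \<B> \<Longrightarrow> countable (\<D> b)"
     "\<And>b. b \<in> \<B> \<Longrightarrow> \<forall>D\<in>\<D> b. open D \<and> closure D = UNIV" "\<And>b. b \<in> \<B> \<Longrightarrow> open (U b)"
     "\<And>b. b \<in> \<B> \<Longrightarrow> \<forall>z\<in>\<Inter>(\<D> b). z \<in> f -` b \<longleftrightarrow> z \<in> U b" by metis
  show ?thesis
  proof
    show "countable (\<Union>b\<in>\<B>. \<D> b)" using B D by auto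
    show "continuous_on (\<Inter>(\<Union>b\<in>\<B>. \<D> b)) f"
      unfolding continuous_on_open_invariant
    proof (intro allI impI)
      fix V :: "'b set" assume "open V"
      then obtain \<B>' where B': "\<B>' \<subseteq> \<B>" "\<Union>\<B>' = V" using B(2) by (auto simp: topological_basis_def)
      show "\<exists>A. open A \<and> A \<inter> \<Inter>(\<Union>b\<in>\<B>. \<D> b) = f -` V \<inter> \<Inter>(\<Union>b\<in>\<B>. \<D> b)"
      proof (intro exI conjI)
        show "open (\<Union>b\<in>\<B>'. U b)" using B'(1) D(3) by blast
        have "z \<in> f -` b \<longleftrightarrow> z \<in> U b" if "z \<in> \<Inter>(\<Union>b\<in>\<B>. \<D> b)" "b \<in> \<B>'" for z b
          using D(4)[of b] that B' by blast
        then show "(\<Union>b\<in>\<B>'. U b) \<inter> \<Inter>(\<Union>b\<in>\<B>. \<D> b) = f -` V \<inter> \<Inter>(\<Union>b\<in>\<B>. \<D> b)"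
          unfolding B'(2)[symmetric] by blast
      qed
    qed
  qed (use D in auto)
qed

section \<open>Finite approximations and generic sequences of natural numbers\<close>

definition agree :: "nat \<Rightarrow> (nat \<Rightarrow> 'a) \<Rightarrow> (nat \<Rightarrow> 'a) \<Rightarrow> bool"
  where "agree n y z \<longleftrightarrow> (\<forall>i<n. y i = z i)"

lemma agree_refl [simp]: "agree n z z" by (simp add: agree_def)
lemma agree_trans: "agree n x y \<Longrightarrow> agree m y z \<Longrightarrow> n \<le> m \<Longrightarrow> agree n x z" by (auto simp: agree_def)
lemma agree_mono: "agree m x y \<Longrightarrow> n \<le> m \<Longrightarrow> agree n x y" by (auto simp: agree_def)
lemma agree_extend: "agree m w y \<Longrightarrow> agree n y z \<Longrightarrow> n \<le> m \<Longrightarrow> agree n w z" by (auto simp: agree_def)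

lemma open_nat_seq_agree:
  fixes U :: "(nat \<Rightarrow> nat) set"
  assumes "open U" "z \<in> U"
  obtains n where "\<And>y. agree n y z \<Longrightarrow> y \<in> U"
proof -
  have "openin (product_topology (\<lambda>_. euclidean) UNIV) U" using assms by (simp add: open_fun_def)
  from product_topology_open_contains_basis[OF this assms(2)]
  obtain X where X: "z \<in> PiE UNIV X" "finite {i. X i \<noteq> topspace (euclidean :: nat topology)}"
    "PiE UNIV X \<subseteq> U" by blast
  then obtain n where n: "{i. X i \<noteq> UNIV} \<subseteq> {..<n}"
    using finite_nat_bounded[of "{i. X i \<noteq> UNIV}"] by auto
  have "y \<in> U" if "agree n y z" for y
  proof -
    have "y i \<in> X i" for i
    proof (cases "X i = UNIV")
      case False
      then have "i < n" using n by auto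
      then show ?thesis using that X(1) by (auto simp: agree_def PiE_iff)
    qed auto
    then show ?thesis using X(3) by (auto simp: PiE_iff subset_iff)
  qed
  then show ?thesis by (rule that)
qed

lemma open_agree: "open {y::nat \<Rightarrow> nat. agree n y z}"
proof -
  have "{y. agree n y z} = (\<Inter>i\<in>{..<n}. (\<lambda>y. y i) -` {z i})" by (auto simp: agree_def)
  also have "open \<dots>"
    by (intro open_INT open_vimage finite_lessThan ballI continuous_on_product_coordinates)
      (auto simp: open_discrete)
  finally show ?thesis .
qed

text \<open>A pair \<open>(n, z)\<close> stands for the condition that the first \<open>n\<close> values are those of \<open>z\<close>.\<close>

lemma agree_sequence:
  assumes R: "\<And>k n z. n0 \<le> n \<Longrightarrow> agree n0 z z0 \<Longrightarrow> \<exists>n' z'. n \<le> n' \<and> agree n z' z \<and> R (k::nat) n' z'"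
  obtains y :: "nat \<Rightarrow> nat" where "agree n0 y z0" "\<And>k. \<exists>n' z'. R k n' z' \<and> agree n' y z'"
proof -
  \<comment> \<open>\<open>Suc\<close> makes the determined initial segment grow at every stage, so
    the limit sequence is determined everywhere even when R demands no extension.\<close>
  define Q where "Q k s s' \<longleftrightarrow> Suc (fst s) \<le> fst s' \<and> agree (Suc (fst s)) (snd s') (snd s) \<and> R k (fst s') (snd s')"
    for k :: nat and s s' :: "nat \<times> (nat \<Rightarrow> nat)"
  have "\<exists>f. \<forall>k. ((k = 0 \<longrightarrow> f k = (n0, z0)) \<and> n0 \<le> fst (f k) \<and> agree n0 (snd (f k)) z0) \<and> Q k (f k) (f (Suc k))"
  proof (rule dependent_nat_choice)
    fix s :: "nat \<times> (nat \<Rightarrow> nat)" and k :: nat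
    assume s: "(k = 0 \<longrightarrow> s = (n0, z0)) \<and> n0 \<le> fst s \<and> agree n0 (snd s) z0"
    then obtain n' z' where *: "Suc (fst s) \<le> n'" "agree (Suc (fst s)) z' (snd s)" "R k n' z'"
      using R[of "Suc (fst s)" "snd s" k] by auto
    have "agree n0 z' z0" using s * by (meson agree_mono agree_trans le_SucI order_refl)
    then show "\<exists>s'. ((Suc k = 0 \<longrightarrow> s' = (n0, z0)) \<and> n0 \<le> fst s' \<and> agree n0 (snd s') z0) \<and> Q k s s'"
      using s * by (intro exI[of _ "(n', z')"]) (auto simp: Q_def)
  qed auto
  then obtain f where f: "f 0 = (n0, z0)" "\<And>k. Q k (f k) (f (Suc k))" by blast
  define n where "n k = fst (f k)" for k
  define z where "z k = snd (f k)" for k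
  have step: "Suc (n k) \<le> n (Suc k)" "agree (Suc (n k)) (z (Suc k)) (z k)" "R k (n (Suc k)) (z (Suc k))" for k
    using f(2)[of k] by (auto simp: Q_def n_def z_def)
  have sm: "strict_mono n" using step(1) by (simp add: strict_mono_Suc_iff Suc_le_eq)
  have chain: "agree (n j) (z k) (z j)" if "j \<le> k" for j k
    using that
  proof (induction k rule: dec_induct)
    case (step k)
    have "n j \<le> n k" using sm step by (simp add: strict_mono_less_eq)
    then have "agree (n j) (z (Suc k)) (z k)" using \<open>\<And>k. agree (Suc (n k)) (z (Suc k)) (z k)\<close>
      by (meson agree_mono le_SucI)
    then show ?case using step by (meson agree_trans order_refl)
  qed simp
  define y where "y i = z (Suc i) i" for i
  have y: "agree (n k) y (z k)" for k
    unfolding agree_def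
  proof (intro allI impI)
    fix i assume i: "i < n k"
    have i': "i < n (Suc i)" using seq_suble[OF sm, of "Suc i"] by simp
    show "y i = z k i"
    proof (cases "Suc i \<le> k")
      case True then show ?thesis using chain[OF True] i' by (simp add: y_def agree_def)
    next
      case False then show ?thesis using chain[of k "Suc i"] i by (simp add: y_def agree_def)
    qed
  qed
  show ?thesis
  proof (rule that)
    show "agree n0 y z0" using y[of 0] f(1) by (simp add: n_def z_def)
    show "\<exists>n' z'. R k n' z' \<and> agree n' y z'" for k using y[of "Suc k"] step(3)[of k] by blast
  qed
qed

text \<open>Finitely many requirements are met one after another; \<open>mono\<close> keeps the
  earlier ones in force under later extensions.\<close>

lemma agree_finite:
  assumes "finite A"
    and Q: "\<And>a n z. a \<in> A \<Longrightarrow> \<exists>n' z'. n \<le> n' \<and> agree n z' z \<and> Q a n' z'"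
    and mono: "\<And>a n z n' z'. Q a n z \<Longrightarrow> n \<le> n' \<Longrightarrow> agree n z' z \<Longrightarrow> Q a n' z'"
  shows "\<exists>n' z'. n \<le> n' \<and> agree n z' z \<and> (\<forall>a\<in>A. Q a n' z')"
  using assms(1) Q
proof (induction A)
  case (insert a A)
  then obtain n1 z1 where 1: "n \<le> n1" "agree n z1 z" "\<forall>a\<in>A. Q a n1 z1" by blast
  obtain n2 z2 where 2: "n1 \<le> n2" "agree n1 z2 z1" "Q a n2 z2"
    using insert.prems[of a n1 z1] by blast
  have "\<forall>a\<in>insert a A. Q a n2 z2" using 1 2 mono by blast
  moreover have "agree n z2 z" using 1 2 agree_trans[OF agree_mono, of n1 z2 z1 n n z] by simp
  ultimately show ?case using 1 2 by (meson order_trans)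
qed (use agree_refl in blast)

text \<open>Splits an input into reserved coordinates carrying a freely chosen pattern
  \<open>c\<close> and a background \<open>z\<close>, which is built once for all patterns.\<close>

definition override :: "nat set \<Rightarrow> (nat \<Rightarrow> nat) \<Rightarrow> (nat \<Rightarrow> nat) \<Rightarrow> nat \<Rightarrow> nat"
  where "override P c z j = (if j \<in> P then c j else z j)"

lemma agree_override: "agree n y z \<Longrightarrow> agree n (override P c y) (override P c z)"
  by (auto simp: agree_def override_def)

section \<open>Fusion of a generic background with free coordinates\<close>

locale generic_map = group_norm N
  for N :: "'h::{topological_ab_group_add, polish_space} \<Rightarrow> real" +
  fixes \<Theta> :: "(nat \<Rightarrow> nat) \<Rightarrow> nat \<Rightarrow> 'h" and D :: "nat \<Rightarrow> (nat \<Rightarrow> nat) set"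
  assumes open_D: "open (D k)" and dense_D: "closure (D k) = UNIV"
    and cont: "continuous_on (\<Inter>k. D k) \<Theta>"
    and finite_change: "(\<And>i. i \<ge> n \<Longrightarrow> y i = z i) \<Longrightarrow> convergent (\<lambda>m. \<Theta> y m - \<Theta> z m)"
begin

abbreviation "C \<equiv> \<Inter>k. D k"

lemma near:
  assumes "z \<in> C" "e > 0"
  obtains n where "\<And>y. y \<in> C \<Longrightarrow> agree n y z \<Longrightarrow> N (\<Theta> y m - \<Theta> z m) < e"
proof -
  have c: "continuous_on C (\<lambda>z. N (\<Theta> z m - \<Theta> w m))" for w
    by (intro continuous_on_compose2[OF continuous] continuous_intros
        continuous_on_product_then_coordinatewise[OF cont]) auto
  have "\<forall>V. open V \<longrightarrow> (\<exists>A. open A \<and> A \<inter> C = (\<lambda>y. N (\<Theta> y m - \<Theta> z m)) -` V \<inter> C)"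
    using c[of z] unfolding continuous_on_open_invariant .
  then obtain A where A: "open A" "A \<inter> C = (\<lambda>y. N (\<Theta> y m - \<Theta> z m)) -` {..<e} \<inter> C"
    by (meson open_lessThan)
  have "z \<in> A" using A(2) assms by auto
  with A(1) obtain n where "\<And>y. agree n y z \<Longrightarrow> y \<in> A" using open_nat_seq_agree by blast
  then show ?thesis using that[of n] A(2) by blast
qed

text \<open>Density of \<open>D k\<close> is applied at the overridden point; on P the values are
  afterwards reset to those of z, which the override hides.\<close>

lemma extend_into_D:
  assumes "finite P"
  shows "\<exists>n' z'. n \<le> n' \<and> agree n z' z \<and> (\<forall>y. agree n' y z' \<longrightarrow> override P c y \<in> D k)"
proof -
  obtain m0 where m0: "P \<subseteq> {..<m0}" using assms finite_nat_bounded by blast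
  define m where "m = max n m0"
  have "{y. agree m y (override P c z)} \<inter> D k \<noteq> {}"
    using open_Int_closure_eq_empty[OF open_agree, of m "override P c z" "D k"] dense_D[of k]
    by (metis UNIV_I agree_refl empty_iff inf_top_right mem_Collect_eq)
  then obtain w where w: "agree m w (override P c z)" "w \<in> D k" by blast
  obtain n1 where n1: "\<And>y. agree n1 y w \<Longrightarrow> y \<in> D k" using open_nat_seq_agree[OF open_D w(2)] by blast
  define z' where "z' j = (if j \<in> P then z j else w j)" for j
  show ?thesis
  proof (intro exI conjI allI impI)
    show "n \<le> max m n1" by (simp add: m_def)
    show "agree n z' z" using w(1) by (auto simp: agree_def z'_def override_def m_def)
    fix y assume y: "agree (max m n1) y z'"
    have "agree n1 (override P c y) w"
      using y w(1) m0 unfolding agree_def override_def z'_def m_def by (auto simp: subset_iff)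
    then show "override P c y \<in> D k" by (rule n1)
  qed
qed

text \<open>Choose w so that its override by c is generic. Continuity at this single point bounds
  the oscillation at the finitely many times m \<le> l on a whole cylinder.\<close>

lemma extend_osc:
  assumes "finite P" "e > 0"
  shows "\<exists>n' z'. n \<le> n' \<and> agree n z' z \<and> (\<forall>y y'. agree n' y z' \<longrightarrow> agree n' y' z' \<longrightarrow>
     override P c y \<in> C \<longrightarrow> override P c y' \<in> C \<longrightarrow>
     (\<forall>m\<le>l. N (\<Theta> (override P c y) m - \<Theta> (override P c y') m) \<le> e))"
proof -
  obtain w where w: "agree n w z" "\<And>k. \<exists>n' z'. (\<forall>y. agree n' y z' \<longrightarrow> override P c y \<in> D k) \<and> agree n' w z'"
    using agree_sequence[of n z "\<lambda>k n' z'. \<forall>y. agree n' y z' \<longrightarrow> override P c y \<in> D k"]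
      extend_into_D[OF assms(1)] by blast
  have wC: "override P c w \<in> C" using w(2) by blast
  have "\<exists>n1. \<forall>y. y \<in> C \<longrightarrow> agree n1 y (override P c w) \<longrightarrow> N (\<Theta> y m - \<Theta> (override P c w) m) < e / 2" for m
    using near[OF wC, of "e/2" m] assms(2) by (metis half_gt_zero)
  then obtain n1 where n1: "\<And>m y. y \<in> C \<Longrightarrow> agree (n1 m) y (override P c w) \<Longrightarrow> N (\<Theta> y m - \<Theta> (override P c w) m) < e / 2"
    by metis
  define n' where "n' = Max (insert n (n1 ` {..l}))"
  have n': "n \<le> n'" "\<And>m. m \<le> l \<Longrightarrow> n1 m \<le> n'" by (auto simp: n'_def intro!: Max_ge simp del: Max_insert)
  show ?thesis
  proof (intro exI conjI allI impI)
    fix y y' m assume y: "agree n' y w" "agree n' y' w" "override P c y \<in> C" "override P c y' \<in> C" "m \<le> l"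
    have "N (\<Theta> (override P c y) m - \<Theta> (override P c w) m) < e / 2"
      by (rule n1[OF y(3)]) (meson agree_override agree_mono y n')
    moreover have "N (\<Theta> (override P c y') m - \<Theta> (override P c w) m) < e / 2"
      by (rule n1[OF y(4)]) (meson agree_override agree_mono y n')
    ultimately show "N (\<Theta> (override P c y) m - \<Theta> (override P c y') m) \<le> e"
      using diff_triangle[of "\<Theta> (override P c y) m" "\<Theta> (override P c y') m" "\<Theta> (override P c w) m"]
        commute[of "\<Theta> (override P c w) m" "\<Theta> (override P c y') m"] by linarith
  qed (use n' w in auto)
qed

definition variation :: "(nat \<Rightarrow> nat) \<Rightarrow> (nat \<Rightarrow> nat) \<Rightarrow> nat \<Rightarrow> nat \<Rightarrow> real"
  where "variation y z m m' = N ((\<Theta> y m - \<Theta> z m) - (\<Theta> y m' - \<Theta> z m'))"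

lemma variation_near:
  assumes "y \<in> C" "z \<in> C" "variation y z m m' > e"
  obtains n where "\<And>y' z'. y' \<in> C \<Longrightarrow> z' \<in> C \<Longrightarrow> agree n y' y \<Longrightarrow> agree n z' z \<Longrightarrow> variation y' z' m m' > e"
proof -
  \<comment> \<open>A quarter of the slack above e for each of the four values of \<Theta> in
    \<open>variation\<close>.\<close>
  define s where "s = (variation y z m m' - e) / 4"
  have s: "s > 0" using assms by (simp add: s_def)
  obtain n1 where n1: "\<And>y'. y' \<in> C \<Longrightarrow> agree n1 y' y \<Longrightarrow> N (\<Theta> y' m - \<Theta> y m) < s" using near[OF assms(1) s] by blast
  obtain n2 where n2: "\<And>y'. y' \<in> C \<Longrightarrow> agree n2 y' y \<Longrightarrow> N (\<Theta> y' m' - \<Theta> y m') < s" using near[OF assms(1) s] by blast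
  obtain n3 where n3: "\<And>y'. y' \<in> C \<Longrightarrow> agree n3 y' z \<Longrightarrow> N (\<Theta> y' m - \<Theta> z m) < s" using near[OF assms(2) s] by blast
  obtain n4 where n4: "\<And>y'. y' \<in> C \<Longrightarrow> agree n4 y' z \<Longrightarrow> N (\<Theta> y' m' - \<Theta> z m') < s" using near[OF assms(2) s] by blast
  define n where "n = max (max n1 n2) (max n3 n4)"
  have "variation y' z' m m' > e" if h: "y' \<in> C" "z' \<in> C" "agree n y' y" "agree n z' z" for y' z'
  proof -
    have b: "N (\<Theta> y' m - \<Theta> y m) < s" "N (\<Theta> y' m' - \<Theta> y m') < s" "N (\<Theta> z' m - \<Theta> z m) < s" "N (\<Theta> z' m' - \<Theta> z m') < s"
      by (intro n1 n2 n3 n4 h agree_mono[OF h(3)] agree_mono[OF h(4)]; simp add: n_def)+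
    have eq: "(\<Theta> y m - \<Theta> z m) - (\<Theta> y m' - \<Theta> z m') - ((\<Theta> y' m - \<Theta> z' m) - (\<Theta> y' m' - \<Theta> z' m'))
      = ((\<Theta> z' m - \<Theta> z m) - (\<Theta> y' m - \<Theta> y m)) - ((\<Theta> z' m' - \<Theta> z m') - (\<Theta> y' m' - \<Theta> y m'))"
      by (simp add: algebra_simps)
    have "N ((\<Theta> y m - \<Theta> z m) - (\<Theta> y m' - \<Theta> z m') - ((\<Theta> y' m - \<Theta> z' m) - (\<Theta> y' m' - \<Theta> z' m'))) < 4 * s"
      unfolding eq using b
        diff_le[of "(\<Theta> z' m - \<Theta> z m) - (\<Theta> y' m - \<Theta> y m)" "(\<Theta> z' m' - \<Theta> z m') - (\<Theta> y' m' - \<Theta> y m')"]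
        diff_le[of "\<Theta> z' m - \<Theta> z m" "\<Theta> y' m - \<Theta> y m"] diff_le[of "\<Theta> z' m' - \<Theta> z m'" "\<Theta> y' m' - \<Theta> y m'"]
      by linarith
    then show ?thesis
      using abs_diff_le[of "(\<Theta> y m - \<Theta> z m) - (\<Theta> y m' - \<Theta> z m')" "(\<Theta> y' m - \<Theta> z' m) - (\<Theta> y' m' - \<Theta> z' m')"]
      unfolding variation_def s_def by (simp add: field_simps)
  qed
  then show ?thesis by (rule that)
qed

text \<open>Category argument. If no extension made the variation settle by a uniform time, every
  condition could be extended to force a variation above e at times later than k. A generic y
  meeting these demands for all k contradicts \<open>finite_change\<close>, since its two overrides
  differ in finitely many coordinates only.\<close>

lemma extend_variation:
  assumes "finite P" "e > 0"
  shows "\<exists>n' z'. n \<le> n' \<and> agree n z' z \<and> (\<exists>M. \<forall>y. agree n' y z' \<longrightarrow>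
     override P c y \<in> C \<longrightarrow> override P c' y \<in> C \<longrightarrow>
     (\<forall>m\<ge>M. \<forall>m'\<ge>M. variation (override P c y) (override P c' y) m m' \<le> e))"
proof (rule ccontr)
  assume "\<not> ?thesis"
  then have H: "\<exists>y. agree n' y z' \<and> override P c y \<in> C \<and> override P c' y \<in> C \<and>
      (\<exists>m\<ge>M. \<exists>m'\<ge>M. variation (override P c y) (override P c' y) m m' > e)"
    if "n \<le> n'" "agree n z' z" for n' z' M
    using that by (meson not_le)
  define R where "R k n' z' \<longleftrightarrow> (\<forall>y. agree n' y z' \<longrightarrow>
      (override P c y \<in> D k \<and> override P c' y \<in> D k) \<and> (override P c y \<in> C \<longrightarrow> override P c' y \<in> C \<longrightarrow>
      (\<exists>m\<ge>k. \<exists>m'\<ge>k. variation (override P c y) (override P c' y) m m' > e)))" for k n' z'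
  have R: "\<exists>n2 z2. n1 \<le> n2 \<and> agree n1 z2 z1 \<and> R k n2 z2" if n1: "n \<le> n1" "agree n z1 z" for k n1 z1
  proof -
    obtain y m m' where y: "agree n1 y z1" "override P c y \<in> C" "override P c' y \<in> C" "m \<ge> k" "m' \<ge> k"
      "variation (override P c y) (override P c' y) m m' > e"
      using H[OF n1] by blast
    obtain n3 where n3: "\<And>y' z'. y' \<in> C \<Longrightarrow> z' \<in> C \<Longrightarrow> agree n3 y' (override P c y) \<Longrightarrow> agree n3 z' (override P c' y) \<Longrightarrow> variation y' z' m m' > e"
      using variation_near[OF y(2,3,6)] by blast
    obtain n4 z4 where 4: "max n1 n3 \<le> n4" "agree (max n1 n3) z4 y" "\<And>w. agree n4 w z4 \<Longrightarrow> override P c w \<in> D k"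
      using extend_into_D[OF assms(1)] by blast
    obtain n5 z5 where 5: "n4 \<le> n5" "agree n4 z5 z4" "\<And>w. agree n5 w z5 \<Longrightarrow> override P c' w \<in> D k"
      using extend_into_D[OF assms(1)] by blast
    have w4: "agree n4 w z4" if "agree n5 w z5" for w using agree_extend[OF that 5(2,1)] .
    have w3: "agree (max n1 n3) w y" if "agree n5 w z5" for w using agree_extend[OF w4[OF that] 4(2,1)] .
    have "R k n5 z5" unfolding R_def
    proof (intro impI allI conjI)
      fix w assume w: "agree n5 w z5"
      show "override P c w \<in> D k" "override P c' w \<in> D k" using 4 5 w4 w by auto
      assume wC: "override P c w \<in> C" "override P c' w \<in> C"
      have "agree n3 w y" using w3[OF w] by (auto intro: agree_mono)
      then have "variation (override P c w) (override P c' w) m m' > e"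
        using n3[OF wC] agree_override by blast
      then show "\<exists>m\<ge>k. \<exists>m'\<ge>k. variation (override P c w) (override P c' w) m m' > e" using y by blast
    qed
    moreover have "agree n1 z5 z1" using agree_extend[OF w3[of z5] y(1)] by simp
    moreover have "n1 \<le> n5" using 4 5 by auto
    ultimately show ?thesis by blast
  qed
  obtain y where y: "agree n y z" "\<And>k. \<exists>n' z'. R k n' z' \<and> agree n' y z'"
    using agree_sequence[of n z R] R by blast
  have yC: "override P c y \<in> C" "override P c' y \<in> C" using y(2) unfolding R_def by blast+
  obtain n0 where n0: "P \<subseteq> {..<n0}" using assms(1) finite_nat_bounded by blast
  have "convergent (\<lambda>m. \<Theta> (override P c y) m - \<Theta> (override P c' y) m)"
    by (rule finite_change[of n0]) (use n0 in \<open>auto simp: override_def\<close>)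
  from convergent_CauchyD[OF this assms(2)] obtain M where
    "\<forall>m\<ge>M. \<forall>m'\<ge>M. variation (override P c y) (override P c' y) m m' < e" unfolding variation_def by blast
  then show False using y(2)[of M] yC unfolding R_def by (meson less_asym)
qed

text \<open>The order of the demands matters: the time l', after which variations are small, has to
  be fixed before the oscillation up to time l' can be made small.\<close>

lemma extend_stage:
  assumes P: "finite P" and Cs: "finite Cs" and e: "e > 0"
  obtains n' z' l' where "n \<le> n'" "agree n z' z" "l < l'"
    "\<And>c y. c \<in> Cs \<Longrightarrow> agree n' y z' \<Longrightarrow> override P c y \<in> D k"
    "\<And>c c' y m m'. c \<in> Cs \<Longrightarrow> c' \<in> Cs \<Longrightarrow> agree n' y z' \<Longrightarrow> override P c y \<in> C \<Longrightarrow> override P c' y \<in> C \<Longrightarrow>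
      l' \<le> m \<Longrightarrow> l' \<le> m' \<Longrightarrow> variation (override P c y) (override P c' y) m m' \<le> e"
    "\<And>c y y' m. c \<in> Cs \<Longrightarrow> agree n' y z' \<Longrightarrow> agree n' y' z' \<Longrightarrow> override P c y \<in> C \<Longrightarrow> override P c y' \<in> C \<Longrightarrow>
      m \<le> l' \<Longrightarrow> N (\<Theta> (override P c y) m - \<Theta> (override P c y') m) \<le> e"
proof -
  define Q1 where "Q1 p n' z' \<longleftrightarrow> (\<exists>M. \<forall>y. agree n' y z' \<longrightarrow>
     override P (fst p) y \<in> C \<longrightarrow> override P (snd p) y \<in> C \<longrightarrow>
     (\<forall>m\<ge>M. \<forall>m'\<ge>M. variation (override P (fst p) y) (override P (snd p) y) m m' \<le> e))" for p n' z'
  have "\<exists>n' z'. n \<le> n' \<and> agree n z' z \<and> (\<forall>a\<in>Cs \<times> Cs. Q1 a n' z')"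
  proof (rule agree_finite)
    fix a n z n' z' assume "Q1 a n z" "n \<le> n'" "agree n z' z"
    then show "Q1 a n' z'" unfolding Q1_def by (meson agree_mono agree_trans order_refl)
  qed (use Cs extend_variation[OF P e] in \<open>auto simp: Q1_def\<close>)
  then obtain n1 z1 where 1: "n \<le> n1" "agree n z1 z" "\<forall>a\<in>Cs \<times> Cs. Q1 a n1 z1" by blast
  then obtain M where M: "\<And>a y m m'. a \<in> Cs \<times> Cs \<Longrightarrow> agree n1 y z1 \<Longrightarrow>
     override P (fst a) y \<in> C \<Longrightarrow> override P (snd a) y \<in> C \<Longrightarrow> m \<ge> M a \<Longrightarrow> m' \<ge> M a \<Longrightarrow>
     variation (override P (fst a) y) (override P (snd a) y) m m' \<le> e" unfolding Q1_def by metis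
  define l' where "l' = Max (insert (Suc l) (M ` (Cs \<times> Cs)))"
  have l': "l < l'" "\<And>a. a \<in> Cs \<times> Cs \<Longrightarrow> M a \<le> l'"
    using Cs by (auto simp: l'_def Suc_le_eq[symmetric] intro!: Max_ge)
  define Q2 where "Q2 c n' z' \<longleftrightarrow> (\<forall>y. agree n' y z' \<longrightarrow> override P c y \<in> D k)" for c n' z'
  have "\<exists>n' z'. n1 \<le> n' \<and> agree n1 z' z1 \<and> (\<forall>c\<in>Cs. Q2 c n' z')"
  proof (rule agree_finite)
    fix a n z n' z' assume "Q2 a n z" "n \<le> n'" "agree n z' z"
    then show "Q2 a n' z'" unfolding Q2_def by (meson agree_mono agree_trans order_refl)
  qed (use Cs extend_into_D[OF P] in \<open>auto simp: Q2_def\<close>)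
  then obtain n2 z2 where 2: "n1 \<le> n2" "agree n1 z2 z1" "\<forall>a\<in>Cs. Q2 a n2 z2" by blast
  define Q3 where "Q3 c n' z' \<longleftrightarrow> (\<forall>y y'. agree n' y z' \<longrightarrow> agree n' y' z' \<longrightarrow>
     override P c y \<in> C \<longrightarrow> override P c y' \<in> C \<longrightarrow>
     (\<forall>m\<le>l'. N (\<Theta> (override P c y) m - \<Theta> (override P c y') m) \<le> e))" for c n' z'
  have "\<exists>n' z'. n2 \<le> n' \<and> agree n2 z' z2 \<and> (\<forall>c\<in>Cs. Q3 c n' z')"
  proof (rule agree_finite)
    fix a n z n' z' assume "Q3 a n z" "n \<le> n'" "agree n z' z"
    then show "Q3 a n' z'" unfolding Q3_def by (meson agree_mono agree_trans order_refl)
  qed (use Cs extend_osc[OF P e] in \<open>auto simp: Q3_def\<close>)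
  then obtain n3 z3 where 3: "n2 \<le> n3" "agree n2 z3 z2" "\<forall>a\<in>Cs. Q3 a n3 z3" by blast
  have a2: "agree n2 y z2" if "agree n3 y z3" for y using that 3 by (meson agree_mono agree_trans order_refl)
  have a1: "agree n1 y z1" if "agree n3 y z3" for y using a2[OF that] 2 by (meson agree_mono agree_trans order_refl)
  have a0: "agree n z3 z" using a1[of z3] 1 by (meson agree_mono agree_trans order_refl agree_refl)
  show ?thesis
  proof (rule that[of n3 z3 l'])
    show "n \<le> n3" "agree n z3 z" "l < l'" using 1 2 3 a0 l' by auto
    show "override P c y \<in> D k" if "c \<in> Cs" "agree n3 y z3" for c y
      using 2(3) a2 that by (auto simp: Q2_def)
    show "variation (override P c y) (override P c' y) m m' \<le> e"
      if "c \<in> Cs" "c' \<in> Cs" "agree n3 y z3" "override P c y \<in> C" "override P c' y \<in> C" "l' \<le> m" "l' \<le> m'" for c c' y m m'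
      using M[of "(c, c')" y m m'] l'(2)[of "(c, c')"] that a1 by auto
    show "N (\<Theta> (override P c y) m - \<Theta> (override P c y') m) \<le> e"
      if "c \<in> Cs" "agree n3 y z3" "agree n3 y' z3" "override P c y \<in> C" "override P c y' \<in> C" "m \<le> l'" for c y y' m
      using 3(3) that unfolding Q3_def by blast
  qed
qed

text \<open>Stage i reserves the position \<open>p i\<close>. For all patterns with values at most i
  on the positions reserved so far, the effect of past inputs has settled by time
  \<open>l (Suc i)\<close>, and future inputs are almost invisible up to that time. The restriction
  x i \<le> i keeps the number of patterns finite.\<close>

theorem block_form:
  obtains p l :: "nat \<Rightarrow> nat" and e where "strict_mono p" "strict_mono l"
    "\<And>x i. e x (p i) = x i"
    "\<And>x x' j. j \<notin> range p \<Longrightarrow> e x j = e x' j"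
    "\<And>x x' i m m'. \<lbrakk>\<And>i. x i \<le> i; \<And>i. x' i \<le> i; \<And>j. j \<ge> i \<Longrightarrow> x j = x' j; l i \<le> m; l i \<le> m'\<rbrakk> \<Longrightarrow>
       N ((\<Theta> (e x) m - \<Theta> (e x') m) - (\<Theta> (e x) m' - \<Theta> (e x') m')) \<le> (1/2)^i"
    "\<And>x x' i m. \<lbrakk>\<And>i. x i \<le> i; \<And>i. x' i \<le> i; \<And>j. j < i \<Longrightarrow> x j = x' j; m \<le> l i; i > 0\<rbrakk> \<Longrightarrow>
       N (\<Theta> (e x) m - \<Theta> (e x') m) \<le> (1/2)^i"
proof -
  define Cs where "Cs i P = {c::nat \<Rightarrow> nat. \<forall>x. (x \<in> P \<longrightarrow> c x \<in> {..i}) \<and> (x \<notin> P \<longrightarrow> c x = 0)}" for i P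
  define Q where "Q i s s' \<longleftrightarrow> (case s of (n, z, l, P) \<Rightarrow> case s' of (n', z', l', P') \<Rightarrow>
      P' = insert n P \<and> n < n' \<and> agree (Suc n) z' z \<and> l < l' \<and>
      (\<forall>c\<in>Cs i P'. \<forall>y. agree n' y z' \<longrightarrow> override P' c y \<in> D i) \<and>
      (\<forall>c\<in>Cs i P'. \<forall>c'\<in>Cs i P'. \<forall>y m m'. agree n' y z' \<longrightarrow> override P' c y \<in> C \<longrightarrow> override P' c' y \<in> C \<longrightarrow>
         l' \<le> m \<longrightarrow> l' \<le> m' \<longrightarrow> variation (override P' c y) (override P' c' y) m m' \<le> (1/2)^Suc i) \<and>
      (\<forall>c\<in>Cs i P'. \<forall>y y' m. agree n' y z' \<longrightarrow> agree n' y' z' \<longrightarrow> override P' c y \<in> C \<longrightarrow> override P' c y' \<in> C \<longrightarrow>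
         m \<le> l' \<longrightarrow> N (\<Theta> (override P' c y) m - \<Theta> (override P' c y') m) \<le> (1/2)^Suc i))"
    for i :: nat and s s' :: "nat \<times> (nat \<Rightarrow> nat) \<times> nat \<times> nat set"
  have "\<exists>f. \<forall>i. ((i = 0 \<longrightarrow> f i = (0, \<lambda>_. 0, 0, {})) \<and> finite (snd (snd (snd (f i))))) \<and> Q i (f i) (f (Suc i))"
  proof (rule dependent_nat_choice)
    fix s :: "nat \<times> (nat \<Rightarrow> nat) \<times> nat \<times> nat set" and i :: nat
    assume s: "(i = 0 \<longrightarrow> s = (0, \<lambda>_. 0, 0, {})) \<and> finite (snd (snd (snd s)))"
    obtain n z l P where sd: "s = (n, z, l, P)" by (cases s) auto
    have P: "finite (insert n P)" using s sd by simp
    have fin: "finite (Cs i (insert n P))" unfolding Cs_def by (rule finite_set_of_finite_funs[OF P]) simp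
    obtain n' z' l' where *: "Suc n \<le> n'" "agree (Suc n) z' z" "l < l'"
    "\<And>c y. c \<in> Cs i (insert n P) \<Longrightarrow> agree n' y z' \<Longrightarrow> override (insert n P) c y \<in> D i"
    "\<And>c c' y m m'. c \<in> Cs i (insert n P) \<Longrightarrow> c' \<in> Cs i (insert n P) \<Longrightarrow> agree n' y z' \<Longrightarrow> override (insert n P) c y \<in> C \<Longrightarrow> override (insert n P) c' y \<in> C \<Longrightarrow>
      l' \<le> m \<Longrightarrow> l' \<le> m' \<Longrightarrow> variation (override (insert n P) c y) (override (insert n P) c' y) m m' \<le> (1/2)^Suc i"
    "\<And>c y y' m. c \<in> Cs i (insert n P) \<Longrightarrow> agree n' y z' \<Longrightarrow> agree n' y' z' \<Longrightarrow> override (insert n P) c y \<in> C \<Longrightarrow> override (insert n P) c y' \<in> C \<Longrightarrow>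
      m \<le> l' \<Longrightarrow> N (\<Theta> (override (insert n P) c y) m - \<Theta> (override (insert n P) c y') m) \<le> (1/2)^Suc i"
      by (rule extend_stage[OF P fin, of "(1/2)^Suc i" "Suc n" z l i]) (simp, rule that)
    have "Q i s (n', z', l', insert n P)"
      unfolding Q_def sd using * by (simp del: power_Suc)
    then show "\<exists>s'. ((Suc i = 0 \<longrightarrow> s' = (0, \<lambda>_. 0, 0, {})) \<and> finite (snd (snd (snd s')))) \<and> Q i s s'"
      using P by (intro exI[of _ "(n', z', l', insert n P)"]) simp
  qed auto
  then obtain f where f0: "f 0 = (0, \<lambda>_. 0, 0, {})" and fQ: "\<And>i. Q i (f i) (f (Suc i))" by blast
  define p where "p i = fst (f i)" for i
  define z where "z i = fst (snd (f i))" for i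
  define l where "l i = fst (snd (snd (f i)))" for i
  define P where "P i = snd (snd (snd (f i)))" for i
  have fi: "f i = (p i, z i, l i, P i)" for i by (simp add: p_def z_def l_def P_def)
  note Qi = fQ[unfolded Q_def fi prod.case]
  have P_Suc: "P (Suc i) = insert (p i) (P i)" and p_less: "p i < p (Suc i)" and
    z_agree: "agree (Suc (p i)) (z (Suc i)) (z i)" and l_less: "l i < l (Suc i)" for i using Qi[of i] by blast+
  have sp: "strict_mono p" and sl: "strict_mono l" using p_less l_less by (simp_all add: strict_mono_Suc_iff)
  have P_eq: "P i = p ` {..<i}" for i
  proof (induction i)
    case 0 show ?case using f0 by (simp add: P_def)
  next
    case (Suc i) then show ?case by (simp add: P_Suc lessThan_Suc)
  qed
  have z_chain: "agree (Suc (p j)) (z k) (z j)" if "j \<le> k" for j k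
    using that
  proof (induction k rule: dec_induct)
    case (step k)
    have "Suc (p j) \<le> Suc (p k)" using sp step by (simp add: strict_mono_less_eq)
    then show ?case using agree_extend[OF z_agree[of k] step.IH] by simp
  qed simp
  \<comment> \<open>Coordinate j is final from stage Suc j on, because \<open>p (Suc j)\<close>
    exceeds j.\<close>
  define zl where "zl j = z (Suc j) j" for j
  have zl: "zl j = z k j" if "j < p k" for j k
  proof (cases "Suc j \<le> k")
    case True
    have "j < Suc (p (Suc j))" using seq_suble[OF sp, of "Suc j"] by simp
    then show ?thesis using z_chain[OF True] by (simp add: zl_def agree_def)
  next
    case False
    then show ?thesis using z_chain[of k "Suc j"] that by (simp add: zl_def agree_def)
  qed
  have inj: "inj p" using sp by (simp add: strict_mono_imp_inj_on)
  define e where "e x j = (if j \<in> range p then x (inv p j) else zl j)" for x :: "nat \<Rightarrow> nat" and j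
  have e_p: "e x (p i) = x i" for x i using inj by (simp add: e_def)
  define c where "c i x j = (if j \<in> P i then x (inv p j) else 0)" for i and x :: "nat \<Rightarrow> nat" and j
  have c_in: "c (Suc i) x \<in> Cs i (P (Suc i))" if "\<And>i. x i \<le> i" for i x
  proof -
    have "x k \<le> i" if "k < Suc i" for k using \<open>\<And>i. x i \<le> i\<close>[of k] that by simp
    then show ?thesis using inj by (auto simp: Cs_def c_def P_eq)
  qed
  \<comment> \<open>The background to which the estimates of the stage are applied. On
    \<open>P i\<close> it follows \<open>z i\<close>, so that it lies in the cylinder of the stage;
    the override then restores \<open>e x\<close>.\<close>
  define y where "y i x j = (if j \<in> P i then z i j else e x j)" for i x j
  have ov: "override (P i) (c i x) (y i x) = e x" for i x
    using inj by (auto simp: override_def c_def y_def e_def P_eq fun_eq_iff)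
  have y_agree: "agree (p i) (y i x) (z i)" for i x
    unfolding agree_def
  proof (intro allI impI)
    fix j assume j: "j < p i"
    show "y i x j = z i j"
    proof (cases "j \<in> range p")
      case True
      then have "j \<in> P i" using j sp by (auto simp: P_eq strict_mono_less)
      then show ?thesis by (simp add: y_def)
    next
      case False
      then show ?thesis using zl[OF j] by (simp add: y_def e_def)
    qed
  qed
  have eC: "e x \<in> C" if "\<And>i. x i \<le> i" for x
  proof
    fix i
    show "e x \<in> D i" using Qi[of i] c_in[OF that, of i] y_agree[of "Suc i" x] ov[of "Suc i" x] by metis
  qed
  show ?thesis
  proof (rule that[OF sp sl, of e])
    show "e x (p i) = x i" for x i by (rule e_p)
    show "e x j = e x' j" if "j \<notin> range p" for x x' j using that by (simp add: e_def)
  next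
    fix x x' i m m'
    assume x: "\<And>i. x i \<le> i" and x': "\<And>i. x' i \<le> i" and eq: "\<And>j. j \<ge> i \<Longrightarrow> x j = x' j" and m: "l i \<le> m" "l i \<le> m'"
    show "N ((\<Theta> (e x) m - \<Theta> (e x') m) - (\<Theta> (e x) m' - \<Theta> (e x') m')) \<le> (1/2)^i"
    proof (cases i)
      case 0
      then have "x = x'" using eq by auto
      then show ?thesis by simp
    next
      case (Suc k)
      have "y i x = y i x'"
      proof
        fix j
        show "y i x j = y i x' j"
        proof (cases "j \<in> range p")
          case True
          then obtain n where "j = p n" by blast
          then show ?thesis using eq[of n] inj by (cases "n < i") (auto simp: y_def P_eq e_p inj_image_mem_iff)
        qed (auto simp: y_def e_def)
      qed
      then have "override (P i) (c i x') (y i x) = e x'" using ov[of i x'] by simp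
      then have "variation (e x) (e x') m m' \<le> (1/2)^Suc k"
        using Qi[of k] c_in[OF x, of k] c_in[OF x', of k] y_agree[of i x] ov[of i x] eC[OF x] eC[OF x'] m
        unfolding Suc by metis
      then show ?thesis by (simp add: variation_def Suc)
    qed
  next
    fix x x' i m
    assume x: "\<And>i. x i \<le> i" and x': "\<And>i. x' i \<le> i" and eq: "\<And>j. j < i \<Longrightarrow> x j = x' j" and m: "m \<le> l i" "i > 0"
    then obtain k where k: "i = Suc k" by (cases i) auto
    have "c i x = c i x'" using eq inj by (auto simp: c_def P_eq fun_eq_iff)
    then have "override (P i) (c i x) (y i x') = e x'" using ov[of i x'] by simp
    then show "N (\<Theta> (e x) m - \<Theta> (e x') m) \<le> (1/2)^i"
      using Qi[of k] c_in[OF x, of k] y_agree[of i x] y_agree[of i x'] ov[of i x] eC[OF x] eC[OF x'] m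
      unfolding k by metis
  qed
qed

end

subsection \<open>Maps in block form\<close>

lemma convergent_sum_reindex:
  fixes f :: "nat \<Rightarrow> 'a::{topological_ab_group_add, metric_space}"
  assumes r: "strict_mono r" and f: "\<And>j. j \<notin> range r \<Longrightarrow> f j = 0"
  shows "convergent (\<lambda>n. \<Sum>i<n. f i) \<longleftrightarrow> convergent (\<lambda>n. \<Sum>i<n. f (r i))"
proof -
  have inj: "inj r" using r by (simp add: strict_mono_imp_inj_on)
  \<comment> \<open>Counts the indices i with r i < n.\<close>
  define \<kappa> where "\<kappa> n = (LEAST i. n \<le> r i)" for n
  have \<kappa>: "r i < n \<longleftrightarrow> i < \<kappa> n" for i n
  proof -
    have *: "n \<le> r (\<kappa> n)" unfolding \<kappa>_def by (rule LeastI[of _ n]) (rule seq_suble[OF r])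
    show ?thesis
    proof
      assume "r i < n"
      then have "r i < r (\<kappa> n)" using * by simp
      then show "i < \<kappa> n" using r by (simp add: strict_mono_less)
    next
      assume "i < \<kappa> n"
      then show "r i < n" unfolding \<kappa>_def using not_less_Least[of i "\<lambda>i. n \<le> r i"] by simp
    qed
  qed
  have F: "(\<Sum>i<n. f i) = (\<Sum>i<\<kappa> n. f (r i))" for n
  proof -
    have "(\<Sum>i<n. f i) = (\<Sum>i\<in>r ` {..<\<kappa> n}. f i)"
    proof (rule sum.mono_neutral_right)
      show "\<forall>i\<in>{..<n} - r ` {..<\<kappa> n}. f i = 0"
      proof
        fix i assume "i \<in> {..<n} - r ` {..<\<kappa> n}"
        then have "i \<notin> range r" using \<kappa> by auto
        then show "f i = 0" by (rule f)
      qed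
    qed (use \<kappa> in auto)
    also have "\<dots> = (\<Sum>i<\<kappa> n. f (r i))" by (rule sum.reindex_cong[OF inj_on_subset[OF inj]]) auto
    finally show ?thesis .
  qed
  have kr: "\<kappa> (r n) = n" for n
    using \<kappa>[of _ "r n"] r by (metis linorder_neq_iff strict_mono_less)
  have lim: "filterlim \<kappa> at_top sequentially"
    unfolding filterlim_at_top
  proof
    fix Z show "\<forall>\<^sub>F n in sequentially. Z \<le> \<kappa> n"
      unfolding eventually_sequentially
      by (rule exI[of _ "Suc (r Z)"]) (use \<kappa>[of Z] in \<open>auto simp: Suc_le_eq\<close>)
  qed
  show ?thesis
  proof
    assume "convergent (\<lambda>n. \<Sum>i<n. f i)"
    then have "convergent ((\<lambda>n. \<Sum>i<n. f i) \<circ> r)" by (rule convergent_subseq_convergent) (rule r)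
    then show "convergent (\<lambda>n. \<Sum>i<n. f (r i))" by (simp add: comp_def F kr)
  next
    assume "convergent (\<lambda>n. \<Sum>i<n. f (r i))"
    then obtain L where "(\<lambda>n. \<Sum>i<n. f (r i)) \<longlonglongrightarrow> L" by (auto simp: convergent_def)
    from filterlim_compose[OF this lim] show "convergent (\<lambda>n. \<Sum>i<n. f i)"
      by (auto simp: F convergent_def)
  qed
qed

definition diagonal_bounded :: "(nat \<Rightarrow> nat) \<Rightarrow> bool"
  where "diagonal_bounded x \<longleftrightarrow> (\<forall>i. x i \<le> i)"

text \<open>Serves to combine counterexamples living on successive blocks into one input. Between
  the blocks two glued inputs are both 0, so they cancel there.\<close>

lemma glue_blocks:
  assumes PQ: "\<And>r. P r \<le> Q r" "\<And>r. Q r \<le> P (Suc r)" and xs: "\<And>r. diagonal_bounded (xs r)"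
  obtains x where "diagonal_bounded x" "\<And>r i. P r \<le> i \<Longrightarrow> i < Q r \<Longrightarrow> x i = xs r i"
    "\<And>r i. Q r \<le> i \<Longrightarrow> i < P (Suc r) \<Longrightarrow> x i = 0"
proof -
  have mono: "P r \<le> P s" if "r \<le> s" for r s using that PQ by (meson lift_Suc_mono_le order_trans)
  have uniq: "r = s" if "P r \<le> i" "i < P (Suc r)" "P s \<le> i" "i < P (Suc s)" for r s i
  proof (rule ccontr)
    assume "r \<noteq> s"
    then have "Suc r \<le> s \<or> Suc s \<le> r" by auto
    then show False using mono[of "Suc r" s] mono[of "Suc s" r] that by auto
  qed
  define x where "x i = (if \<exists>r. P r \<le> i \<and> i < Q r then xs (SOME r. P r \<le> i \<and> i < Q r) i else 0)" for i
  show ?thesis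
  proof (rule that)
    show "diagonal_bounded x" using xs by (auto simp: diagonal_bounded_def x_def)
    show "x i = xs r i" if "P r \<le> i" "i < Q r" for r i
    proof -
      have "P (SOME r. P r \<le> i \<and> i < Q r) \<le> i \<and> i < Q (SOME r. P r \<le> i \<and> i < Q r)"
        by (rule someI[of _ r]) (use that in auto)
      then have "(SOME r. P r \<le> i \<and> i < Q r) = r" using uniq that PQ(2) by (meson order_less_le_trans)
      then show ?thesis using that by (auto simp: x_def)
    qed
    show "x i = 0" if "Q r \<le> i" "i < P (Suc r)" for r i
    proof -
      have "\<not> (P s \<le> i \<and> i < Q s)" for s
      proof
        assume s: "P s \<le> i \<and> i < Q s"
        have "r = s" by (rule uniq[of r i s]) (use s that PQ(1)[of r] PQ(2)[of s] in linarith)+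
        then show False using s that by simp
      qed
      then show ?thesis unfolding x_def by (subst if_not_P) blast+
    qed
  qed
qed

definition pt :: "nat \<Rightarrow> nat \<Rightarrow> nat \<Rightarrow> nat" where "pt i a j = (if j = i then a else 0)"

lemma diagonal_bounded_pt: "a \<le> i \<Longrightarrow> diagonal_bounded (pt i a)"
  by (simp add: diagonal_bounded_def pt_def)

section \<open>Transfer of smallness between source series and their images\<close>

locale block_map = H: group_norm N + G: group_norm M
  for N :: "'h::{topological_ab_group_add, polish_space} \<Rightarrow> real"
    and M :: "'g::{topological_ab_group_add, polish_space} \<Rightarrow> real" +
  fixes d :: "nat \<Rightarrow> 'g" and \<Psi> :: "(nat \<Rightarrow> nat) \<Rightarrow> nat \<Rightarrow> 'h" and l :: "nat \<Rightarrow> nat"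
  assumes l: "strict_mono l" and d_0: "d 0 = 0"
    and d_add: "\<exists>c. d c = d a + d b" and d_minus: "\<exists>c. d c = - d a"
    and d_dense: "closure (range d) = UNIV" and conn: "connected (UNIV :: 'g set)"
    and tail: "\<lbrakk>diagonal_bounded x; diagonal_bounded x'; \<And>j. j \<ge> i \<Longrightarrow> x j = x' j; l i \<le> m; l i \<le> m'\<rbrakk> \<Longrightarrow>
       N ((\<Psi> x m - \<Psi> x' m) - (\<Psi> x m' - \<Psi> x' m')) \<le> (1/2)^i"
    and head: "\<lbrakk>diagonal_bounded x; diagonal_bounded x'; \<And>j. j < i \<Longrightarrow> x j = x' j; m \<le> l i; i > 0\<rbrakk> \<Longrightarrow>
       N (\<Psi> x m - \<Psi> x' m) \<le> (1/2)^i"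
    and reduction: "\<lbrakk>diagonal_bounded x; diagonal_bounded x'\<rbrakk> \<Longrightarrow>
       convergent (\<lambda>n. \<Sum>i<n. d (x i) - d (x' i)) \<longleftrightarrow> convergent (\<lambda>m. \<Psi> x m - \<Psi> x' m)"
begin

text \<open>Compare through the hybrid u that follows x before q and y from q on. Then x and u first
  differ at q or later, which costs \<open>head\<close> at both times, while u and y differ only
  before p, which costs \<open>tail\<close> once: three errors in all.\<close>

lemma local:
  assumes x: "diagonal_bounded x" and y: "diagonal_bounded y" and eq: "\<And>i. p \<le> i \<Longrightarrow> i < q \<Longrightarrow> x i = y i"
    and m: "l p \<le> m" "m \<le> l q" "l p \<le> m'" "m' \<le> l q"
  shows "N ((\<Psi> x m - \<Psi> x m') - (\<Psi> y m - \<Psi> y m')) \<le> 3 * (1/2)^p"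
proof (cases "p < q")
  case False
  then have "m = m'" using m l by (metis le_antisym linorder_not_less order_trans strict_mono_less_eq)
  then show ?thesis by simp
next
  case True
  define u where "u i = (if i < q then x i else y i)" for i
  have u: "diagonal_bounded u" using x y by (simp add: diagonal_bounded_def u_def)
  have pq: "(1/2::real)^q \<le> (1/2)^p" using True by (intro power_decreasing) auto
  have 1: "N (\<Psi> x m - \<Psi> u m) \<le> (1/2)^q" "N (\<Psi> x m' - \<Psi> u m') \<le> (1/2)^q"
    using True m by (auto intro!: head x u simp: u_def)
  have 2: "N ((\<Psi> u m - \<Psi> y m) - (\<Psi> u m' - \<Psi> y m')) \<le> (1/2)^p"
    using m eq by (intro tail u y) (auto simp: u_def)
  have e: "(\<Psi> x m - \<Psi> x m') - (\<Psi> y m - \<Psi> y m') =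
     ((\<Psi> x m - \<Psi> u m) - (\<Psi> x m' - \<Psi> u m')) + ((\<Psi> u m - \<Psi> y m) - (\<Psi> u m' - \<Psi> y m'))"
    by (simp add: algebra_simps)
  show ?thesis unfolding e using 1 2 pq H.triangle[of "(\<Psi> x m - \<Psi> u m) - (\<Psi> x m' - \<Psi> u m')" "(\<Psi> u m - \<Psi> y m) - (\<Psi> u m' - \<Psi> y m')"]
      H.diff_le[of "\<Psi> x m - \<Psi> u m" "\<Psi> x m' - \<Psi> u m'"] by linarith
qed

definition inc :: "(nat \<Rightarrow> nat) \<Rightarrow> (nat \<Rightarrow> nat) \<Rightarrow> nat \<Rightarrow> nat \<Rightarrow> 'h"
  where "inc x x' m' m = (\<Psi> x m - \<Psi> x' m) - (\<Psi> x m' - \<Psi> x' m')"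

lemma inc_local:
  assumes "diagonal_bounded x" "diagonal_bounded y" "diagonal_bounded x'" "diagonal_bounded y'"
    "\<And>i. p \<le> i \<Longrightarrow> i < q \<Longrightarrow> x i = y i" "\<And>i. p \<le> i \<Longrightarrow> i < q \<Longrightarrow> x' i = y' i"
    "l p \<le> m" "m \<le> l q" "l p \<le> m'" "m' \<le> l q"
  shows "N (inc x x' m' m - inc y y' m' m) \<le> 6 * (1/2)^p"
proof -
  have e: "inc x x' m' m - inc y y' m' m =
    ((\<Psi> x m - \<Psi> x m') - (\<Psi> y m - \<Psi> y m')) - ((\<Psi> x' m - \<Psi> x' m') - (\<Psi> y' m - \<Psi> y' m'))"
    by (simp add: inc_def algebra_simps)
  show ?thesis unfolding e
    using local[OF assms(1,2,5,7,8,9,10)] local[OF assms(3,4,6,7,8,9,10)]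
      H.diff_le[of "(\<Psi> x m - \<Psi> x m') - (\<Psi> y m - \<Psi> y m')" "(\<Psi> x' m - \<Psi> x' m') - (\<Psi> y' m - \<Psi> y' m')"]
    by linarith
qed

lemma inc_zero_block:
  assumes "diagonal_bounded x" "diagonal_bounded x'" "\<And>i. p \<le> i \<Longrightarrow> i < q \<Longrightarrow> x i = x' i"
    "l p \<le> m" "m \<le> l q" "l p \<le> m'" "m' \<le> l q"
  shows "N (inc x x' m' m) \<le> 3 * (1/2)^p"
  using local[OF assms] by (simp add: inc_def algebra_simps)

text \<open>Failures that occur beyond every index and at every tolerance can be lined up on
  successive blocks with tolerances (1/2)^r, ready for gluing.\<close>

lemma block_sequence:
  assumes bad: "\<And>(e::real) (n::nat). e > 0 \<Longrightarrow> \<exists>(p::nat) q x x'. n \<le> p \<and> p < q \<and> diagonal_bounded x \<and> diagonal_bounded x' \<and> R e p q x x'"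
  obtains P Q xs xs' where "strict_mono P" "\<And>r. P r < Q r" "\<And>r. Q r \<le> P (Suc r)"
    "\<And>r. diagonal_bounded (xs r)" "\<And>r. diagonal_bounded (xs' r)" "\<And>r. R ((1/2)^r) (P r) (Q r) (xs r) (xs' r)"
proof -
  define ok where "ok r s \<longleftrightarrow> (case s of (p, q, x, x') \<Rightarrow> p < q \<and> diagonal_bounded x \<and> diagonal_bounded x' \<and> R ((1/2)^r) p q x x')"
    for r :: nat and s :: "nat \<times> nat \<times> (nat \<Rightarrow> nat) \<times> (nat \<Rightarrow> nat)"
  have "\<exists>f. \<forall>r. ok r (f r) \<and> fst (snd (f r)) \<le> fst (f (Suc r))"
  proof (rule dependent_nat_choice)
    show "\<exists>s. ok 0 s" using bad[of 1 0] by (auto simp: ok_def)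
    show "\<exists>s'. ok (Suc r) s' \<and> fst (snd s) \<le> fst s'" for r and s :: "nat \<times> nat \<times> (nat \<Rightarrow> nat) \<times> (nat \<Rightarrow> nat)"
      using bad[of "(1/2)^Suc r" "fst (snd s)"] by (fastforce simp: ok_def)
  qed
  then obtain f where f: "\<And>r. ok r (f r)" "\<And>r. fst (snd (f r)) \<le> fst (f (Suc r))" by blast
  show ?thesis
  proof (rule that[of "\<lambda>r. fst (f r)" "\<lambda>r. fst (snd (f r))" "\<lambda>r. fst (snd (snd (f r)))" "\<lambda>r. snd (snd (snd (f r)))"])
    have *: "fst (f r) < fst (snd (f r))" for r using f(1)[of r] by (auto simp: ok_def split: prod.splits)
    then show "fst (f r) < fst (snd (f r))" for r .
    show "strict_mono (\<lambda>r. fst (f r))" unfolding strict_mono_Suc_iff using * f(2) by (meson order_less_le_trans)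
    show "diagonal_bounded (fst (snd (snd (f r))))" "diagonal_bounded (snd (snd (snd (f r))))"
      "R ((1/2)^r) (fst (f r)) (fst (snd (f r))) (fst (snd (snd (f r)))) (snd (snd (snd (f r))))" for r
      using f(1)[of r] by (auto simp: ok_def split: prod.splits)
  qed (rule f(2))
qed

lemma half_power_le: "r \<le> p \<Longrightarrow> (1/2::real)^p \<le> (1/2)^r"
  by (intro power_decreasing) auto

lemma half_power_small: "(0::real) < e \<Longrightarrow> \<exists>n. \<forall>p\<ge>n. c * (1/2)^p < e"
proof -
  assume e: "e > 0"
  have "(\<lambda>p. c * (1/2::real)^p) \<longlonglongrightarrow> c * 0" by (intro tendsto_intros) auto
  then have "\<forall>\<^sub>F p in sequentially. c * (1/2)^p < e" using order_tendstoD(2)[of _ "0::real"] e by simp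
  then show ?thesis by (simp add: eventually_sequentially)
qed

lemma diff_sum_lessThan: "(p::nat) \<le> m \<Longrightarrow> (\<Sum>i<m. f i) - (\<Sum>i<p. f i) = (\<Sum>i=p..<m. f i :: 'z::ab_group_add)"
  using sum_diff_nat_ivl[of 0 p m f] by (simp add: lessThan_atLeast0)

text \<open>Otherwise glue failures with tolerances (1/2)^r. The glued source series converges
  because its variations are summable, whereas its image varies by nearly \<epsilon> on arbitrarily
  late blocks.\<close>

lemma small_image:
  assumes "\<epsilon> > 0"
  shows "\<exists>\<delta>>0. \<exists>n. \<forall>p q x x'. n \<le> p \<longrightarrow> p \<le> q \<longrightarrow> diagonal_bounded x \<longrightarrow> diagonal_bounded x' \<longrightarrow>
    (\<forall>k\<in>{p..q}. M (\<Sum>i=p..<k. d (x i) - d (x' i)) < \<delta>) \<longrightarrow> (\<forall>m\<in>{l p..l q}. N (inc x x' (l p) m) \<le> \<epsilon>)"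
proof (rule ccontr)
  assume neg: "\<not> ?thesis"
  define R where "R \<delta> p q x x' \<longleftrightarrow> (\<forall>k\<in>{p..q}. M (\<Sum>i=p..<k. d (x i) - d (x' i)) < \<delta>) \<and> (\<exists>m\<in>{l p..l q}. \<not> N (inc x x' (l p) m) \<le> \<epsilon>)"
    for \<delta> p q x x'
  have bad: "\<exists>p q x x'. n \<le> p \<and> p < q \<and> diagonal_bounded x \<and> diagonal_bounded x' \<and> R \<delta> p q x x'" if pos: "\<delta> > 0" for \<delta> n
  proof -
    obtain p q x x' where *: "n \<le> p" "p \<le> q" "diagonal_bounded x" "diagonal_bounded x'" "R \<delta> p q x x'"
      using neg pos unfolding R_def by blast
    have "p \<noteq> q" using *(5) assms by (auto simp: R_def inc_def)
    then show ?thesis using * by (metis le_neq_implies_less)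
  qed
  obtain P Q xs xs' where P: "strict_mono P" "\<And>r. P r < Q r" "\<And>r. Q r \<le> P (Suc r)"
    "\<And>r. diagonal_bounded (xs r)" "\<And>r. diagonal_bounded (xs' r)" "\<And>r. R ((1/2)^r) (P r) (Q r) (xs r) (xs' r)"
    using block_sequence[of R] bad by blast
  obtain x where x: "diagonal_bounded x" "\<And>r i. P r \<le> i \<Longrightarrow> i < Q r \<Longrightarrow> x i = xs r i" "\<And>r i. Q r \<le> i \<Longrightarrow> i < P (Suc r) \<Longrightarrow> x i = 0"
    using glue_blocks[of P Q xs] P(3,4) less_imp_le[OF P(2)] by blast
  obtain x' where x': "diagonal_bounded x'" "\<And>r i. P r \<le> i \<Longrightarrow> i < Q r \<Longrightarrow> x' i = xs' r i" "\<And>r i. Q r \<le> i \<Longrightarrow> i < P (Suc r) \<Longrightarrow> x' i = 0"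
    using glue_blocks[of P Q xs'] P(3,5) less_imp_le[OF P(2)] by blast
  have "convergent (\<lambda>n. \<Sum>i<n. d (x i) - d (x' i))"
  proof (rule G.convergent_breakpoints[OF P(1), of "\<lambda>r. (1/2)^r"])
    show "summable (\<lambda>r. (1/2::real)^r)" by (rule summable_geometric) simp
    fix r m assume m: "P r \<le> m" "m \<le> P (Suc r)"
    have "(\<Sum>i=P r..<m. d (x i) - d (x' i)) = (\<Sum>i=P r..<min m (Q r). d (x i) - d (x' i))"
    proof (rule sum.mono_neutral_right)
      show "\<forall>i\<in>{P r..<m} - {P r..<min m (Q r)}. d (x i) - d (x' i) = 0"
        using x(3)[of r] x'(3)[of r] m by auto
    qed auto
    also have "\<dots> = (\<Sum>i=P r..<min m (Q r). d (xs r i) - d (xs' r i))"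
      using x(2)[of r] x'(2)[of r] by (intro sum.cong) auto
    finally have "M (\<Sum>i=P r..<m. d (x i) - d (x' i)) < (1/2)^r"
      using P(6)[of r] m P(2)[of r] by (auto simp: R_def)
    then show "M ((\<Sum>i<m. d (x i) - d (x' i)) - (\<Sum>i<P r. d (x i) - d (x' i))) \<le> (1/2)^r"
      using m by (simp add: diff_sum_lessThan)
  qed
  then have "convergent (\<lambda>m. \<Psi> x m - \<Psi> x' m)" using reduction[OF x(1) x'(1)] by simp
  from H.convergent_CauchyD[OF this, of "\<epsilon>/2"] assms obtain m0 where
    m0: "\<And>m m'. m \<ge> m0 \<Longrightarrow> m' \<ge> m0 \<Longrightarrow> N (inc x x' m' m) < \<epsilon> / 2" unfolding inc_def by auto
  obtain n where n: "\<And>p. p \<ge> n \<Longrightarrow> 6 * (1/2::real)^p < \<epsilon> / 2" using half_power_small[of "\<epsilon>/2" 6] assms by auto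
  define r where "r = max n m0"
  have Pr: "P r \<ge> n" "l (P r) \<ge> m0" using seq_suble[OF P(1), of r] seq_suble[OF l, of "P r"] by (auto simp: r_def)
  obtain m where m: "m \<in> {l (P r)..l (Q r)}" "N (inc (xs r) (xs' r) (l (P r)) m) > \<epsilon>" using P(6)[of r] by (auto simp: R_def)
  have "N (inc x x' (l (P r)) m - inc (xs r) (xs' r) (l (P r)) m) \<le> 6 * (1/2)^P r"
    by (rule inc_local[OF x(1) P(4) x'(1) P(5), of "P r" "Q r"]) (use x(2) x'(2) m P(2)[of r] l in \<open>auto simp: strict_mono_less_eq less_imp_le\<close>)
  then show False
    using m(2) m0[of m "l (P r)"] m(1) Pr n[OF Pr(1)]
      H.abs_diff_le[of "inc x x' (l (P r)) m" "inc (xs r) (xs' r) (l (P r)) m"] by auto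
qed

text \<open>The mirror argument: glued failures have an image of summable variation, so the source
  series converges and its sum over a late block must be small.\<close>

lemma small_preimage:
  assumes "\<rho> > 0"
  shows "\<exists>\<epsilon>>0. \<exists>n. \<forall>p q x x'. n \<le> p \<longrightarrow> p \<le> q \<longrightarrow> diagonal_bounded x \<longrightarrow> diagonal_bounded x' \<longrightarrow>
    (\<forall>m\<in>{l p..l q}. N (inc x x' (l p) m) < \<epsilon>) \<longrightarrow> M (\<Sum>i=p..<q. d (x i) - d (x' i)) < \<rho>"
proof (rule ccontr)
  assume neg: "\<not> ?thesis"
  define R where "R \<epsilon> p q x x' \<longleftrightarrow> (\<forall>m\<in>{l p..l q}. N (inc x x' (l p) m) < \<epsilon>) \<and> \<not> M (\<Sum>i=p..<q. d (x i) - d (x' i)) < \<rho>"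
    for \<epsilon> p q x x'
  have bad: "\<exists>p q x x'. n \<le> p \<and> p < q \<and> diagonal_bounded x \<and> diagonal_bounded x' \<and> R \<epsilon> p q x x'" if pos: "\<epsilon> > 0" for \<epsilon> n
  proof -
    obtain p q x x' where *: "n \<le> p" "p \<le> q" "diagonal_bounded x" "diagonal_bounded x'" "R \<epsilon> p q x x'"
      using neg pos unfolding R_def by blast
    have "p \<noteq> q" using *(5) assms by (auto simp: R_def inc_def)
    then show ?thesis using * by (metis le_neq_implies_less)
  qed
  obtain P Q xs xs' where P: "strict_mono P" "\<And>r. P r < Q r" "\<And>r. Q r \<le> P (Suc r)"
    "\<And>r. diagonal_bounded (xs r)" "\<And>r. diagonal_bounded (xs' r)" "\<And>r. R ((1/2)^r) (P r) (Q r) (xs r) (xs' r)"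
    using block_sequence[of R] bad by blast
  obtain x where x: "diagonal_bounded x" "\<And>r i. P r \<le> i \<Longrightarrow> i < Q r \<Longrightarrow> x i = xs r i" "\<And>r i. Q r \<le> i \<Longrightarrow> i < P (Suc r) \<Longrightarrow> x i = 0"
    using glue_blocks[of P Q xs] P(3,4) less_imp_le[OF P(2)] by blast
  obtain x' where x': "diagonal_bounded x'" "\<And>r i. P r \<le> i \<Longrightarrow> i < Q r \<Longrightarrow> x' i = xs' r i" "\<And>r i. Q r \<le> i \<Longrightarrow> i < P (Suc r) \<Longrightarrow> x' i = 0"
    using glue_blocks[of P Q xs'] P(3,5) less_imp_le[OF P(2)] by blast
  have "convergent (\<lambda>m. \<Psi> x m - \<Psi> x' m)"
  \<comment> \<open>10 = 1 + 6 + 3: the tolerance of the block, the comparison of the glued with the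
    original inputs, and the gap up to the next block.\<close>
  proof (rule H.convergent_breakpoints[of "\<lambda>r. l (P r)" "\<lambda>r. 10 * (1/2)^r"])
    show "strict_mono (\<lambda>r. l (P r))" using P(1) l by (simp add: strict_mono_def)
    show "summable (\<lambda>r. 10 * (1/2::real)^r)" by (intro summable_mult summable_geometric) simp
    fix r m assume m: "l (P r) \<le> m" "m \<le> l (P (Suc r))"
    have lPQ: "l (P r) \<le> l (Q r)" "l (Q r) \<le> l (P (Suc r))" using P(2)[of r] P(3)[of r] l by (simp_all add: strict_mono_less_eq)
    have r: "(1/2::real)^P r \<le> (1/2)^r" "(1/2::real)^Q r \<le> (1/2)^r"
      using seq_suble[OF P(1), of r] P(2)[of r] by (auto intro!: half_power_le)
    have blk: "N (inc x x' (l (P r)) m) \<le> 7 * (1/2)^r" if m: "l (P r) \<le> m" "m \<le> l (Q r)" for m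
    proof -
      have "N (inc x x' (l (P r)) m - inc (xs r) (xs' r) (l (P r)) m) \<le> 6 * (1/2)^P r"
        by (rule inc_local[OF x(1) P(4) x'(1) P(5), of "P r" "Q r"]) (use x(2) x'(2) m lPQ in auto)
      moreover have "N (inc (xs r) (xs' r) (l (P r)) m) < (1/2)^r" using P(6)[of r] m by (auto simp: R_def)
      ultimately show ?thesis using r
          H.abs_diff_le[of "inc x x' (l (P r)) m" "inc (xs r) (xs' r) (l (P r)) m"] by linarith
    qed
    have "N (inc x x' (l (P r)) m) \<le> 10 * (1/2)^r"
    proof (cases "m \<le> l (Q r)")
      case True
      then show ?thesis using blk[OF m(1) True] zero_le_power[of "1/2::real" r] by linarith
    next
      case False
      have "N (inc x x' (l (Q r)) m) \<le> 3 * (1/2)^Q r"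
        by (rule inc_zero_block[OF x(1) x'(1), of "Q r" "P (Suc r)"]) (use x(3) x'(3) m False lPQ in auto)
      moreover have "inc x x' (l (P r)) m = inc x x' (l (P r)) (l (Q r)) + inc x x' (l (Q r)) m"
        by (simp add: inc_def algebra_simps)
      ultimately show ?thesis using blk[of "l (Q r)", OF lPQ(1) order_refl] r
          H.triangle[of "inc x x' (l (P r)) (l (Q r))" "inc x x' (l (Q r)) m"] by (simp only:)
    qed
    then show "N ((\<Psi> x m - \<Psi> x' m) - (\<Psi> x (l (P r)) - \<Psi> x' (l (P r)))) \<le> 10 * (1/2)^r"
      by (simp add: inc_def)
  qed
  then have "convergent (\<lambda>n. \<Sum>i<n. d (x i) - d (x' i))" using reduction[OF x(1) x'(1)] by simp
  from G.convergent_CauchyD[OF this assms] obtain m0 where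
    m0: "\<And>m m'. m \<ge> m0 \<Longrightarrow> m' \<ge> m0 \<Longrightarrow> M ((\<Sum>i<m. d (x i) - d (x' i)) - (\<Sum>i<m'. d (x i) - d (x' i))) < \<rho>" by auto
  have "M ((\<Sum>i<Q m0. d (x i) - d (x' i)) - (\<Sum>i<P m0. d (x i) - d (x' i))) < \<rho>"
    using seq_suble[OF P(1), of m0] P(2)[of m0] by (intro m0) auto
  moreover have "(\<Sum>i<Q m0. d (x i) - d (x' i)) - (\<Sum>i<P m0. d (x i) - d (x' i)) = (\<Sum>i=P m0..<Q m0. d (xs m0 i) - d (xs' m0 i))"
    using P(2)[of m0] x(2)[of m0] x'(2)[of m0] by (simp add: diff_sum_lessThan)
  ultimately show False using P(6)[of m0] by (simp add: R_def)
qed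

lemma dense: "r > 0 \<Longrightarrow> \<exists>b. M (d b - g) < r"
proof -
  assume r: "r > 0"
  have "g \<in> closure (range d)" using d_dense by simp
  moreover have "open {y. M (y - g) < r}" by (rule G.open_ball)
  ultimately show ?thesis using r by (auto simp: closure_iff_nhds_not_empty dest!: spec[of _ "{y. M (y - g) < r}"])
qed

text \<open>Connectedness as induction along chains. The balls of radius \<delta> / 2 around the
  points satisfying P form an open set W. A point within \<delta> / 4 of W has a dense point within
  \<delta> / 4, which is reached by a step shorter than \<delta> / 2 + \<delta> / 4 + \<delta> / 4;
  hence W is closed as well.\<close>

lemma step_induct:
  assumes "\<delta> > 0" "P 0" and step: "\<And>a b. P a \<Longrightarrow> M (d b - d a) < \<delta> \<Longrightarrow> P b"
  shows "P c"
proof -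
  define W where "W = (\<Union>a\<in>{a. P a}. {g. M (g - d a) < \<delta> / 2})"
  have oW: "open W" unfolding W_def by (intro open_UN ballI G.open_ball)
  have near: "g \<in> W" if "g' \<in> W" "M (g' - g) < \<delta> / 4" for g g'
  proof -
    obtain a where a: "P a" "M (g' - d a) < \<delta> / 2" using \<open>g' \<in> W\<close> by (auto simp: W_def)
    obtain b where b: "M (d b - g) < \<delta> / 4" using dense[of "\<delta>/4"] assms(1) by auto
    have "M (d b - d a) < \<delta>"
      using G.diff_triangle[of "d b" "d a" g] G.diff_triangle[of g "d a" g'] a b that(2) G.commute[of g g'] assms(1) by linarith
    then have "P b" using step a by blast
    moreover have "M (g - d b) < \<delta> / 2" using b G.commute[of g "d b"] assms(1) by linarith
    ultimately show ?thesis by (auto simp: W_def)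
  qed
  have "open (- W)"
  proof (subst open_subopen, intro ballI)
    fix g assume g: "g \<in> - W"
    show "\<exists>T. open T \<and> g \<in> T \<and> T \<subseteq> - W"
      by (intro exI[of _ "{y. M (y - g) < \<delta> / 4}"] conjI G.open_ball) (use g near assms(1) in auto)
  qed
  moreover have "0 \<in> W" using assms(1,2) d_0 by (force simp: W_def)
  ultimately have "W = UNIV" using conn oW by (auto simp: connected_clopen closed_def)
  then obtain a where "P a" "M (d c - d a) < \<delta> / 2" by (auto simp: W_def set_eq_iff)
  then show ?thesis using step[of a c] assms(1) by auto
qed

end

lemma compact_pointwise_product:
  fixes C :: "'i \<Rightarrow> 'a::topological_space set"
  assumes "\<And>i. compact (C i)"
  shows "compact {f. \<forall>i. f i \<in> C i}"
proof -
  have "compactin (product_topology (\<lambda>_. euclidean) UNIV) (PiE UNIV C)"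
    unfolding compactin_PiE using assms by simp
  moreover have "PiE UNIV C = {f. \<forall>i. f i \<in> C i}" by (auto simp: PiE_iff)
  ultimately show ?thesis by (simp add: euclidean_product_topology)
qed

section \<open>Cluster values of the block changes\<close>

context block_map
begin

definition \<tau> :: "nat \<Rightarrow> nat \<Rightarrow> 'h"
  where "\<tau> i a = \<Psi> (pt i a) (l (Suc i)) - \<Psi> (pt i a) (l i)"

lemma telescope:
  assumes "diagonal_bounded x" "p \<le> q"
  shows "N ((\<Psi> x (l q) - \<Psi> x (l p)) - (\<Sum>i=p..<q. \<tau> i (x i))) \<le> 6 * (1/2)^p"
proof -
  \<comment> \<open>Block q adds the error 3 * (1/2)^q; the bound is the exact geometric sum, which
    is the form in which the induction closes.\<close>
  have "N ((\<Psi> x (l q) - \<Psi> x (l p)) - (\<Sum>i=p..<q. \<tau> i (x i))) \<le> 6 * (1/2)^p - 6 * (1/2)^q"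
    using assms(2)
  proof (induction q rule: dec_induct)
    case (step q)
    have xq: "x q \<le> q" using assms(1) by (simp add: diagonal_bounded_def)
    have "N ((\<Psi> x (l (Suc q)) - \<Psi> x (l q)) - \<tau> q (x q)) \<le> 3 * (1/2)^q"
      unfolding \<tau>_def by (rule local[OF assms(1) diagonal_bounded_pt[OF xq], of q "Suc q"])
        (use l in \<open>auto simp: pt_def strict_mono_less_eq less_Suc_eq\<close>)
    moreover have e: "(\<Psi> x (l (Suc q)) - \<Psi> x (l p)) - (\<Sum>i=p..<Suc q. \<tau> i (x i)) =
        ((\<Psi> x (l q) - \<Psi> x (l p)) - (\<Sum>i=p..<q. \<tau> i (x i))) + ((\<Psi> x (l (Suc q)) - \<Psi> x (l q)) - \<tau> q (x q))"
      using step by (simp add: algebra_simps)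
    ultimately show ?case unfolding e power_Suc using step.IH
        H.triangle[of "(\<Psi> x (l q) - \<Psi> x (l p)) - (\<Sum>i=p..<q. \<tau> i (x i))" "(\<Psi> x (l (Suc q)) - \<Psi> x (l q)) - \<tau> q (x q)"]
      by linarith
  qed simp
  also have "\<dots> \<le> 6 * (1/2)^p" by simp
  finally show ?thesis .
qed

text \<open>Local compactness and connectedness meet here: replacing a by a \<delta>-close b moves
  \<tau> by at most r, hence within a compact set, and every a is reached from 0 by finitely many
  such replacements. The compact set and the starting index depend on a.\<close>

lemma \<tau>_bounded: "\<exists>K n. compact K \<and> (\<forall>i\<ge>n. \<tau> i a - \<tau> i 0 \<in> K)"
proof -
  obtain r K where r: "r > 0" and K: "compact K" "{x. N x \<le> r} \<subseteq> K" using H.compact_ball by blast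
  obtain \<delta> n where \<delta>: "\<delta> > 0" and n: "\<And>p q x x'. n \<le> p \<Longrightarrow> p \<le> q \<Longrightarrow> diagonal_bounded x \<Longrightarrow> diagonal_bounded x' \<Longrightarrow>
    (\<forall>k\<in>{p..q}. M (\<Sum>i=p..<k. d (x i) - d (x' i)) < \<delta>) \<Longrightarrow> (\<forall>m\<in>{l p..l q}. N (inc x x' (l p) m) \<le> r)"
    using small_image[OF r] by blast
  show ?thesis
  proof (induction a rule: step_induct[OF \<delta>])
    case 1 show ?case by (rule exI[of _ "{0}"]) auto
  next
    case (2 a b)
    then obtain K' n' where K': "compact K'" "\<forall>i\<ge>n'. \<tau> i a - \<tau> i 0 \<in> K'" by blast
    have "compact ((\<lambda>z. fst z + snd z) ` (K' \<times> K))"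
      by (intro compact_continuous_image compact_Times K' K continuous_intros)
    moreover have "\<tau> i b - \<tau> i 0 \<in> (\<lambda>z. fst z + snd z) ` (K' \<times> K)" if i: "i \<ge> max (max n n') (max a b)" for i
    proof -
      have "\<forall>m\<in>{l i..l (Suc i)}. N (inc (pt i b) (pt i a) (l i) m) \<le> r"
      proof (rule n)
        show "\<forall>k\<in>{i..Suc i}. M (\<Sum>j = i..<k. d (pt i b j) - d (pt i a j)) < \<delta>"
        proof
          fix k assume "k \<in> {i..Suc i}"
          then have "k = i \<or> k = Suc i" by auto
          then show "M (\<Sum>j = i..<k. d (pt i b j) - d (pt i a j)) < \<delta>"
            using 2(2) \<delta> by (auto simp: pt_def)
        qed
      qed (use i in \<open>auto intro: diagonal_bounded_pt\<close>)
      then have "N (inc (pt i b) (pt i a) (l i) (l (Suc i))) \<le> r" using l by (simp add: strict_mono_less_eq)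
      then have "\<tau> i b - \<tau> i a \<in> K" using K(2) by (auto simp: inc_def \<tau>_def algebra_simps)
      moreover have "\<tau> i a - \<tau> i 0 \<in> K'" using K'(2) i by simp
      ultimately show ?thesis by (intro image_eqI[of _ _ "(\<tau> i a - \<tau> i 0, \<tau> i b - \<tau> i a)"]) auto
    qed
    ultimately show ?case by blast
  qed
qed

lemma \<tau>_subsequence:
  obtains r T where "strict_mono (r::nat \<Rightarrow> nat)" "\<And>a. (\<lambda>i. \<tau> (r i) a - \<tau> (r i) 0) \<longlonglongrightarrow> T a"
proof -
  obtain K n where K: "\<And>a. compact (K a)" "\<And>a i. i \<ge> n a \<Longrightarrow> \<tau> i a - \<tau> i 0 \<in> K a"
    using \<tau>_bounded by metis
  \<comment> \<open>Before index \<open>n a\<close> the value at \<open>n a\<close> is repeated, so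
    that every \<open>u i\<close> lies in the compact product.\<close>
  define u where "u i a = (if i \<ge> n a then \<tau> i a - \<tau> i 0 else \<tau> (n a) a - \<tau> (n a) 0)" for i a
  have "compact {f. \<forall>a. f a \<in> K a}" by (rule compact_pointwise_product) (rule K)
  then have sc: "seq_compact {f. \<forall>a. f a \<in> K a}" by (rule compact_imp_seq_compact)
  have "\<forall>i. u i \<in> {f. \<forall>a. f a \<in> K a}" using K(2) by (auto simp: u_def)
  then obtain T r where T: "strict_mono r" "(u \<circ> r) \<longlonglongrightarrow> T" by (rule seq_compactE[OF sc])
  have "(\<lambda>i. \<tau> (r i) a - \<tau> (r i) 0) \<longlonglongrightarrow> T a" for a
  proof -
    have "(\<lambda>i. (u \<circ> r) i a) \<longlonglongrightarrow> T a"
      by (rule continuous_on_tendsto_compose[OF continuous_on_product_coordinates T(2)]) auto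
    moreover have "\<forall>\<^sub>F i in sequentially. (u \<circ> r) i a = \<tau> (r i) a - \<tau> (r i) 0"
      unfolding eventually_sequentially using seq_suble[OF T(1)]
      by (intro exI[of _ "n a"]) (auto simp: u_def dest: order_trans)
    ultimately show ?thesis by (rule Lim_transform_eventually)
  qed
  then show ?thesis using that T(1) by blast
qed

end

section \<open>Passing to a subsequence of blocks\<close>

definition spread :: "(nat \<Rightarrow> nat) \<Rightarrow> (nat \<Rightarrow> nat) \<Rightarrow> nat \<Rightarrow> nat"
  where "spread r x j = (if j \<in> range r then x (inv r j) else 0)"

lemma spread_apply: "strict_mono r \<Longrightarrow> spread r x (r i) = x i"
  by (simp add: spread_def strict_mono_imp_inj_on)

lemma diagonal_bounded_spread:
  assumes "strict_mono r" "diagonal_bounded x" shows "diagonal_bounded (spread r x)"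
  unfolding diagonal_bounded_def
proof
  fix j show "spread r x j \<le> j"
  proof (cases "j \<in> range r")
    case True
    then obtain i where "j = r i" by blast
    then show ?thesis using assms seq_suble[OF assms(1), of i] by (auto simp: spread_apply diagonal_bounded_def intro: order_trans)
  qed (simp add: spread_def)
qed

lemma spread_pt: "strict_mono r \<Longrightarrow> spread r (pt i a) = pt (r i) a"
proof
  fix j assume r: "strict_mono r"
  show "spread r (pt i a) j = pt (r i) a j"
  proof (cases "j \<in> range r")
    case True
    then obtain k where "j = r k" by blast
    then show ?thesis using r by (auto simp: spread_apply pt_def strict_mono_eq)
  qed (auto simp: spread_def pt_def)
qed

locale block_limit = block_map N M d \<Psi> l
  for N :: "'h::{topological_ab_group_add, polish_space} \<Rightarrow> real"
    and M :: "'g::{topological_ab_group_add, polish_space} \<Rightarrow> real" and d \<Psi> l +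
  fixes T :: "nat \<Rightarrow> 'h"
  assumes T: "(\<lambda>i. \<tau> i a - \<tau> i 0) \<longlonglongrightarrow> T a"

text \<open>Thinning the blocks along r preserves the hypotheses of \<open>block_map\<close> and
  makes \<tau> converge. The new block i ends at \<open>l (r (Suc i))\<close> instead of
  \<open>l (Suc (r i))\<close>; over the extra stretch the inputs compared agree, so the change is
  negligible.\<close>

lemma (in block_map) block_limit_exists:
  obtains r T where "block_limit N M d (\<lambda>x. \<Psi> (spread r x)) (\<lambda>i. l (r i)) T"
proof -
  obtain r T where r: "strict_mono (r::nat \<Rightarrow> nat)" and T: "\<And>a. (\<lambda>i. \<tau> (r i) a - \<tau> (r i) 0) \<longlonglongrightarrow> T a"
    using \<tau>_subsequence by blast
  have ri: "i \<le> r i" for i by (rule seq_suble[OF r])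
  have eq: "spread r x j = spread r x' j" if "\<And>i. r i = j \<Longrightarrow> x i = x' i" for x x' j
    using that r by (cases "j \<in> range r") (auto simp: spread_apply, auto simp: spread_def)
  have bm: "block_map N M d (\<lambda>x. \<Psi> (spread r x)) (\<lambda>i. l (r i))"
  proof unfold_locales
    show "strict_mono (\<lambda>i. l (r i))" using l r by (simp add: strict_mono_def)
    show "N ((\<Psi> (spread r x) m - \<Psi> (spread r x') m) - (\<Psi> (spread r x) m' - \<Psi> (spread r x') m')) \<le> (1/2)^i"
      if "diagonal_bounded x" "diagonal_bounded x'" "\<And>j. j \<ge> i \<Longrightarrow> x j = x' j" "l (r i) \<le> m" "l (r i) \<le> m'" for x x' i m m'
    proof -
      have "N ((\<Psi> (spread r x) m - \<Psi> (spread r x') m) - (\<Psi> (spread r x) m' - \<Psi> (spread r x') m')) \<le> (1/2)^r i"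
        by (rule tail) (use that r in \<open>auto intro!: diagonal_bounded_spread eq simp: strict_mono_less_eq\<close>)
      then show ?thesis using half_power_le[OF ri[of i]] by linarith
    qed
    show "N (\<Psi> (spread r x) m - \<Psi> (spread r x') m) \<le> (1/2)^i"
      if "diagonal_bounded x" "diagonal_bounded x'" "\<And>j. j < i \<Longrightarrow> x j = x' j" "m \<le> l (r i)" "i > 0" for x x' i m
    proof -
      have "N (\<Psi> (spread r x) m - \<Psi> (spread r x') m) \<le> (1/2)^r i"
        by (rule head) (use that r ri[of i] in \<open>auto intro!: diagonal_bounded_spread eq simp: strict_mono_less\<close>)
      then show ?thesis using half_power_le[OF ri[of i]] by linarith
    qed
    show "convergent (\<lambda>n. \<Sum>i<n. d (x i) - d (x' i)) \<longleftrightarrow> convergent (\<lambda>m. \<Psi> (spread r x) m - \<Psi> (spread r x') m)"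
      if "diagonal_bounded x" "diagonal_bounded x'" for x x'
      using reduction[OF diagonal_bounded_spread[OF r that(1)] diagonal_bounded_spread[OF r that(2)]]
        convergent_sum_reindex[OF r, of "\<lambda>i. d (spread r x i) - d (spread r x' i)"]
      by (simp add: spread_apply[OF r]) (simp add: spread_def)
  qed (use d_0 d_add d_minus d_dense conn in auto)
  then interpret bm: block_map N M d "\<lambda>x. \<Psi> (spread r x)" "\<lambda>i. l (r i)" .
  have "block_limit N M d (\<lambda>x. \<Psi> (spread r x)) (\<lambda>i. l (r i)) T"
  proof
    fix a
    define D where "D i = (bm.\<tau> i a - bm.\<tau> i 0) - (\<tau> (r i) a - \<tau> (r i) 0)" for i
    have D_bd: "N (D i) \<le> 3 * (1/2)^i" if i: "i \<ge> a" for i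
    proof -
      have "D i = inc (pt (r i) a) (pt (r i) 0) (l (Suc (r i))) (l (r (Suc i)))"
        by (simp add: D_def bm.\<tau>_def \<tau>_def spread_pt[OF r] inc_def algebra_simps)
      moreover have "Suc (r i) \<le> r (Suc i)" using r by (simp add: Suc_le_eq strict_mono_less)
      moreover have "N (inc (pt (r i) a) (pt (r i) 0) (l (Suc (r i))) (l (r (Suc i)))) \<le> 3 * (1/2)^Suc (r i)"
        by (rule inc_zero_block[of _ _ "Suc (r i)" "r (Suc i)"])
          (use calculation(2) l i ri[of i] in \<open>auto intro!: diagonal_bounded_pt simp: strict_mono_less_eq pt_def\<close>)
      moreover have "(1/2::real)^Suc (r i) \<le> (1/2)^i" using ri[of i] by (intro half_power_le) auto
      ultimately show ?thesis by simp
    qed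
    have "(\<lambda>i. N (D i)) \<longlonglongrightarrow> 0"
    proof (rule Lim_null_comparison)
      show "\<forall>\<^sub>F i in sequentially. norm (N (D i)) \<le> 3 * (1/2)^i" using D_bd by (auto simp: eventually_sequentially)
      have "(\<lambda>i. 3 * (1/2::real)^i) \<longlonglongrightarrow> 3 * 0" by (intro tendsto_intros) auto
      then show "(\<lambda>i. 3 * (1/2::real)^i) \<longlonglongrightarrow> 0" by (simp only: mult_zero_right)
    qed
    then have "D \<longlonglongrightarrow> 0" by (simp add: H.tendsto_iff)
    from tendsto_add[OF this T[of a]] show "(\<lambda>i. bm.\<tau> i a - bm.\<tau> i 0) \<longlonglongrightarrow> T a"
      by (simp add: D_def)
  qed
  then show ?thesis by (rule that)
qed

definition place :: "nat \<Rightarrow> nat list \<Rightarrow> nat \<Rightarrow> nat"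
  where "place p as i = (if p \<le> i \<and> i < p + length as then as ! (i - p) else 0)"

lemma diagonal_bounded_place: "\<forall>a\<in>set as. a \<le> p \<Longrightarrow> diagonal_bounded (place p as)"
  unfolding diagonal_bounded_def place_def
proof
  fix i assume as: "\<forall>a\<in>set as. a \<le> p"
  show "(if p \<le> i \<and> i < p + length as then as ! (i - p) else 0) \<le> i"
  proof (cases "p \<le> i \<and> i < p + length as")
    case True
    then have "as ! (i - p) \<in> set as" by (intro nth_mem) auto
    then show ?thesis using True as by (auto intro: order_trans)
  qed auto
qed

lemma sum_place:
  "k \<le> length as \<Longrightarrow> length bs = length as \<Longrightarrow> (\<Sum>i=p..<p+k. f i (place p as i) (place p bs i)) = (\<Sum>j<k. f (p + j) (as ! j) (bs ! j))"
  using sum.shift_bounds_nat_ivl[of "\<lambda>i. f i (place p as i) (place p bs i)" 0 p k]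
  by (simp add: add.commute lessThan_atLeast0 place_def)

context block_limit
begin

text \<open>Far out, a finite word of values on consecutive coordinates acts on the image through
  sums of T, with the same accuracy \<eta> at every block boundary. This translates between
  statements on blocks and statements on T.\<close>

lemma placement:
  assumes "\<eta> > 0" and len: "length bs = length as"
  obtains p where "p \<ge> n0" "diagonal_bounded (place p as)" "diagonal_bounded (place p bs)"
    "\<And>k. k \<le> length as \<Longrightarrow>
      N (inc (place p as) (place p bs) (l p) (l (p + k)) - (\<Sum>j<k. T (as ! j) - T (bs ! j))) \<le> \<eta>"
proof -
  \<comment> \<open>Two deviations c at each of at most \<open>length as\<close> positions use up
    half of \<eta>; the other half covers the 12 * (1/2)^p of two telescopes.\<close>
  define c where "c = \<eta> / (4 * (real (length as) + 1))"
  have c: "c > 0" using assms by (simp add: c_def)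
  have Tlim: "\<forall>\<^sub>F p in sequentially. N ((\<tau> (p + j) a - \<tau> (p + j) 0) - T a) < c" for a j
  proof -
    have "(\<lambda>i. N ((\<tau> i a - \<tau> i 0) - T a)) \<longlonglongrightarrow> 0" using T[of a] by (simp add: H.tendsto_diff_iff)
    then have "(\<lambda>p. N ((\<tau> (p + j) a - \<tau> (p + j) 0) - T a)) \<longlonglongrightarrow> 0" by (rule LIMSEQ_ignore_initial_segment)
    then show ?thesis using c by (rule order_tendstoD(2))
  qed
  have "\<forall>\<^sub>F p in sequentially. \<forall>j\<in>{..<length as}. N ((\<tau> (p + j) (as ! j) - \<tau> (p + j) 0) - T (as ! j)) < c \<and> N ((\<tau> (p + j) (bs ! j) - \<tau> (p + j) 0) - T (bs ! j)) < c"
    by (intro eventually_ball_finite ballI eventually_conj Tlim) auto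
  then obtain p1 where p1: "\<And>p j. p \<ge> p1 \<Longrightarrow> j < length as \<Longrightarrow> N ((\<tau> (p + j) (as ! j) - \<tau> (p + j) 0) - T (as ! j)) < c \<and> N ((\<tau> (p + j) (bs ! j) - \<tau> (p + j) 0) - T (bs ! j)) < c"
    unfolding eventually_sequentially by auto
  obtain p2 where p2: "\<And>p. p \<ge> p2 \<Longrightarrow> 12 * (1/2::real)^p < \<eta> / 2" using half_power_small[of "\<eta>/2" 12] assms by auto
  define p where "p = Max (insert n0 (insert p1 (insert p2 (set as \<union> set bs))))"
  have p: "p \<ge> n0" "p \<ge> p1" "p \<ge> p2" "\<forall>a\<in>set as. a \<le> p" "\<forall>a\<in>set bs. a \<le> p"
    unfolding p_def by (auto intro!: Max_ge simp del: Max_insert)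
  define x where "x = place p as"
  define y where "y = place p bs"
  have x: "diagonal_bounded x" and y: "diagonal_bounded y"
    using p unfolding x_def y_def by (auto intro!: diagonal_bounded_place)
  show ?thesis
  proof (rule that[OF p(1)])
    fix k assume k: "k \<le> length as"
    have s: "(\<Sum>i=p..<p+k. \<tau> i (x i)) - (\<Sum>i=p..<p+k. \<tau> i (y i)) = (\<Sum>j<k. \<tau> (p + j) (as ! j) - \<tau> (p + j) (bs ! j))"
      unfolding sum_subtractf[symmetric] x_def y_def using k len by (intro sum_place) auto
    have a: "N (inc x y (l p) (l (p + k)) - (\<Sum>j<k. \<tau> (p + j) (as ! j) - \<tau> (p + j) (bs ! j))) \<le> 12 * (1/2)^p"
    proof -
      have e: "inc x y (l p) (l (p + k)) - (\<Sum>j<k. \<tau> (p + j) (as ! j) - \<tau> (p + j) (bs ! j)) =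
        ((\<Psi> x (l (p + k)) - \<Psi> x (l p)) - (\<Sum>i=p..<p+k. \<tau> i (x i))) -
        ((\<Psi> y (l (p + k)) - \<Psi> y (l p)) - (\<Sum>i=p..<p+k. \<tau> i (y i)))"
        unfolding s[symmetric] inc_def by (simp add: algebra_simps)
      show ?thesis unfolding e using telescope[OF x, of p "p + k"] telescope[OF y, of p "p + k"]
        H.diff_le[of "(\<Psi> x (l (p + k)) - \<Psi> x (l p)) - (\<Sum>i=p..<p+k. \<tau> i (x i))" "(\<Psi> y (l (p + k)) - \<Psi> y (l p)) - (\<Sum>i=p..<p+k. \<tau> i (y i))"]
        by linarith
    qed
    have b: "N ((\<Sum>j<k. \<tau> (p + j) (as ! j) - \<tau> (p + j) (bs ! j)) - (\<Sum>j<k. T (as ! j) - T (bs ! j))) \<le> \<eta> / 2"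
    proof -
      have "N ((\<Sum>j<k. \<tau> (p + j) (as ! j) - \<tau> (p + j) (bs ! j)) - (\<Sum>j<k. T (as ! j) - T (bs ! j))) \<le>
         (\<Sum>j<k. N ((\<tau> (p + j) (as ! j) - \<tau> (p + j) (bs ! j)) - (T (as ! j) - T (bs ! j))))"
        unfolding sum_subtractf[symmetric] by (rule H.sum_le)
      also have "\<dots> \<le> (\<Sum>j<k. 2 * c)"
      proof (rule sum_mono)
        fix j assume "j \<in> {..<k}"
        then have j: "j < length as" using k by simp
        have e: "(\<tau> (p + j) (as ! j) - \<tau> (p + j) (bs ! j)) - (T (as ! j) - T (bs ! j)) =
          ((\<tau> (p + j) (as ! j) - \<tau> (p + j) 0) - T (as ! j)) - ((\<tau> (p + j) (bs ! j) - \<tau> (p + j) 0) - T (bs ! j))"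
          by (simp add: algebra_simps)
        show "N ((\<tau> (p + j) (as ! j) - \<tau> (p + j) (bs ! j)) - (T (as ! j) - T (bs ! j))) \<le> 2 * c"
          unfolding e using p1[OF p(2) j] H.diff_le[of "(\<tau> (p + j) (as ! j) - \<tau> (p + j) 0) - T (as ! j)" "(\<tau> (p + j) (bs ! j) - \<tau> (p + j) 0) - T (bs ! j)"]
          by linarith
      qed
      also have "\<dots> = 2 * c * real k" by simp
      also have "\<dots> \<le> 2 * c * (real (length as) + 1)" using k c by (intro mult_left_mono) auto
      also have "\<dots> = \<eta> / 2" by (simp add: c_def divide_simps)
      finally show ?thesis .
    qed
    show "N (inc (place p as) (place p bs) (l p) (l (p + k)) - (\<Sum>j<k. T (as ! j) - T (bs ! j))) \<le> \<eta>"
      using a b p2[OF p(3)] H.diff_triangle[of "inc x y (l p) (l (p + k))" "\<Sum>j<k. T (as ! j) - T (bs ! j)" "\<Sum>j<k. \<tau> (p + j) (as ! j) - \<tau> (p + j) (bs ! j)"]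
      unfolding x_def y_def by linarith
  qed (use x y in \<open>auto simp: x_def y_def\<close>)
qed

end

subsection \<open>The homomorphism extracted from a reduction\<close>

inductive_set reach :: "'g::ab_group_add set \<Rightarrow> ('g \<Rightarrow> real) \<Rightarrow> real \<Rightarrow> 'g set"
  for K M \<delta> where
  zero: "0 \<in> reach K M \<delta>"
| step: "y \<in> reach K M \<delta> \<Longrightarrow> y' \<in> K \<Longrightarrow> M (y' - y) < \<delta> \<Longrightarrow> y' \<in> reach K M \<delta>"

text \<open>A chain from 0 to y, translated by z, prolongs a chain from 0 to z; negation maps chains
  to chains.\<close>

lemma (in group_norm) is_subgroup_reach:
  assumes K: "is_subgroup K"
  shows "is_subgroup (reach K N \<delta>)" "reach K N \<delta> \<subseteq> K"
proof -
  show sub: "reach K N \<delta> \<subseteq> K"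
  proof
    fix y assume "y \<in> reach K N \<delta>"
    then show "y \<in> K" by cases (use K in \<open>auto simp: is_subgroup_def\<close>)
  qed
  have "z + y \<in> reach K N \<delta>" if "y \<in> reach K N \<delta>" "z \<in> reach K N \<delta>" for y z
    using that
  proof (induction rule: reach.induct)
    case (step y y')
    have "z + y' \<in> K" using step sub K by (auto simp: is_subgroup_def)
    moreover have "N ((z + y') - (z + y)) < \<delta>" using step by simp
    ultimately show ?case using step reach.step by blast
  qed simp
  moreover have "- y \<in> reach K N \<delta>" if "y \<in> reach K N \<delta>" for y
    using that
  proof (induction rule: reach.induct)
    case (step y y')
    have "- y' \<in> K" using step K by (auto simp: is_subgroup_def)
    moreover have "N (- y' - - y) < \<delta>" using step commute[of y y'] by simp
    ultimately show ?case using step reach.step by blast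
  qed (simp add: reach.zero)
  ultimately show "is_subgroup (reach K N \<delta>)" by (auto simp: is_subgroup_def reach.zero)
qed

lemma (in group_norm) openin_reach:
  assumes "\<delta> > 0" "is_subgroup K"
  shows "openin (top_of_set K) (reach K N \<delta>)"
proof -
  have "reach K N \<delta> = K \<inter> (\<Union>y\<in>reach K N \<delta>. {z. N (z - y) < \<delta>})"
    using is_subgroup_reach(2)[OF assms(2)] assms(1) by (force intro: reach.step)
  then show ?thesis unfolding openin_open by (metis open_UN open_ball)
qed

context block_limit
begin

lemma T_0 [simp]: "T 0 = 0"
  using T[of 0] by (simp add: LIMSEQ_const_iff)

text \<open>A list of pairs is a word of differences d a - d b. All partial sums are bounded, not
  only the total, to match the hypothesis of \<open>small_image\<close>.\<close>

definition small :: "real \<Rightarrow> (nat \<times> nat) list \<Rightarrow> bool"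
  where "small \<delta> ps \<longleftrightarrow> (\<forall>k\<le>length ps. M (\<Sum>j<k. d (fst (ps ! j)) - d (snd (ps ! j))) < \<delta>)"

lemma small_snoc:
  assumes "small \<delta> ps" "M ((\<Sum>j<length ps. d (fst (ps ! j)) - d (snd (ps ! j))) + (d a - d b)) < \<delta>"
  shows "small \<delta> (ps @ [(a, b)])"
  unfolding small_def
proof (intro allI impI)
  fix k assume k: "k \<le> length (ps @ [(a, b)])"
  have e: "(\<Sum>j<i. d (fst ((ps @ [(a, b)]) ! j)) - d (snd ((ps @ [(a, b)]) ! j))) = (\<Sum>j<i. d (fst (ps ! j)) - d (snd (ps ! j)))"
    if "i \<le> length ps" for i using that by (intro sum.cong) (auto simp: nth_append)
  show "M (\<Sum>j<k. d (fst ((ps @ [(a, b)]) ! j)) - d (snd ((ps @ [(a, b)]) ! j))) < \<delta>"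
  proof (cases "k \<le> length ps")
    case True then show ?thesis using assms(1) e[OF True] by (simp add: small_def)
  next
    case False
    then have "k = Suc (length ps)" using k by simp
    then show ?thesis using assms(2) e[of "length ps"] by (simp add: nth_append)
  qed
qed

text \<open>The limit form of \<open>small_image\<close>: the two words are placed far out, where
  sums of T describe the image.\<close>

lemma T_small:
  assumes "\<epsilon> > 0"
  shows "\<exists>\<delta>>0. \<forall>ps. small \<delta> ps \<longrightarrow> N (\<Sum>j<length ps. T (fst (ps ! j)) - T (snd (ps ! j))) \<le> \<epsilon>"
proof -
  have e2: "\<epsilon> / 2 > 0" using assms by simp
  obtain \<delta> n where \<delta>: "\<delta> > 0" and n: "\<And>p q x x'. n \<le> p \<Longrightarrow> p \<le> q \<Longrightarrow> diagonal_bounded x \<Longrightarrow> diagonal_bounded x' \<Longrightarrow>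
    (\<forall>k\<in>{p..q}. M (\<Sum>i=p..<k. d (x i) - d (x' i)) < \<delta>) \<Longrightarrow> (\<forall>m\<in>{l p..l q}. N (inc x x' (l p) m) \<le> \<epsilon> / 2)"
    using small_image[OF e2] by blast
  show ?thesis
  proof (intro exI conjI allI impI)
    fix ps assume ps: "small \<delta> ps"
    define as bs where "as = map fst ps" and "bs = map snd ps"
    obtain p where p: "p \<ge> n" "diagonal_bounded (place p as)" "diagonal_bounded (place p bs)"
      "\<And>k. k \<le> length as \<Longrightarrow>
        N (inc (place p as) (place p bs) (l p) (l (p + k)) - (\<Sum>j<k. T (as ! j) - T (bs ! j))) \<le> \<epsilon> / 2"
      using placement[OF e2, of bs as n] by (auto simp: as_def bs_def)
    have "\<forall>m\<in>{l p..l (p + length ps)}. N (inc (place p as) (place p bs) (l p) m) \<le> \<epsilon> / 2"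
    proof (rule n[OF p(1) _ p(2,3)])
      show "\<forall>k\<in>{p..p + length ps}. M (\<Sum>i=p..<k. d (place p as i) - d (place p bs i)) < \<delta>"
      proof
        fix k assume "k \<in> {p..p + length ps}"
        then obtain k' where k': "k = p + k'" "k' \<le> length ps" by (metis add_le_cancel_left atLeastAtMost_iff le_Suc_ex)
        have "(\<Sum>i=p..<p+k'. d (place p as i) - d (place p bs i)) = (\<Sum>j<k'. d (as ! j) - d (bs ! j))"
          by (rule sum_place[of k' as bs "\<lambda>i a b. d a - d b"]) (use k' in \<open>auto simp: as_def bs_def\<close>)
        also have "\<dots> = (\<Sum>j<k'. d (fst (ps ! j)) - d (snd (ps ! j)))"
          using k' by (intro sum.cong) (auto simp: as_def bs_def)
        finally show "M (\<Sum>i=p..<k. d (place p as i) - d (place p bs i)) < \<delta>" using ps k' by (simp add: small_def)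
      qed
    qed simp
    then have "N (inc (place p as) (place p bs) (l p) (l (p + length ps))) \<le> \<epsilon> / 2" using l by (simp add: strict_mono_less_eq)
    moreover have "(\<Sum>j<length ps. T (as ! j) - T (bs ! j)) = (\<Sum>j<length ps. T (fst (ps ! j)) - T (snd (ps ! j)))"
      by (intro sum.cong) (auto simp: as_def bs_def)
    ultimately show "N (\<Sum>j<length ps. T (fst (ps ! j)) - T (snd (ps ! j))) \<le> \<epsilon>"
      using p(4)[of "length ps"] H.abs_diff_le[of "inc (place p as) (place p bs) (l p) (l (p + length ps))" "\<Sum>j<length ps. T (as ! j) - T (bs ! j)"]
      by (auto simp: as_def)
  qed (rule \<delta>)
qed

lemma T_uniformly_continuous:
  assumes "\<epsilon> > 0"
  shows "\<exists>\<delta>>0. \<forall>a b. M (d a - d b) < \<delta> \<longrightarrow> N (T a - T b) \<le> \<epsilon>"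
proof -
  obtain \<delta> where \<delta>: "\<delta> > 0" "\<And>ps. small \<delta> ps \<Longrightarrow> N (\<Sum>j<length ps. T (fst (ps ! j)) - T (snd (ps ! j))) \<le> \<epsilon>"
    using T_small[OF assms] by blast
  have "N (T a - T b) \<le> \<epsilon>" if "M (d a - d b) < \<delta>" for a b
  proof -
    have "small \<delta> [(a, b)]" using small_snoc[of \<delta> "[]" a b] that \<delta>(1) by (simp add: small_def)
    from \<delta>(2)[OF this] show ?thesis by simp
  qed
  then show ?thesis using \<delta>(1) by blast
qed

lemma le_all_pos_0: "(\<And>\<epsilon>. \<epsilon> > 0 \<Longrightarrow> N h \<le> c * \<epsilon>) \<Longrightarrow> c > 0 \<Longrightarrow> h = 0"
proof (rule ccontr)
  assume h: "\<And>\<epsilon>. \<epsilon> > 0 \<Longrightarrow> N h \<le> c * \<epsilon>" and c: "c > 0" and "h \<noteq> 0"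
  then have "N h > 0" using H.nonneg[of h] H.eq_zero_iff[of h] by linarith
  then have "N h \<le> c * (N h / (2 * c))" using c by (intro h) simp
  then show False using c \<open>N h > 0\<close> by (simp add: field_simps)
qed

lemma T_cong: "d a = d b \<Longrightarrow> T a = T b"
proof -
  assume "d a = d b"
  have "T a - T b = 0"
  proof (rule le_all_pos_0[of _ 1])
    show "N (T a - T b) \<le> 1 * \<epsilon>" if "\<epsilon> > 0" for \<epsilon>
      using T_uniformly_continuous[OF that] \<open>d a = d b\<close> by auto
  qed simp
  then show ?thesis by simp
qed

text \<open>The idea is to realise T c - T a - T b as the T-sum of a word with small partial sums,
  by moving from 0 to a in small steps. When a becomes a', the pair (c', c) shifts the partial sum
  by the small d a' - d a and the pair (a, a') brings it back to 0. Alternating the two keeps all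
  partial sums below \<delta>, however many steps there are.\<close>

lemma T_add:
  assumes "d c = d a + d b"
  shows "T c = T a + T b"
proof -
  have "T c - T a - T b = 0"
  proof (rule le_all_pos_0[of _ 1])
    fix \<epsilon> :: real assume "\<epsilon> > 0"
    then obtain \<delta> where \<delta>: "\<delta> > 0" "\<And>ps. small \<delta> ps \<Longrightarrow> N (\<Sum>j<length ps. T (fst (ps ! j)) - T (snd (ps ! j))) \<le> \<epsilon>"
      using T_small[OF \<open>\<epsilon> > 0\<close>] by blast
    have "\<forall>c. d c = d a + d b \<longrightarrow> (\<exists>ps. small \<delta> ps \<and> (\<Sum>j<length ps. d (fst (ps ! j)) - d (snd (ps ! j))) = 0 \<and>
       (\<Sum>j<length ps. T (fst (ps ! j)) - T (snd (ps ! j))) = T c - T a - T b)"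
    proof (induction a rule: step_induct[OF \<delta>(1)])
      case 1
      show ?case
      proof (intro allI impI)
        fix c assume "d c = d 0 + d b"
        then have "T c = T b" by (intro T_cong) (simp add: d_0)
        then show "\<exists>ps. small \<delta> ps \<and> (\<Sum>j<length ps. d (fst (ps ! j)) - d (snd (ps ! j))) = 0 \<and>
           (\<Sum>j<length ps. T (fst (ps ! j)) - T (snd (ps ! j))) = T c - T 0 - T b"
          using \<delta>(1) by (intro exI[of _ "[]"]) (simp add: small_def)
      qed
    next
      case (2 a a')
      show ?case
      proof (intro allI impI)
        fix c' assume c': "d c' = d a' + d b"
        obtain c where c: "d c = d a + d b" using d_add by blast
        obtain ps where ps: "small \<delta> ps" "(\<Sum>j<length ps. d (fst (ps ! j)) - d (snd (ps ! j))) = 0"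
          "(\<Sum>j<length ps. T (fst (ps ! j)) - T (snd (ps ! j))) = T c - T a - T b" using 2(1) c by blast
        define qs where "qs = ps @ [(c', c)]"
        have sum_snoc: "(\<Sum>j<length (xs @ [u]). f ((xs @ [u]) ! j)) = (\<Sum>j<length xs. f (xs ! j)) + f u"
          for xs :: "(nat \<times> nat) list" and u and f :: "nat \<times> nat \<Rightarrow> 'z::comm_monoid_add"
          by (simp add: nth_append)
        have q1: "small \<delta> qs" unfolding qs_def by (rule small_snoc[OF ps(1)]) (use ps(2) 2(2) c c' in simp)
        have q2: "(\<Sum>j<length qs. d (fst (qs ! j)) - d (snd (qs ! j))) = d c' - d c"
          unfolding qs_def sum_snoc[of "\<lambda>u. d (fst u) - d (snd u)"] using ps by simp
        have q3: "(\<Sum>j<length qs. T (fst (qs ! j)) - T (snd (qs ! j))) = T c' - T a - T b"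
          unfolding qs_def sum_snoc[of "\<lambda>u. T (fst u) - T (snd u)"] using ps by simp
        show "\<exists>ps. small \<delta> ps \<and> (\<Sum>j<length ps. d (fst (ps ! j)) - d (snd (ps ! j))) = 0 \<and>
           (\<Sum>j<length ps. T (fst (ps ! j)) - T (snd (ps ! j))) = T c' - T a' - T b"
        proof (intro exI conjI)
          show "small \<delta> (qs @ [(a, a')])" by (rule small_snoc[OF q1]) (use q2 c c' \<delta>(1) in simp)
          show "(\<Sum>j<length (qs @ [(a, a')]). d (fst ((qs @ [(a, a')]) ! j)) - d (snd ((qs @ [(a, a')]) ! j))) = 0"
            unfolding sum_snoc[of "\<lambda>u. d (fst u) - d (snd u)"] q2 using c c' by simp
          show "(\<Sum>j<length (qs @ [(a, a')]). T (fst ((qs @ [(a, a')]) ! j)) - T (snd ((qs @ [(a, a')]) ! j))) = T c' - T a' - T b"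
            unfolding sum_snoc[of "\<lambda>u. T (fst u) - T (snd u)"] q3 by simp
        qed
      qed
    qed
    then obtain ps where "small \<delta> ps" "(\<Sum>j<length ps. T (fst (ps ! j)) - T (snd (ps ! j))) = T c - T a - T b" using assms by blast
    then show "N (T c - T a - T b) \<le> 1 * \<epsilon>" using \<delta>(2)[of ps] by simp
  qed simp
  then show ?thesis by (simp add: algebra_simps)
qed

text \<open>Uniform continuity extends T from the dense subgroup. The statement compares T a with S
  g directly because agreement with T, continuity and additivity of S can all be read off from this
  form.\<close>

lemma extension_exists: "\<exists>S. \<forall>\<epsilon>>0. \<exists>\<delta>>0. \<forall>g a. M (d a - g) < \<delta> \<longrightarrow> N (T a - S g) \<le> \<epsilon>"
proof -
  have "\<exists>s. \<forall>n. M (d (s n) - g) < 1 / real (Suc n)" for g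
    using dense[of "1 / real (Suc _)" g] by (intro choice) auto
  then obtain s where s: "\<And>g n. M (d (s g n) - g) < 1 / real (Suc n)" by metis
  have s_ev: "\<exists>n0. \<forall>n\<ge>n0. M (d (s g n) - g) < r" if r: "r > 0" for g r
  proof -
    obtain n0 where n0: "inverse (real (Suc n0)) < r" using reals_Archimedean[OF r] by blast
    have "M (d (s g n) - g) < r" if "n \<ge> n0" for n
    proof -
      have "1 / real (Suc n) \<le> 1 / real (Suc n0)" using that by (intro divide_left_mono) auto
      then show ?thesis using s[of g n] n0 by (simp add: inverse_eq_divide)
    qed
    then show ?thesis by blast
  qed
  have "convergent (\<lambda>n. T (s g n))" for g
  proof (rule H.Cauchy_convergent)
    fix e :: real assume "e > 0"
    then obtain \<delta> where \<delta>: "\<delta> > 0" "\<And>a b. M (d a - d b) < \<delta> \<Longrightarrow> N (T a - T b) \<le> e / 2"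
      using T_uniformly_continuous[of "e/2"] by auto
    obtain n0 where n0: "\<And>n. n \<ge> n0 \<Longrightarrow> M (d (s g n) - g) < \<delta> / 2" using s_ev[of "\<delta>/2" g] \<delta>(1) by auto
    have "N (T (s g m) - T (s g n)) < e" if "m \<ge> n0" "n \<ge> n0" for m n
    proof -
      have "M (d (s g m) - d (s g n)) < \<delta>"
        using G.diff_triangle[of "d (s g m)" "d (s g n)" g] n0[OF that(1)] n0[OF that(2)] G.commute[of g "d (s g n)"] by linarith
      then show ?thesis using \<delta>(2) \<open>e > 0\<close> by fastforce
    qed
    then show "\<exists>M. \<forall>m\<ge>M. \<forall>n\<ge>M. N (T (s g m) - T (s g n)) < e" by blast
  qed
  then obtain S where S: "\<And>g. (\<lambda>n. T (s g n)) \<longlonglongrightarrow> S g" unfolding convergent_def by metis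
  show ?thesis
  proof (rule exI[of _ S], intro allI impI)
    fix \<epsilon> :: real assume "\<epsilon> > 0"
    then obtain \<delta> where \<delta>: "\<delta> > 0" "\<And>a b. M (d a - d b) < \<delta> \<Longrightarrow> N (T a - T b) \<le> \<epsilon> / 2"
      using T_uniformly_continuous[of "\<epsilon>/2"] by auto
    have "N (T a - S g) \<le> \<epsilon>" if "M (d a - g) < \<delta> / 2" for a g
    proof -
      obtain n0 where n0: "\<And>n. n \<ge> n0 \<Longrightarrow> M (d (s g n) - g) < \<delta> / 2" using s_ev[of "\<delta>/2" g] \<delta>(1) by auto
      have "(\<lambda>n. N (T (s g n) - S g)) \<longlonglongrightarrow> 0" using S by (simp add: H.tendsto_diff_iff)
      then have "\<forall>\<^sub>F n in sequentially. N (T (s g n) - S g) < \<epsilon> / 2" using \<open>\<epsilon> > 0\<close> by (intro order_tendstoD(2)) auto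
      then obtain n1 where n1: "\<And>n. n \<ge> n1 \<Longrightarrow> N (T (s g n) - S g) < \<epsilon> / 2" by (auto simp: eventually_sequentially)
      define n where "n = max n0 n1"
      have "M (d a - d (s g n)) < \<delta>"
        using G.diff_triangle[of "d a" "d (s g n)" g] that n0[of n] G.commute[of g "d (s g n)"] by (simp add: n_def)
      then have "N (T a - T (s g n)) \<le> \<epsilon> / 2" by (rule \<delta>(2))
      then show ?thesis using n1[of n] H.diff_triangle[of "T a" "S g" "T (s g n)"] by (simp add: n_def)
    qed
    then show "\<exists>\<delta>>0. \<forall>g a. M (d a - g) < \<delta> \<longrightarrow> N (T a - S g) \<le> \<epsilon>" using \<delta>(1) by (intro exI[of _ "\<delta>/2"]) auto
  qed
qed

lemma between: "l p \<le> m \<Longrightarrow> m \<le> l (p + n) \<Longrightarrow> n > 0 \<Longrightarrow> \<exists>k<n. l (p + k) \<le> m \<and> m \<le> l (Suc (p + k))"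
proof (induction n)
  case (Suc n)
  show ?case
  proof (cases "m \<le> l (p + n) \<and> n > 0")
    case True then show ?thesis using Suc by (meson less_SucI)
  next
    case False
    then have "l (p + n) \<le> m" using Suc.prems by (cases n) auto
    then show ?thesis using Suc.prems by auto
  qed
qed simp

theorem homomorphism_exists:
  "\<exists>S :: 'g \<Rightarrow> 'h. continuous_on UNIV S \<and> Modules.additive S \<and> non_archimedean (kernel_of S)"
proof -
  obtain S where S: "\<And>\<epsilon>. \<epsilon> > 0 \<Longrightarrow> \<exists>\<delta>>0. \<forall>g a. M (d a - g) < \<delta> \<longrightarrow> N (T a - S g) \<le> \<epsilon>"
    using extension_exists by blast
  have S_d: "S (d a) = T a" for a
  proof -
    have "T a - S (d a) = 0"
    proof (rule le_all_pos_0[of _ 1])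
      show "N (T a - S (d a)) \<le> 1 * \<epsilon>" if "\<epsilon> > 0" for \<epsilon> using S[OF that] by auto
    qed simp
    then show ?thesis by simp
  qed
  have S_unif: "\<exists>\<delta>>0. \<forall>g h. M (g - h) < \<delta> \<longrightarrow> N (S g - S h) \<le> 2 * \<epsilon>" if pos: "\<epsilon> > 0" for \<epsilon>
  proof -
    obtain \<delta> where \<delta>: "\<delta> > 0" "\<And>g a. M (d a - g) < \<delta> \<Longrightarrow> N (T a - S g) \<le> \<epsilon>" using S[OF pos] by blast
    have "N (S g - S h) \<le> 2 * \<epsilon>" if gh: "M (g - h) < \<delta> / 2" for g h
    proof -
      obtain a where a: "M (d a - h) < \<delta> / 2" using dense[of "\<delta>/2"] \<delta>(1) by auto
      have "M (d a - g) < \<delta>" using a gh G.diff_triangle[of "d a" g h] G.commute[of h g] by linarith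
      moreover have "M (d a - h) < \<delta>" using a \<delta>(1) by linarith
      ultimately have "N (T a - S g) \<le> \<epsilon>" "N (T a - S h) \<le> \<epsilon>" using \<delta>(2) by auto
      then show ?thesis using H.diff_triangle[of "S g" "S h" "T a"] H.commute[of "S g" "T a"] by linarith
    qed
    then show ?thesis using \<delta>(1) by (intro exI[of _ "\<delta>/2"]) auto
  qed
  have S_cont: "continuous_on UNIV S"
    unfolding continuous_on_sequentially
  proof safe
    fix u :: "nat \<Rightarrow> 'g" and g assume "u \<longlonglongrightarrow> g"
    then have u: "(\<lambda>n. M (u n - g)) \<longlonglongrightarrow> 0" by (simp add: G.tendsto_diff_iff)
    have "(\<lambda>n. N (S (u n) - S g)) \<longlonglongrightarrow> 0"
    proof (rule LIMSEQ_I)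
      fix e :: real assume e: "e > 0"
      obtain \<delta> where \<delta>: "\<delta> > 0" "\<And>g h. M (g - h) < \<delta> \<Longrightarrow> N (S g - S h) \<le> 2 * (e / 4)" using S_unif[of "e/4"] e by auto
      have "\<forall>\<^sub>F n in sequentially. M (u n - g) < \<delta>" using order_tendstoD(2)[OF u \<delta>(1)] .
      then obtain n0 where "\<And>n. n \<ge> n0 \<Longrightarrow> M (u n - g) < \<delta>" by (auto simp: eventually_sequentially)
      then have "\<And>n. n \<ge> n0 \<Longrightarrow> N (S (u n) - S g) < e" using \<delta>(2) e by fastforce
      then show "\<exists>no. \<forall>n\<ge>no. norm (N (S (u n) - S g) - 0) < e" by auto
    qed
    then show "(S \<circ> u) \<longlonglongrightarrow> S g" by (simp add: H.tendsto_diff_iff comp_def)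
  qed
  have S_add: "S (g + h) = S g + S h" for g h
  proof -
    have "S (g + h) - (S g + S h) = 0"
    proof (rule le_all_pos_0[of _ 3])
      fix \<epsilon> :: real assume "\<epsilon> > 0"
      then obtain \<delta> where \<delta>: "\<delta> > 0" "\<And>g a. M (d a - g) < \<delta> \<Longrightarrow> N (T a - S g) \<le> \<epsilon>" using S by blast
      obtain a where a: "M (d a - g) < \<delta> / 2" using dense[of "\<delta>/2"] \<delta>(1) by auto
      obtain b where b: "M (d b - h) < \<delta> / 2" using dense[of "\<delta>/2"] \<delta>(1) by auto
      obtain c where c: "d c = d a + d b" using d_add by blast
      have "M (d c - (g + h)) < \<delta>" using G.triangle[of "d a - g" "d b - h"] a b unfolding c by (simp add: algebra_simps)
      then have 1: "N (T c - S (g + h)) \<le> \<epsilon>" by (rule \<delta>(2))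
      have 2: "N (T a - S g) \<le> \<epsilon>" "N (T b - S h) \<le> \<epsilon>" using a b \<delta> by auto
      have e: "S (g + h) - (S g + S h) = ((T a - S g) + (T b - S h)) - (T c - S (g + h))"
        using T_add[OF c] by (simp add: algebra_simps)
      show "N (S (g + h) - (S g + S h)) \<le> 3 * \<epsilon>"
        unfolding e using 1 2 H.diff_le[of "(T a - S g) + (T b - S h)" "T c - S (g + h)"] H.triangle[of "T a - S g" "T b - S h"] by linarith
    qed simp
    then show ?thesis by simp
  qed
  have S_0: "S 0 = 0" using S_add[of 0 0] by simp
  have S_diff: "S (g - h) = S g - S h" for g h using S_add[of "g - h" h] by simp
  have K: "is_subgroup (kernel_of S)" using S_0 S_add S_diff[of 0] by (auto simp: is_subgroup_def kernel_of_def)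
  \<comment> \<open>The chain is approximated by elements d c of the dense subgroup. As S vanishes
    on the chain, the values T c stay small along it, so the word of successive differences has an
    image of small variation, and \<open>small_preimage\<close> bounds the end point.\<close>
  have key: "\<exists>\<delta>>0. \<forall>y\<in>reach (kernel_of S) M \<delta>. M y < \<rho>" if \<rho>: "\<rho> > 0" for \<rho>
  proof -
    obtain \<epsilon> n1 where \<epsilon>: "\<epsilon> > 0" and n1: "\<And>p q x x'. n1 \<le> p \<Longrightarrow> p \<le> q \<Longrightarrow> diagonal_bounded x \<Longrightarrow> diagonal_bounded x' \<Longrightarrow>
      (\<forall>m\<in>{l p..l q}. N (inc x x' (l p) m) < \<epsilon>) \<Longrightarrow> M (\<Sum>i=p..<q. d (x i) - d (x' i)) < \<rho> / 2"
      using small_preimage[OF half_gt_zero[OF \<rho>]] by blast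
    have e8: "\<epsilon> / 8 > 0" using \<epsilon> by simp
    obtain \<delta>1 n2 where \<delta>1: "\<delta>1 > 0" and n2: "\<And>p q x x'. n2 \<le> p \<Longrightarrow> p \<le> q \<Longrightarrow> diagonal_bounded x \<Longrightarrow> diagonal_bounded x' \<Longrightarrow>
      (\<forall>k\<in>{p..q}. M (\<Sum>i=p..<k. d (x i) - d (x' i)) < \<delta>1) \<Longrightarrow> (\<forall>m\<in>{l p..l q}. N (inc x x' (l p) m) \<le> \<epsilon> / 8)"
      using small_image[OF e8] by blast
    obtain \<eta>0 where \<eta>0: "\<eta>0 > 0" "\<And>g. M g < \<eta>0 \<Longrightarrow> N (S g) < \<epsilon> / 8"
      using G.continuous_at_0[OF S_cont S_0 H.group_norm_axioms e8] by blast
    \<comment> \<open>\<open>\<eta>0\<close> makes T small at approximations of kernel points,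
      \<rho> / 2 pays for the return from d c to y, and \<delta>1 / 4 at both ends turns a chain
      step below \<delta>1 / 2 into a difference below \<delta>1.\<close>
    define \<eta> where "\<eta> = min \<eta>0 (min (\<rho> / 2) (\<delta>1 / 4))"
    have \<eta>: "\<eta> > 0" "\<eta> \<le> \<eta>0" "\<eta> \<le> \<rho> / 2" "\<eta> \<le> \<delta>1 / 4" using \<eta>0 \<rho> \<delta>1 by (auto simp: \<eta>_def)
    have chain: "\<exists>bs c. (\<forall>b\<in>set bs. M (d b) < \<delta>1) \<and> (\<forall>k\<le>length bs. N (\<Sum>j<k. T (bs ! j)) \<le> \<epsilon> / 8) \<and>
       d c = (\<Sum>j<length bs. d (bs ! j)) \<and> T c = (\<Sum>j<length bs. T (bs ! j)) \<and> M (d c - y) < \<eta>"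
      if "y \<in> reach (kernel_of S) M (\<delta>1 / 2)" for y
      using that
    proof (induction rule: reach.induct)
      case zero
      show ?case by (intro exI[of _ "[]"] exI[of _ 0]) (use e8 \<eta> d_0 in auto)
    next
      case (step y y')
      then obtain bs c where bs: "\<forall>b\<in>set bs. M (d b) < \<delta>1" "\<forall>k\<le>length bs. N (\<Sum>j<k. T (bs ! j)) \<le> \<epsilon> / 8"
        "d c = (\<Sum>j<length bs. d (bs ! j))" "T c = (\<Sum>j<length bs. T (bs ! j))" "M (d c - y) < \<eta>" by blast
      obtain c' where c': "M (d c' - y') < \<eta>" using dense[OF \<eta>(1)] by blast
      obtain c1 where c1: "d c1 = - d c" using d_minus by blast
      obtain b where b: "d b = d c' + d c1" using d_add by blast
      have db: "d c' = d c + d b" using b c1 by simp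
      have Tc': "T c' = T c + T b" by (rule T_add[OF db])
      have "M (d c' - d c) < \<delta>1"
        using G.diff_triangle[of "d c'" "d c" y'] G.diff_triangle[of y' "d c" y] c' bs(5) step(3) G.commute[of y "d c"] \<eta>(4)
        by linarith
      then have Mb: "M (d b) < \<delta>1" using db by simp
      have "S y' = 0" using step by (simp add: kernel_of_def)
      then have "T c' = S (d c' - y')" using S_diff S_d by simp
      then have NT: "N (T c') < \<epsilon> / 8" using \<eta>0(2)[of "d c' - y'"] c' \<eta>(2) by simp
      have sc: "(\<Sum>j<k. f ((bs @ [b]) ! j)) = (\<Sum>j<k. f (bs ! j))" if "k \<le> length bs" for k and f :: "nat \<Rightarrow> 'z::comm_monoid_add"
        using that by (intro sum.cong) (auto simp: nth_append)
      show ?case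
      proof (intro exI conjI)
        show "\<forall>a\<in>set (bs @ [b]). M (d a) < \<delta>1" using bs(1) Mb by auto
        show "d c' = (\<Sum>j<length (bs @ [b]). d ((bs @ [b]) ! j))" using db bs(3) sc[of "length bs" d] by (simp add: nth_append)
        show T': "T c' = (\<Sum>j<length (bs @ [b]). T ((bs @ [b]) ! j))" using Tc' bs(4) sc[of "length bs" T] by (simp add: nth_append)
        show "M (d c' - y') < \<eta>" by (rule c')
        show "\<forall>k\<le>length (bs @ [b]). N (\<Sum>j<k. T ((bs @ [b]) ! j)) \<le> \<epsilon> / 8"
        proof (intro allI impI)
          fix k assume "k \<le> length (bs @ [b])"
          then consider "k \<le> length bs" | "k = length (bs @ [b])" by (auto simp: le_Suc_eq)
          then show "N (\<Sum>j<k. T ((bs @ [b]) ! j)) \<le> \<epsilon> / 8"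
            by cases (use bs(2) sc[of k T] NT T' in auto)
        qed
      qed
    qed
    have "M y < \<rho>" if y: "y \<in> reach (kernel_of S) M (\<delta>1 / 2)" for y
    proof -
      obtain bs c where bs: "\<forall>b\<in>set bs. M (d b) < \<delta>1" "\<forall>k\<le>length bs. N (\<Sum>j<k. T (bs ! j)) \<le> \<epsilon> / 8"
        "d c = (\<Sum>j<length bs. d (bs ! j))" "M (d c - y) < \<eta>" using chain[OF y] by blast
      define zs where "zs = replicate (length bs) (0::nat)"
      have zs: "length zs = length bs" "\<And>j. j < length bs \<Longrightarrow> zs ! j = 0" by (auto simp: zs_def)
      obtain p where p: "p \<ge> max n1 n2" "diagonal_bounded (place p bs)" "diagonal_bounded (place p zs)"
        "\<And>k. k \<le> length bs \<Longrightarrow> N (inc (place p bs) (place p zs) (l p) (l (p + k)) - (\<Sum>j<k. T (bs ! j) - T (zs ! j))) \<le> \<epsilon> / 8"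
        using placement[OF e8 zs(1), of "max n1 n2"] by blast
      have 1: "N (inc (place p bs) (place p zs) (l p) (l (p + k))) \<le> \<epsilon> / 4" if k: "k \<le> length bs" for k
      proof -
        have "(\<Sum>j<k. T (bs ! j) - T (zs ! j)) = (\<Sum>j<k. T (bs ! j))" using k zs(2) by (intro sum.cong) auto
        then show ?thesis using p(4)[OF k] bs(2) k
          H.abs_diff_le[of "inc (place p bs) (place p zs) (l p) (l (p + k))" "\<Sum>j<k. T (bs ! j)"] by fastforce
      qed
      have var: "\<forall>m\<in>{l p..l (p + length bs)}. N (inc (place p bs) (place p zs) (l p) m) < \<epsilon>"
      proof
        fix m assume m: "m \<in> {l p..l (p + length bs)}"
        show "N (inc (place p bs) (place p zs) (l p) m) < \<epsilon>"
        proof (cases "length bs = 0")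
          case True then show ?thesis using m \<epsilon> by (simp add: inc_def)
        next
          case False
          then obtain k where k: "k < length bs" "l (p + k) \<le> m" "m \<le> l (Suc (p + k))" using between[of p m "length bs"] m by auto
          \<comment> \<open>Within one block only a single term counts, and it is smaller than
            \<delta>1. So \<open>small_image\<close> applies block by block, although nothing is
            known here about partial sums of the whole word.\<close>
          have "\<forall>m\<in>{l (p + k)..l (Suc (p + k))}. N (inc (place p bs) (place p zs) (l (p + k)) m) \<le> \<epsilon> / 8"
          proof (rule n2[OF _ _ p(2,3)])
            show "\<forall>i\<in>{p + k..Suc (p + k)}. M (\<Sum>j=p+k..<i. d (place p bs j) - d (place p zs j)) < \<delta>1"
            proof
              fix i assume "i \<in> {p + k..Suc (p + k)}"
              then have "i = p + k \<or> i = Suc (p + k)" by auto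
              then show "M (\<Sum>j=p+k..<i. d (place p bs j) - d (place p zs j)) < \<delta>1"
                using \<delta>1 bs(1) k zs by (auto simp: place_def d_0)
            qed
          qed (use p in auto)
          then have "N (inc (place p bs) (place p zs) (l (p + k)) m) \<le> \<epsilon> / 8" using k by simp
          moreover have e: "inc (place p bs) (place p zs) (l p) m = inc (place p bs) (place p zs) (l p) (l (p + k)) + inc (place p bs) (place p zs) (l (p + k)) m"
            by (simp add: inc_def algebra_simps)
          ultimately show ?thesis unfolding e using 1[of k] k \<epsilon>
              H.triangle[of "inc (place p bs) (place p zs) (l p) (l (p + k))" "inc (place p bs) (place p zs) (l (p + k)) m"] by linarith
        qed
      qed
      have "M (\<Sum>i=p..<p + length bs. d (place p bs i) - d (place p zs i)) < \<rho> / 2"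
        using n1[OF _ _ p(2,3) var] p(1) by simp
      moreover have "(\<Sum>i=p..<p + length bs. d (place p bs i) - d (place p zs i)) = d c"
        using sum_place[of "length bs" bs zs "\<lambda>i a b. d a - d b" p] zs bs(3) by (simp add: d_0)
      ultimately show ?thesis using bs(4) G.abs_diff_le[of "d c" y] \<eta>(3) by simp
    qed
    then show ?thesis using \<delta>1 by (intro exI[of _ "\<delta>1 / 2"]) auto
  qed
  have "non_archimedean (kernel_of S)"
    unfolding non_archimedean_def neighbourhood_base_at_def
  proof (intro allI impI)
    fix W assume W: "openin (top_of_set (kernel_of S)) W \<and> 0 \<in> W"
    then obtain O' where O': "open O'" "W = kernel_of S \<inter> O'" by (auto simp: openin_open)
    then obtain \<rho> where \<rho>: "\<rho> > 0" "{y. M (y - 0) < \<rho>} \<subseteq> O'" using W G.ball_in_open[of O' 0] by blast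
    obtain \<delta> where \<delta>: "\<delta> > 0" "\<And>y. y \<in> reach (kernel_of S) M \<delta> \<Longrightarrow> M y < \<rho>" using key[OF \<rho>(1)] by blast
    show "\<exists>U V. openin (top_of_set (kernel_of S)) U \<and> (openin (top_of_set (kernel_of S)) V \<and> is_subgroup V) \<and> 0 \<in> U \<and> U \<subseteq> V \<and> V \<subseteq> W"
      by (intro exI[of _ "reach (kernel_of S) M \<delta>"] conjI G.openin_reach G.is_subgroup_reach K \<delta>(1) reach.zero order_refl)
        (use O' \<rho> \<delta> G.is_subgroup_reach(2)[OF K] in auto)
  qed
  then show ?thesis using S_cont S_add by (intro exI[of _ S]) (auto simp: Modules.additive_def)
qed

end

section \<open>From a Borel reduction to the homomorphism\<close>

lemma countable_dense_subgroup:
  obtains d :: "nat \<Rightarrow> 'g::{topological_ab_group_add, polish_space}"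
  where "d 0 = 0" "\<And>a b. \<exists>c. d c = d a + d b" "\<And>a. \<exists>c. d c = - d a" "closure (range d) = UNIV"
proof -
  obtain A :: "'g set" where A: "countable A" "\<And>X. open X \<Longrightarrow> X \<noteq> {} \<Longrightarrow> \<exists>a\<in>A. a \<in> X"
    using countable_dense_setE by blast
  define B where "B = A \<union> uminus ` A"
  define D where "D = sum_list ` lists B"
  have "countable D" unfolding D_def B_def using A(1) by (intro countable_image countable_lists countable_Un)
  have D0: "0 \<in> D" unfolding D_def by (rule image_eqI[of _ _ "[]"]) auto
  have D_add: "x + y \<in> D" if xy: "x \<in> D" "y \<in> D" for x y
  proof -
    obtain xs ys where "x = sum_list xs" "xs \<in> lists B" "y = sum_list ys" "ys \<in> lists B" using xy by (auto simp: D_def)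
    then show ?thesis unfolding D_def by (intro image_eqI[of _ _ "xs @ ys"]) auto
  qed
  have "- sum_list xs \<in> D" if "xs \<in> lists B" for xs
    using that
  proof (induction xs)
    case (Cons a xs)
    have "- a \<in> B" using Cons by (auto simp: B_def)
    then have "- a \<in> D" unfolding D_def by (intro image_eqI[of _ _ "[- a]"]) auto
    then show ?case using Cons D_add[of "- a" "- sum_list xs"] by simp
  qed (use D0 in simp)
  then have D_minus: "- x \<in> D" if "x \<in> D" for x using that by (auto simp: D_def)
  have "A \<subseteq> D"
  proof
    fix a assume "a \<in> A"
    then show "a \<in> D" unfolding D_def B_def by (intro image_eqI[of _ _ "[a]"]) auto
  qed
  have "closure D = UNIV"
  proof -
    have "x \<in> closure D" for x
      unfolding closure_iff_nhds_not_empty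
    proof (intro allI impI)
      fix V U assume "U \<subseteq> V" "open U" "x \<in> U"
      then show "D \<inter> V \<noteq> {}" using A(2)[of U] \<open>A \<subseteq> D\<close> by blast
    qed
    then show ?thesis by auto
  qed
  \<comment> \<open>Index 0 is reserved for the neutral element, the value used for padding.\<close>
  define d where "d n = (case n of 0 \<Rightarrow> 0 | Suc k \<Rightarrow> from_nat_into D k)" for n
  have rd: "range d = D"
  proof
    have "from_nat_into D k \<in> D" for k by (rule from_nat_into) (use D0 in auto)
    then show "range d \<subseteq> D" using D0 by (auto simp: d_def split: nat.splits)
    have "\<exists>n. d n = x" if x: "x \<in> D" for x
    proof -
      obtain k where "from_nat_into D k = x" using from_nat_into_surj[OF \<open>countable D\<close> x] by blast
      then show ?thesis by (intro exI[of _ "Suc k"]) (simp add: d_def)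
    qed
    then show "D \<subseteq> range d" by blast
  qed
  have sur: "\<exists>c. d c = x" if "x \<in> D" for x using that rd by (metis imageE)
  have din: "d a \<in> D" for a using rd by auto
  show ?thesis
  proof (rule that[of d])
    show "d 0 = 0" by (simp add: d_def)
  qed (use rd sur din D_add D_minus \<open>closure D = UNIV\<close> in auto)
qed

theorem reduction_imp_homomorphism:
  fixes \<theta> :: "(nat \<Rightarrow> 'g::{topological_ab_group_add, polish_space}) \<Rightarrow> nat \<Rightarrow> 'h::{topological_ab_group_add, polish_space}"
  assumes lcG: "locally_compact_space (euclidean :: 'g topology)" and conn: "connected (UNIV :: 'g set)"
    and lcH: "locally_compact_space (euclidean :: 'h topology)"
    and \<theta>: "\<theta> \<in> borel_measurable borel" and red: "\<And>x y. E_grp x y \<longleftrightarrow> E_grp (\<theta> x) (\<theta> y)"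
  shows "\<exists>S :: 'g \<Rightarrow> 'h. continuous_on UNIV S \<and> Modules.additive S \<and> non_archimedean (kernel_of S)"
proof -
  obtain M :: "'g \<Rightarrow> real" where M: "group_norm M" using group_norm_exists[OF lcG] .
  obtain N :: "'h \<Rightarrow> real" where N: "group_norm N" using group_norm_exists[OF lcH] .
  obtain d :: "nat \<Rightarrow> 'g" where d: "d 0 = 0" "\<And>a b. \<exists>c. d c = d a + d b" "\<And>a. \<exists>c. d c = - d a" "closure (range d) = UNIV"
    using countable_dense_subgroup by blast
  define P where "P z n = (\<Sum>m\<le>n. d (z m))" for z :: "nat \<Rightarrow> nat" and n :: nat
  define \<Theta> where "\<Theta> z = \<theta> (P z)" for z
  have "continuous_on UNIV P"
  proof (rule continuous_on_coordinatewise_then_product)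
    fix n
    have "continuous_on UNIV (\<lambda>z. d (z m))" for m
      by (rule continuous_on_compose2[of UNIV d UNIV "\<lambda>z. z m"]) auto
    then show "continuous_on UNIV (\<lambda>z. P z n)" unfolding P_def by (intro continuous_on_sum)
  qed
  then have "P \<in> borel_measurable borel" by (rule borel_measurable_continuous_onI)
  then have "\<Theta> \<in> borel_measurable borel" using measurable_compose[OF _ \<theta>] unfolding \<Theta>_def by blast
  then obtain \<D> where D: "countable \<D>" "\<And>D. D \<in> \<D> \<Longrightarrow> open D" "\<And>D. D \<in> \<D> \<Longrightarrow> closure D = UNIV"
    "continuous_on (\<Inter>\<D>) \<Theta>" using borel_continuous_on_generic by blast
  \<comment> \<open>Inserting UNIV makes the family nonempty, so that it can be enumerated by all
    natural numbers.\<close>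
  define D where "D k = from_nat_into (insert UNIV \<D>) k" for k
  have Dk: "D k \<in> insert UNIV \<D>" for k unfolding D_def by (rule from_nat_into) simp
  have "range D = insert UNIV \<D>" unfolding D_def using range_from_nat_into[of "insert UNIV \<D>"] D(1) by simp
  then have Int: "(\<Inter>k. D k) = \<Inter>\<D>" by auto
  have E: "convergent (\<lambda>n. \<Sum>i<n. d (z i) - d (z' i)) \<longleftrightarrow> convergent (\<lambda>m. \<Theta> z m - \<Theta> z' m)" for z z'
  proof -
    have "convergent (\<lambda>n. \<Sum>i<n. d (z i) - d (z' i)) \<longleftrightarrow> convergent (\<lambda>n. \<Sum>i<Suc n. d (z i) - d (z' i))"
      by (rule convergent_Suc_iff[symmetric])
    also have "(\<lambda>n. \<Sum>i<Suc n. d (z i) - d (z' i)) = (\<lambda>n. P z n - P z' n)"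
      by (simp only: P_def sum_subtractf lessThan_Suc_atMost)
    also have "convergent \<dots> \<longleftrightarrow> E_grp (P z) (P z')" by (simp add: E_grp_def)
    also have "\<dots> \<longleftrightarrow> convergent (\<lambda>m. \<Theta> z m - \<Theta> z' m)" unfolding red[of "P z"] by (simp add: E_grp_def \<Theta>_def)
    finally show ?thesis .
  qed
  interpret generic_map N \<Theta> D
  proof (intro generic_map.intro generic_map_axioms.intro N)
    show "open (D k)" "closure (D k) = UNIV" for k using Dk[of k] D by auto
    show "continuous_on (\<Inter>k. D k) \<Theta>" unfolding Int by (rule D)
    fix n and y z :: "nat \<Rightarrow> nat" assume yz: "\<And>i. i \<ge> n \<Longrightarrow> y i = z i"
    have "(\<lambda>k. \<Sum>i<k. d (y i) - d (z i)) \<longlonglongrightarrow> (\<Sum>i<n. d (y i) - d (z i))"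
    proof (rule tendsto_eventually, unfold eventually_sequentially, intro exI allI impI)
      fix k assume k: "n \<le> k"
      show "(\<Sum>i<k. d (y i) - d (z i)) = (\<Sum>i<n. d (y i) - d (z i))"
        by (rule sum.mono_neutral_right) (use k yz in auto)
    qed
    then show "convergent (\<lambda>m. \<Theta> y m - \<Theta> z m)" unfolding E[symmetric] convergent_def by blast
  qed
  show ?thesis
  proof (rule block_form)
    fix p l e assume B: "strict_mono p" "strict_mono l"
      "\<And>x i. e x (p i) = x i"
      "\<And>x x' j. j \<notin> range p \<Longrightarrow> e x j = e x' j"
      "\<And>x x' i m m'. \<lbrakk>\<And>i. x i \<le> i; \<And>i. x' i \<le> i; \<And>j. j \<ge> i \<Longrightarrow> x j = x' j; l i \<le> m; l i \<le> m'\<rbrakk> \<Longrightarrow>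
         N ((\<Theta> (e x) m - \<Theta> (e x') m) - (\<Theta> (e x) m' - \<Theta> (e x') m')) \<le> (1/2)^i"
      "\<And>x x' i m. \<lbrakk>\<And>i. x i \<le> i; \<And>i. x' i \<le> i; \<And>j. j < i \<Longrightarrow> x j = x' j; m \<le> l i; i > 0\<rbrakk> \<Longrightarrow>
         N (\<Theta> (e x) m - \<Theta> (e x') m) \<le> (1/2)^i"
    interpret block_map N M d "\<lambda>x. \<Theta> (e x)" l
    proof (intro block_map.intro block_map_axioms.intro N M)
      fix x x' :: "nat \<Rightarrow> nat" assume x: "diagonal_bounded x" "diagonal_bounded x'"
      have "convergent (\<lambda>n. \<Sum>i<n. d (e x i) - d (e x' i)) \<longleftrightarrow> convergent (\<lambda>n. \<Sum>i<n. d (e x (p i)) - d (e x' (p i)))"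
        by (rule convergent_sum_reindex[OF B(1)]) (use B(4)[of _ x x'] in simp)
      then show "convergent (\<lambda>n. \<Sum>i<n. d (x i) - d (x' i)) \<longleftrightarrow> convergent (\<lambda>m. \<Theta> (e x) m - \<Theta> (e x') m)"
        using E[of "e x" "e x'"] by (simp add: B(3))
    qed (use B d conn in \<open>simp_all add: diagonal_bounded_def\<close>)
    obtain r T where "block_limit N M d (\<lambda>x. \<Theta> (e (spread r x))) (\<lambda>i. l (r i)) T" by (rule block_limit_exists)
    then show ?thesis by (rule block_limit.homomorphism_exists)
  qed
qed

subsection \<open>The invariant mean on a compact abelian group\<close>

definition avg :: "'g::ab_group_add list \<Rightarrow> ('g \<Rightarrow> 'b::real_normed_vector) \<Rightarrow> 'g \<Rightarrow> 'b"
  where "avg ys f x = (\<Sum>y\<leftarrow>ys. f (x + y)) /\<^sub>R real (length ys)"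

text \<open>Von Neumann's mean value: c is a uniform limit of averages of finitely many translates
  of f. On continuous functions it plays the role of the Haar integral.\<close>

definition has_mean :: "('g::ab_group_add \<Rightarrow> 'b::real_normed_vector) \<Rightarrow> 'b \<Rightarrow> bool"
  where "has_mean f c \<longleftrightarrow> (\<forall>e>0. \<exists>ys. ys \<noteq> [] \<and> (\<forall>x. norm (avg ys f x - c) \<le> e))"

lemma sum_list_swap:
  "(\<Sum>x\<leftarrow>xs. \<Sum>y\<leftarrow>ys. f x y) = (\<Sum>y\<leftarrow>ys. \<Sum>x\<leftarrow>xs. f x y :: 'a::comm_monoid_add)"
  by (induction xs) (simp_all add: sum_list_addf)

lemma avg_add: "avg ys (\<lambda>x. f x + g x) x = avg ys f x + avg ys g x"
  by (simp add: avg_def sum_list_addf scaleR_add_right)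

lemma avg_bounded_linear: "bounded_linear T \<Longrightarrow> avg ys (\<lambda>x. T (f x)) x = T (avg ys f x)"
proof -
  assume T: "bounded_linear T"
  then interpret bounded_linear T .
  have "(\<Sum>y\<leftarrow>ys. T (f (x + y))) = T (\<Sum>y\<leftarrow>ys. f (x + y))" by (induction ys) (simp_all add: add)
  then show ?thesis by (simp add: avg_def scaleR)
qed

lemma avg_const: "ys \<noteq> [] \<Longrightarrow> avg ys (\<lambda>_. c) x = c"
proof -
  assume "ys \<noteq> []"
  moreover have "(\<Sum>y\<leftarrow>ys. c) = real (length ys) *\<^sub>R c" by (induction ys) (simp_all add: scaleR_left_distrib)
  ultimately show ?thesis by (simp add: avg_def)
qed

lemma avg_real: "avg ys f x = (\<Sum>y\<leftarrow>ys. f (x + y)) / real (length ys)" for f :: "'g::ab_group_add \<Rightarrow> real"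
  unfolding avg_def real_scaleR_def divide_inverse by (rule mult.commute)

lemma avg_commute: "avg ys (avg zs f) x = avg zs (avg ys f) x"
proof -
  have "(\<Sum>y\<leftarrow>ys. (\<Sum>z\<leftarrow>zs. f (x + y + z)) /\<^sub>R a) = (\<Sum>y\<leftarrow>ys. \<Sum>z\<leftarrow>zs. f (x + y + z)) /\<^sub>R a" for a ys zs
    by (induction ys) (simp_all add: scaleR_add_right)
  then show ?thesis unfolding avg_def
    by (simp add: sum_list_swap[of _ zs ys] add_ac mult.commute)
qed

lemma avg_avg:
  assumes "ys \<noteq> []" "zs \<noteq> []"
  obtains ws where "ws \<noteq> []" "\<And>x. avg ys (avg zs f) x = avg ws f x"
proof
  define ws where "ws = concat (map (\<lambda>y. map (\<lambda>z. y + z) zs) ys)"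
  show "ws \<noteq> []" using assms by (cases ys; cases zs) (auto simp: ws_def)
  have len: "length ws = length ys * length zs" unfolding ws_def by (induction ys) auto
  show "avg ys (avg zs f) x = avg ws f x" for x
  proof -
    have 1: "(\<Sum>w\<leftarrow>ws. f (x + w)) = (\<Sum>y\<leftarrow>ys. \<Sum>z\<leftarrow>zs. f (x + y + z))"
      unfolding ws_def by (induction ys) (simp_all add: o_def add.assoc)
    have "(\<Sum>y\<leftarrow>ys. (\<Sum>z\<leftarrow>zs. f (x + y + z)) /\<^sub>R a) = (\<Sum>y\<leftarrow>ys. \<Sum>z\<leftarrow>zs. f (x + y + z)) /\<^sub>R a" for a
      by (induction ys) (simp_all add: scaleR_add_right)
    then show ?thesis unfolding avg_def 1 len by simp
  qed
qed

lemma norm_avg_le: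
  assumes "ys \<noteq> []" "\<And>x. norm (f x) \<le> e"
  shows "norm (avg ys f x) \<le> e"
proof -
  have "norm (\<Sum>y\<leftarrow>ys. f (x + y)) \<le> real (length ys) * e"
  proof (induction ys)
    case (Cons y ys)
    have "norm (f (x + y) + (\<Sum>y\<leftarrow>ys. f (x + y))) \<le> e + real (length ys) * e"
      by (rule norm_triangle_le) (use Cons assms(2) add_mono in blast)
    then show ?case by (simp add: algebra_simps)
  qed simp
  then show ?thesis using assms(1) by (simp add: avg_def field_simps)
qed

lemma avg_diff_const: "ys \<noteq> [] \<Longrightarrow> avg ys f x - c = avg ys (\<lambda>x. f x - c) x"
  using avg_add[of ys f "\<lambda>_. - c" x] avg_const[of ys "- c" x] by simp

lemma norm_avg_diff_le:
  assumes "ys \<noteq> []" "\<And>x. norm (f x - c) \<le> e"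
  shows "norm (avg ys f x - c) \<le> e"
  unfolding avg_diff_const[OF assms(1)] by (rule norm_avg_le[OF assms])

text \<open>Averaging over ys commutes with averaging over zs, so one double average is close to
  both values.\<close>

lemma has_mean_unique:
  assumes "has_mean f c" "has_mean f c'" shows "c = c'"
proof -
  have "norm (c - c') \<le> e" if e: "e > 0" for e
  proof -
    obtain ys zs where ys: "ys \<noteq> []" "\<And>x. norm (avg ys f x - c) \<le> e/2" "zs \<noteq> []" "\<And>x. norm (avg zs f x - c') \<le> e/2"
      using assms half_gt_zero[OF e] unfolding has_mean_def by meson
    have "norm (avg zs (avg ys f) 0 - c) \<le> e/2" by (rule norm_avg_diff_le[OF ys(3,2)])
    moreover have "norm (avg zs (avg ys f) 0 - c') \<le> e/2" unfolding avg_commute[of zs] by (rule norm_avg_diff_le[OF ys(1,4)])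
    ultimately show ?thesis using norm_triangle_ineq4[of "avg zs (avg ys f) 0 - c'" "avg zs (avg ys f) 0 - c"] by simp
  qed
  then show ?thesis by (metis eq_iff_diff_eq_0 field_le_epsilon norm_le_zero_iff add_0)
qed

lemma has_mean_add:
  assumes "has_mean f c" "has_mean g d" shows "has_mean (\<lambda>x. f x + g x) (c + d)"
  unfolding has_mean_def
proof (intro allI impI)
  fix e :: real assume "e > 0"
  then obtain ys zs where ys: "ys \<noteq> []" "\<And>x. norm (avg ys f x - c) \<le> e/2" "zs \<noteq> []" "\<And>x. norm (avg zs g x - d) \<le> e/2"
    using assms half_gt_zero unfolding has_mean_def by meson
  obtain ws where ws: "ws \<noteq> []" "\<And>x. avg ys (avg zs (\<lambda>x. f x + g x)) x = avg ws (\<lambda>x. f x + g x) x" using avg_avg[OF ys(1,3)] by blast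
  have "norm (avg ws (\<lambda>x. f x + g x) x - (c + d)) \<le> e" for x
  proof -
    have "avg ws (\<lambda>x. f x + g x) x = avg zs (avg ys f) x + avg ys (avg zs g) x"
      unfolding ws(2)[symmetric] avg_commute[of zs] by (simp add: avg_add[abs_def])
    moreover have "norm (avg zs (avg ys f) x - c) \<le> e/2" by (rule norm_avg_diff_le[OF ys(3,2)])
    moreover have "norm (avg ys (avg zs g) x - d) \<le> e/2" by (rule norm_avg_diff_le[OF ys(1,4)])
    ultimately show ?thesis using norm_triangle_ineq[of "avg zs (avg ys f) x - c" "avg ys (avg zs g) x - d"]
      by (simp add: algebra_simps)
  qed
  then show "\<exists>ys. ys \<noteq> [] \<and> (\<forall>x. norm (avg ys (\<lambda>x. f x + g x) x - (c + d)) \<le> e)" using ws(1) by blast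
qed

lemma has_mean_bounded_linear:
  assumes T: "bounded_linear T" and f: "has_mean f c" shows "has_mean (\<lambda>x. T (f x)) (T c)"
  unfolding has_mean_def
proof (intro allI impI)
  fix e :: real assume e: "e > 0"
  interpret bounded_linear T by fact
  obtain K where K: "K > 0" "\<And>x. norm (T x) \<le> norm x * K" using pos_bounded by blast
  obtain ys where ys: "ys \<noteq> []" "\<And>x. norm (avg ys f x - c) \<le> e / K" using f e K(1) unfolding has_mean_def by (meson divide_pos_pos)
  have "norm (avg ys (\<lambda>x. T (f x)) x - T c) \<le> e" for x
  proof -
    have "norm (T (avg ys f x - c)) \<le> norm (avg ys f x - c) * K" by (rule K)
    also have "\<dots> \<le> e" using ys(2)[of x] K(1) by (simp add: pos_le_divide_eq)
    finally show ?thesis by (simp add: avg_bounded_linear[OF T] diff)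
  qed
  then show "\<exists>ys. ys \<noteq> [] \<and> (\<forall>x. norm (avg ys (\<lambda>x. T (f x)) x - T c) \<le> e)" using ys(1) by blast
qed

lemma has_mean_translate:
  assumes "has_mean f c" shows "has_mean (\<lambda>x. f (x + a)) c"
proof -
  have "avg ys (\<lambda>x. f (x + a)) x = avg ys f (x + a)" for ys x by (simp add: avg_def add_ac)
  then show ?thesis using assms unfolding has_mean_def by metis
qed

lemma has_mean_const: "has_mean (\<lambda>_. c) c"
  unfolding has_mean_def by (auto intro!: exI[of _ "[0]"] simp: avg_def)

lemma has_mean_avg:
  assumes "has_mean f c" "ys \<noteq> []" shows "has_mean (avg ys f) c"
  unfolding has_mean_def
proof (intro allI impI)
  fix e :: real assume "e > 0"
  then obtain zs where zs: "zs \<noteq> []" "\<And>x. norm (avg zs f x - c) \<le> e" using assms unfolding has_mean_def by meson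
  have "norm (avg zs (avg ys f) x - c) \<le> e" for x
    unfolding avg_commute[of zs] by (rule norm_avg_diff_le[OF assms(2) zs(2)])
  then show "\<exists>zs. zs \<noteq> [] \<and> (\<forall>x. norm (avg zs (avg ys f) x - c) \<le> e)" using zs(1) by blast
qed

lemma has_mean_nonneg:
  fixes f :: "'g::ab_group_add \<Rightarrow> real"
  assumes "has_mean f c" "\<And>x. f x \<ge> 0" shows "c \<ge> 0"
proof (rule field_le_epsilon)
  fix e :: real assume "e > 0"
  then obtain ys where ys: "\<And>x. norm (avg ys f x - c) \<le> e" using assms unfolding has_mean_def by meson
  have "avg ys f 0 \<ge> 0" unfolding avg_real by (auto intro!: divide_nonneg_nonneg sum_list_nonneg assms(2))
  then show "0 \<le> c + e" using ys[of 0] by (simp add: abs_le_iff)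
qed

definition mean :: "('g::ab_group_add \<Rightarrow> 'b::real_normed_vector) \<Rightarrow> 'b"
  where "mean f = (THE c. has_mean f c)"

lemma mean_eqI: "has_mean f c \<Longrightarrow> mean f = c"
  unfolding mean_def using has_mean_unique by blast

section \<open>Existence and positivity of the mean\<close>

locale compact_ab_group = group_norm M
  for M :: "'g::{topological_ab_group_add, polish_space} \<Rightarrow> real" +
  assumes compact_UNIV: "compact (UNIV :: 'g set)"
begin

lemma convergent_subsequence:
  obtains l r where "strict_mono (r::nat \<Rightarrow> nat)" "(\<lambda>n. u (r n) :: 'g) \<longlonglongrightarrow> l"
proof -
  obtain l r where "strict_mono (r::nat \<Rightarrow> nat)" "(u \<circ> r) \<longlonglongrightarrow> l"
    by (rule seq_compactE[OF compact_imp_seq_compact[OF compact_UNIV], of u]) auto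
  then show ?thesis by (intro that[of r l]) (simp_all add: comp_def)
qed

lemma uniform_small:
  fixes f :: "'g \<Rightarrow> 'b::metric_space"
  assumes "continuous_on UNIV f" "e > 0"
  shows "\<exists>r>0. \<forall>x u. M u < r \<longrightarrow> dist (f (x + u)) (f x) < e"
proof (rule ccontr)
  assume "\<not> ?thesis"
  then have "\<forall>n. \<exists>x u. M u < 1 / real (Suc n) \<and> \<not> dist (f (x + u)) (f x) < e" by fastforce
  then obtain x u where xu: "\<And>n. M (u n) < 1 / real (Suc n)" "\<And>n. \<not> dist (f (x n + u n)) (f (x n)) < e" by metis
  obtain l r where r: "strict_mono r" "(\<lambda>n. x (r n)) \<longlonglongrightarrow> l" by (rule convergent_subsequence)
  have "(\<lambda>n. M (u n)) \<longlonglongrightarrow> 0"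
    by (rule Lim_null_comparison[OF _ LIMSEQ_inverse_real_of_nat])
      (use xu(1) in \<open>auto simp: inverse_eq_divide intro!: always_eventually less_imp_le\<close>)
  then have "u \<longlonglongrightarrow> 0" by (simp add: tendsto_iff)
  then have "(\<lambda>n. u (r n)) \<longlonglongrightarrow> 0" using LIMSEQ_subseq_LIMSEQ[OF _ r(1)] by (auto simp: comp_def)
  then have "(\<lambda>n. x (r n) + u (r n)) \<longlonglongrightarrow> l" using tendsto_add[OF r(2)] by fastforce
  then have "(\<lambda>n. f (x (r n) + u (r n))) \<longlonglongrightarrow> f l" using continuous_on_tendsto_compose[OF assms(1)] by auto
  moreover have "(\<lambda>n. f (x (r n))) \<longlonglongrightarrow> f l" using continuous_on_tendsto_compose[OF assms(1) r(2)] by auto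
  ultimately have "(\<lambda>n. dist (f (x (r n) + u (r n))) (f (x (r n)))) \<longlonglongrightarrow> dist (f l) (f l)" by (rule tendsto_dist)
  then have "\<forall>\<^sub>F n in sequentially. dist (f (x (r n) + u (r n))) (f (x (r n))) < e" using assms(2) by (intro order_tendstoD(2)) auto
  then show False using xu(2) by simp
qed

lemma finite_net:
  assumes "r > 0"
  obtains ys where "ys \<noteq> []" "\<And>x. \<exists>y\<in>set ys. M (x - y) < r"
proof -
  have "UNIV \<subseteq> (\<Union>y\<in>UNIV. {x. M (x - y) < r})" using assms by (auto intro!: exI[where P = "\<lambda>y. M (_ - y) < r"])
  then obtain Y where Y: "finite Y" "UNIV \<subseteq> (\<Union>y\<in>Y. {x. M (x - y) < r})"
    using compactE_image[OF compact_UNIV, of UNIV "\<lambda>y. {x. M (x - y) < r}"] open_ball by metis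
  obtain ys where "set ys = Y" using finite_list[OF Y(1)] by blast
  with Y have "\<exists>y\<in>set ys. M (x - y) < r" for x by blast
  moreover from this[of 0] have "ys \<noteq> []" by auto
  ultimately show ?thesis using that by blast
qed

lemma continuous_on_avg: "continuous_on UNIV f \<Longrightarrow> continuous_on UNIV (avg ys (f :: 'g \<Rightarrow> 'b::real_normed_vector))"
proof -
  assume f: "continuous_on UNIV f"
  have "continuous_on UNIV (\<lambda>x. \<Sum>y\<leftarrow>ys. f (x + y))"
  proof (induction ys)
    case (Cons y ys)
    have "continuous_on UNIV (\<lambda>x. f (x + y))" by (intro continuous_on_compose2[OF f] continuous_intros) auto
    then show ?case using Cons by (auto intro: continuous_on_add)
  qed auto
  then show ?thesis unfolding avg_def[abs_def] by (intro continuous_intros)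
qed

text \<open>Averaging over an r-net of n points contracts the oscillation: for every x some
  translate x + y0 is close to a minimum point, so one of the n summands exceeds the minimum by at
  most e / 2. The part of the oscillation above e / 2 shrinks by the factor 1 - 1/n each
  time.\<close>

lemma avg_oscillation:
  fixes f :: "'g \<Rightarrow> real"
  assumes f: "continuous_on UNIV f" and e: "e > 0"
  obtains ys where "ys \<noteq> []" "\<And>x x'. avg ys f x - avg ys f x' \<le> e"
proof -
  obtain r where r: "r > 0" "\<And>x u. M u < r \<Longrightarrow> \<bar>f (x + u) - f x\<bar> < e / 2"
    using uniform_small[OF f, of "e/2"] e by (auto simp: dist_real_def)
  obtain ys where ys: "ys \<noteq> []" "\<And>x. \<exists>y\<in>set ys. M (x - y) < r" using finite_net[OF r(1)] by blast
  define n where "n = real (length ys)"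
  have n: "n \<ge> 1" using ys(1) by (cases ys) (auto simp: n_def)
  have near: "avg zs f (x + u) - avg zs f x \<le> e / 2" if "zs \<noteq> []" "M u < r" for zs x u
  proof -
    have "avg zs f (x + u) - avg zs f x = avg zs (\<lambda>x. f (x + u) - f x) x"
      by (simp add: avg_real sum_list_subtractf add_ac diff_divide_distrib)
    moreover have "norm (avg zs (\<lambda>x. f (x + u) - f x) x) \<le> e / 2"
      by (rule norm_avg_le[OF that(1)]) (use r(2)[OF that(2)] in \<open>auto simp: less_imp_le\<close>)
    ultimately show ?thesis by (simp add: abs_le_iff)
  qed
  obtain x1 where x1: "\<And>x. f x1 \<le> f x" using continuous_attains_inf[OF compact_UNIV UNIV_not_empty f] by blast
  obtain x2 where x2: "\<And>x. f x \<le> f x2" using continuous_attains_sup[OF compact_UNIV UNIV_not_empty f] by blast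
  define C where "C = f x2 - f x1"
  have "\<exists>zs. zs \<noteq> [] \<and> (\<forall>x x'. avg zs f x - avg zs f x' \<le> e / 2 + C * (1 - 1/n)^k)" for k
  proof (induction k)
    case 0
    have "f x - f x' \<le> e / 2 + C" for x x' using x1[of x'] x2[of x] e by (simp add: C_def)
    then show ?case by (intro exI[of _ "[0]"]) (simp add: avg_def)
  next
    case (Suc k)
    then obtain zs where zs: "zs \<noteq> []" "\<And>x x'. avg zs f x - avg zs f x' \<le> e / 2 + C * (1 - 1/n)^k" by blast
    define F where "F = avg zs f"
    define D where "D = e / 2 + C * (1 - 1/n)^k"
    obtain x0 where x0: "\<And>x. F x0 \<le> F x"
      using continuous_attains_inf[OF compact_UNIV UNIV_not_empty continuous_on_avg[OF f, of zs]] unfolding F_def by blast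
    have up: "avg ys F x \<le> F x0 + D - (D - e / 2) / n" for x
    proof -
      obtain y0 where y0: "y0 \<in> set ys" "M ((x0 - x) - y0) < r" using ys(2) by blast
      have "F (x + y0) \<le> F x0 + e / 2"
      proof -
        have "M (x + y0 - x0) < r" using y0(2) minus[of "x0 - x - y0"] by (simp add: algebra_simps)
        from near[OF zs(1) this, of x0] show ?thesis by (simp add: F_def)
      qed
      moreover have "F (x + y) \<le> F x0 + D" for y using zs(2)[of "x + y" x0] by (simp add: F_def D_def)
      then have "(\<Sum>y\<leftarrow>remove1 y0 ys. F (x + y)) \<le> (\<Sum>y\<leftarrow>remove1 y0 ys. F x0 + D)" by (intro sum_list_mono) auto
      moreover have "(\<Sum>y\<leftarrow>remove1 y0 ys. F x0 + D) = (n - 1) * (F x0 + D)"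
      proof -
        have "1 \<le> length ys" using y0(1) by (cases ys) auto
        then show ?thesis using y0(1) by (simp add: sum_list_triv length_remove1 n_def of_nat_diff)
      qed
      moreover have "(\<Sum>y\<leftarrow>ys. F (x + y)) = F (x + y0) + (\<Sum>y\<leftarrow>remove1 y0 ys. F (x + y))"
        by (rule sum_list_map_remove1[OF y0(1)])
      ultimately have "(\<Sum>y\<leftarrow>ys. F (x + y)) \<le> n * (F x0 + D) - (D - e / 2)" by (simp add: algebra_simps)
      then have "(\<Sum>y\<leftarrow>ys. F (x + y)) / n \<le> (n * (F x0 + D) - (D - e / 2)) / n" using n by (intro divide_right_mono) auto
      also have "\<dots> = F x0 + D - (D - e / 2) / n" using n by (simp add: diff_divide_distrib)
      finally show ?thesis by (simp add: avg_real n_def)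
    qed
    have lo: "F x0 \<le> avg ys F x" for x
    proof -
      have "(\<Sum>y\<leftarrow>ys. F x0) \<le> (\<Sum>y\<leftarrow>ys. F (x + y))" by (intro sum_list_mono x0)
      then have "n * F x0 \<le> (\<Sum>y\<leftarrow>ys. F (x + y))" by (simp add: sum_list_triv n_def)
      then have "F x0 \<le> (\<Sum>y\<leftarrow>ys. F (x + y)) / n" using n by (simp add: field_simps)
      then show ?thesis by (simp add: avg_real n_def)
    qed
    have DD: "D - (D - e / 2) / n = e / 2 + C * (1 - 1/n)^Suc k" unfolding D_def using n by (simp add: field_simps)
    obtain ws where ws: "ws \<noteq> []" "\<And>x. avg ys (avg zs f) x = avg ws f x" using avg_avg[OF ys(1) zs(1)] by blast
    have "avg ws f x - avg ws f x' \<le> e / 2 + C * (1 - 1/n)^Suc k" for x x'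
      using up[of x] lo[of x'] DD unfolding F_def ws(2) by simp
    then show ?case using ws(1) by blast
  qed
  moreover have "\<exists>k. C * (1 - 1/n)^k < e / 2"
  proof -
    have "(\<lambda>k. C * (1 - 1/n)^k) \<longlonglongrightarrow> C * 0" using n by (intro tendsto_intros LIMSEQ_realpow_zero) (auto simp: field_simps)
    then have "\<forall>\<^sub>F k in sequentially. C * (1 - 1/n)^k < e / 2" using e by (intro order_tendstoD(2)) auto
    then show ?thesis by (auto simp: eventually_sequentially)
  qed
  ultimately obtain zs k where zs: "zs \<noteq> []" "\<And>x x'. avg zs f x - avg zs f x' \<le> e / 2 + C * (1 - 1/n)^k" "C * (1 - 1/n)^k < e / 2" by metis
  have "avg zs f x - avg zs f x' \<le> e" for x x' using zs(2)[of x x'] zs(3) by linarith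
  then show ?thesis using that[OF zs(1)] by blast
qed

text \<open>The mean is the infimum of the uniform upper bounds of averages. An average of small
  oscillation that stays below such a bound cannot drop much below the infimum anywhere, or it would
  yield a smaller upper bound.\<close>

lemma has_mean_real_exists:
  fixes f :: "'g \<Rightarrow> real"
  assumes f: "continuous_on UNIV f"
  shows "\<exists>c. has_mean f c"
proof -
  define S where "S = {s. \<exists>ys. ys \<noteq> [] \<and> (\<forall>x. avg ys f x \<le> s)}"
  obtain x1 where x1: "\<And>x. f x1 \<le> f x" using continuous_attains_inf[OF compact_UNIV UNIV_not_empty f] by blast
  obtain x2 where x2: "\<And>x. f x \<le> f x2" using continuous_attains_sup[OF compact_UNIV UNIV_not_empty f] by blast
  have ne: "S \<noteq> {}" unfolding S_def using x2 by (auto intro!: exI[of _ "f x2"] exI[of _ "[0]"] simp: avg_def)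
  have lb: "f x1 \<le> s" if "s \<in> S" for s
  proof -
    obtain ys where ys: "ys \<noteq> []" "\<And>x. avg ys f x \<le> s" using \<open>s \<in> S\<close> by (auto simp: S_def)
    have "(\<Sum>y\<leftarrow>ys. f x1) \<le> (\<Sum>y\<leftarrow>ys. f (0 + y))" by (intro sum_list_mono x1)
    then have "f x1 \<le> avg ys f 0" using ys(1) by (simp add: sum_list_triv avg_real field_simps)
    then show ?thesis using ys(2)[of 0] by simp
  qed
  have bdd: "bdd_below S" using lb by (rule bdd_belowI)
  define c where "c = Inf S"
  have "has_mean f c" unfolding has_mean_def
  proof (intro allI impI)
    fix e :: real assume e: "e > 0"
    obtain s where s: "s \<in> S" "s < c + e / 2" using cInf_lessD[OF ne, of "c + e/2"] e by (auto simp: c_def)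
    then obtain ys where ys: "ys \<noteq> []" "\<And>x. avg ys f x \<le> s" by (auto simp: S_def)
    obtain zs where zs: "zs \<noteq> []" "\<And>x x'. avg zs f x - avg zs f x' \<le> e / 2" using avg_oscillation[OF f, of "e/2"] e by auto
    obtain ws where ws: "ws \<noteq> []" "\<And>x. avg ys (avg zs f) x = avg ws f x" using avg_avg[OF ys(1) zs(1)] by blast
    have osc: "avg ws f x - avg ws f x' \<le> e / 2" for x x'
    proof -
      have "avg ys (avg zs f) x - avg ys (avg zs f) x' = avg ys (\<lambda>t. avg zs f (t + (x - x')) - avg zs f t) x'"
        by (simp add: avg_real sum_list_subtractf add_ac diff_divide_distrib algebra_simps)
      moreover have "norm (avg ys (\<lambda>t. avg zs f (t + (x - x')) - avg zs f t) x') \<le> e / 2"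
        by (rule norm_avg_le[OF ys(1)]) (simp only: real_norm_def, rule abs_leI, rule zs, subst minus_diff_eq, rule zs)
      ultimately show ?thesis unfolding ws(2)[symmetric] by (simp add: abs_le_iff)
    qed
    have up: "avg ws f x \<le> c + e / 2" for x
    proof -
      have "avg zs (avg ys f) x \<le> s"
      proof -
        have "(\<Sum>y\<leftarrow>zs. avg ys f (x + y)) \<le> (\<Sum>y\<leftarrow>zs. s)" by (intro sum_list_mono ys)
        then show ?thesis using zs(1) by (simp add: sum_list_triv avg_real[of zs] field_simps)
      qed
      then show ?thesis using s(2) by (simp add: ws(2)[symmetric] avg_commute[of ys])
    qed
    have "c - e \<le> avg ws f x" for x
    proof (rule ccontr)
      assume "\<not> c - e \<le> avg ws f x"
      then have "avg ws f x' \<le> c - e / 2" for x' using osc[of x' x] by simp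
      then have "c - e / 2 \<in> S" using ws(1) by (auto simp: S_def)
      then show False using cInf_lower[OF _ bdd] e by (fastforce simp: c_def)
    qed
    then have "norm (avg ws f x - c) \<le> e" for x using up[of x] e by (simp add: abs_le_iff algebra_simps)
    then show "\<exists>ys. ys \<noteq> [] \<and> (\<forall>x. norm (avg ys f x - c) \<le> e)" using ws(1) by blast
  qed
  then show ?thesis by blast
qed

lemma has_mean_real: "continuous_on UNIV f \<Longrightarrow> has_mean f (mean f)" for f :: "'g \<Rightarrow> real"
  using has_mean_real_exists mean_eqI by metis

lemma has_mean_complex: "continuous_on UNIV f \<Longrightarrow> has_mean f (mean f)" for f :: "'g \<Rightarrow> complex"
proof -
  assume f: "continuous_on UNIV f"
  have R: "has_mean (\<lambda>x. complex_of_real (Re (f x))) (complex_of_real (mean (\<lambda>x. Re (f x))))"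
    by (rule has_mean_bounded_linear[OF bounded_linear_of_real has_mean_real]) (intro continuous_intros f)
  have "has_mean (\<lambda>x. complex_of_real (Im (f x))) (complex_of_real (mean (\<lambda>x. Im (f x))))"
    by (rule has_mean_bounded_linear[OF bounded_linear_of_real has_mean_real]) (intro continuous_intros f)
  then have "has_mean (\<lambda>x. \<i> * complex_of_real (Im (f x))) (\<i> * complex_of_real (mean (\<lambda>x. Im (f x))))"
    by (rule has_mean_bounded_linear[OF bounded_linear_mult_right])
  from has_mean_add[OF R this] have "\<exists>c. has_mean f c" by (auto simp: complex_eq[symmetric])
  then show ?thesis using mean_eqI by metis
qed

text \<open>From any point some net translate comes near a, so averaging over the net spreads the
  positivity at a into a uniform lower bound.\<close>

lemma mean_pos:
  fixes f :: "'g \<Rightarrow> real"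
  assumes f: "continuous_on UNIV f" "\<And>x. f x \<ge> 0" "f a > 0"
  shows "mean f > 0"
proof -
  obtain r where r: "r > 0" "\<And>x u. M u < r \<Longrightarrow> \<bar>f (x + u) - f x\<bar> < f a / 2"
    using uniform_small[OF f(1), of "f a / 2"] f(3) by (auto simp: dist_real_def)
  obtain ys where ys: "ys \<noteq> []" "\<And>x. \<exists>y\<in>set ys. M (x - y) < r" using finite_net[OF r(1)] by blast
  define c where "c = f a / 2 / real (length ys)"
  have c: "c > 0" using f ys by (simp add: c_def)
  have nn: "avg ys f x + - c \<ge> 0" for x
  proof -
    obtain y where y: "y \<in> set ys" "M ((a - x) - y) < r" using ys(2) by blast
    have "M (x + y - a) < r" using y(2) minus[of "a - x - y"] by (simp add: algebra_simps)
    from r(2)[OF this, of a] have "\<bar>f (x + y) - f a\<bar> < f a / 2" by (simp add: add.commute)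
    then have "f a / 2 \<le> f (x + y)" using field_sum_of_halves[of "f a"] by (simp only: abs_less_iff) linarith
    also have "\<dots> \<le> (\<Sum>y\<leftarrow>ys. f (x + y))" using y(1) f(2) by (intro member_le_sum_list) auto
    finally show ?thesis using ys(1) by (simp add: avg_real c_def field_simps)
  qed
  have "has_mean (\<lambda>x. avg ys f x + - c) (mean f + - c)"
    by (rule has_mean_add[OF has_mean_avg[OF has_mean_real[OF f(1)] ys(1)] has_mean_const])
  then have "mean f + - c \<ge> 0" using nn by (rule has_mean_nonneg)
  then show ?thesis using c by simp
qed

end

subsection \<open>Positive definite functions and characters\<close>

definition herm_form :: "('g::ab_group_add \<Rightarrow> complex) \<Rightarrow> (complex \<times> 'g) list \<Rightarrow> complex"
  where "herm_form \<phi> ps = (\<Sum>p\<leftarrow>ps. \<Sum>q\<leftarrow>ps. fst p * cnj (fst q) * \<phi> (snd p - snd q))"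

definition pos_def :: "('g::ab_group_add \<Rightarrow> complex) \<Rightarrow> bool"
  where "pos_def \<phi> \<longleftrightarrow> (\<forall>x. \<phi> (- x) = cnj (\<phi> x)) \<and> (\<forall>ps. 0 \<le> Re (herm_form \<phi> ps))"

lemma pos_def_herm: "pos_def \<phi> \<Longrightarrow> \<phi> (- x) = cnj (\<phi> x)" by (simp add: pos_def_def)
lemma pos_def_form: "pos_def \<phi> \<Longrightarrow> 0 \<le> Re (herm_form \<phi> ps)" by (simp add: pos_def_def)

lemma pos_def_0:
  assumes "pos_def \<phi>" shows "Im (\<phi> 0) = 0" "0 \<le> Re (\<phi> 0)" "\<phi> 0 = complex_of_real (Re (\<phi> 0))"
proof -
  show "Im (\<phi> 0) = 0" using pos_def_herm[OF assms, of 0] by (simp add: complex_eq_iff)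
  then show "\<phi> 0 = complex_of_real (Re (\<phi> 0))" by (simp add: complex_eq_iff)
  show "0 \<le> Re (\<phi> 0)" using pos_def_form[OF assms, of "[(1, 0)]"] by (simp add: herm_form_def)
qed

text \<open>Test the form at x and 0, with the weight at 0 chosen so that the cross terms become -
  norm (\<phi> x).\<close>

lemma pos_def_bound:
  assumes "pos_def \<phi>" shows "norm (\<phi> x) \<le> Re (\<phi> 0)"
proof -
  define c where "c = sgn (\<phi> x)"
  have "norm c \<le> 1" by (simp add: c_def norm_sgn)
  have cc: "cnj c * \<phi> x = norm (\<phi> x)"
  proof -
    have "cnj (\<phi> x) * \<phi> x = (norm (\<phi> x))\<^sup>2" using complex_norm_square[of "\<phi> x"] by (simp add: mult.commute)
    then show ?thesis by (simp add: c_def sgn_div_norm scaleR_conv_of_real power2_eq_square field_simps)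
  qed
  have "herm_form \<phi> [(1, x), (- c, 0)] = \<phi> 0 - cnj c * \<phi> x - cnj (cnj c * \<phi> x) + c * cnj c * \<phi> 0"
    using pos_def_herm[OF assms, of x] by (simp add: herm_form_def algebra_simps)
  also have "Re \<dots> = Re (\<phi> 0) - 2 * norm (\<phi> x) + (norm c)\<^sup>2 * Re (\<phi> 0)"
    unfolding cc complex_norm_square[symmetric] by simp
  finally have "0 \<le> Re (\<phi> 0) - 2 * norm (\<phi> x) + (norm c)\<^sup>2 * Re (\<phi> 0)" using pos_def_form[OF assms] by metis
  moreover have "(norm c)\<^sup>2 * Re (\<phi> 0) \<le> 1 * Re (\<phi> 0)"
    using \<open>norm c \<le> 1\<close> pos_def_0(2)[OF assms] by (intro mult_right_mono) (auto simp: power_le_one)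
  ultimately show ?thesis by simp
qed

lemma pos_def_zero: "pos_def \<phi> \<Longrightarrow> Re (\<phi> 0) = 0 \<Longrightarrow> \<phi> x = 0"
  using pos_def_bound[of \<phi> x] by simp

lemma pos_def_Re_le: "pos_def \<phi> \<Longrightarrow> Re (\<phi> x) \<le> Re (\<phi> 0)"
  using pos_def_bound[of \<phi> x] complex_Re_le_cmod[of "\<phi> x"] by linarith

lemma pos_def_Re_ge: "pos_def \<phi> \<Longrightarrow> - Re (\<phi> 0) \<le> Re (\<phi> x)"
  using pos_def_bound[of \<phi> x] abs_Re_le_cmod[of "\<phi> x"] by linarith

text \<open>Krein's inequality. The form is tested with weights 1 at x and -1 at y, and with the
  weight a at 0 that minimises the result. It upgrades continuity at 0 to uniform
  continuity.\<close>

lemma pos_def_diff: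
  assumes "pos_def \<phi>"
  shows "(norm (\<phi> x - \<phi> y))\<^sup>2 \<le> 2 * Re (\<phi> 0) * (Re (\<phi> 0) - Re (\<phi> (x - y)))"
proof (cases "Re (\<phi> 0) = 0")
  case True
  then show ?thesis using pos_def_zero[OF assms True] by simp
next
  case False
  then have pos: "Re (\<phi> 0) > 0" using pos_def_0(2)[OF assms] by simp
  define \<Delta> where "\<Delta> = \<phi> x - \<phi> y"
  define t where "t = 1 / Re (\<phi> 0)"
  define a where "a = - complex_of_real t * \<Delta>"
  have h: "\<phi> (y - x) = cnj (\<phi> (x - y))" "\<phi> (- x) = cnj (\<phi> x)" "\<phi> (- y) = cnj (\<phi> y)"
    using pos_def_herm[OF assms, of "x - y"] pos_def_herm[OF assms] by auto
  have "herm_form \<phi> [(a, 0), (1, x), (-1, y)] =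
     a * cnj a * \<phi> 0 + 2 * \<phi> 0 - (\<phi> (x - y) + cnj (\<phi> (x - y))) + (cnj a * \<Delta> + cnj (cnj a * \<Delta>))"
    by (simp add: herm_form_def h \<Delta>_def algebra_simps)
  also have "cnj a * \<Delta> = - complex_of_real (t * (norm \<Delta>)\<^sup>2)"
    using complex_norm_square[of \<Delta>] by (simp add: a_def mult_ac)
  also have "a * cnj a = complex_of_real (t\<^sup>2 * (norm \<Delta>)\<^sup>2)"
    using complex_norm_square[of \<Delta>] by (simp add: a_def power2_eq_square mult_ac)
  finally have "0 \<le> t\<^sup>2 * (norm \<Delta>)\<^sup>2 * Re (\<phi> 0) + 2 * Re (\<phi> 0) - 2 * Re (\<phi> (x - y)) - 2 * t * (norm \<Delta>)\<^sup>2"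
    using pos_def_form[OF assms, of "[(a, 0), (1, x), (-1, y)]"] by simp
  moreover have "t\<^sup>2 * (norm \<Delta>)\<^sup>2 * Re (\<phi> 0) = t * (norm \<Delta>)\<^sup>2" using pos by (simp add: t_def power2_eq_square)
  ultimately have "t * (norm \<Delta>)\<^sup>2 \<le> 2 * (Re (\<phi> 0) - Re (\<phi> (x - y)))" by simp
  then show ?thesis using pos by (simp add: t_def \<Delta>_def field_simps)
qed

text \<open>A substitute for the triangle inequality for the defect Re (\<phi> 0) - Re (\<phi> z),
  from the form with weights 1, 1, -2 at z, 0, - x.\<close>

lemma pos_def_triangle:
  assumes "pos_def \<phi>"
  shows "Re (\<phi> 0) - Re (\<phi> z) \<le> 2 * (Re (\<phi> 0) - Re (\<phi> (x + z))) + 2 * (Re (\<phi> 0) - Re (\<phi> x))"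
proof -
  have h: "\<phi> (- x - z) = cnj (\<phi> (x + z))" "\<phi> (- z) = cnj (\<phi> z)" "\<phi> (- x) = cnj (\<phi> x)" "z + x = x + z"
    using pos_def_herm[OF assms, of "x + z"] pos_def_herm[OF assms] by (simp_all add: algebra_simps)
  have "0 \<le> Re (herm_form \<phi> [(1, z), (1, 0), (-2, - x)])" by (rule pos_def_form[OF assms])
  then show ?thesis by (simp add: herm_form_def h)
qed

lemma sum_list_cmult: "(\<Sum>x\<leftarrow>xs. c * f x) = c * (\<Sum>x\<leftarrow>xs. f x :: complex)"
  by (induction xs) (simp_all add: algebra_simps)

lemma herm_form_cmult: "herm_form (\<lambda>x. c * \<phi> x) ps = c * herm_form \<phi> ps"
  unfolding herm_form_def by (simp add: sum_list_cmult[symmetric] mult_ac)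

lemma pos_def_cmult: "pos_def \<phi> \<Longrightarrow> r \<ge> 0 \<Longrightarrow> pos_def (\<lambda>x. complex_of_real r * \<phi> x)"
  by (simp add: pos_def_def herm_form_cmult)

text \<open>On a character \<chi> this is multiplication by 2 + c \<chi>(y) + cnj (c \<chi>(y)),
  which equals |1 + c \<chi>(y)|^2 when |c| = 1. Thus it reweights a positive definite function by a
  nonnegative density, and the choices c and -c split 4 \<phi> into two positive definite
  parts.\<close>

definition shift_avg :: "complex \<Rightarrow> 'g::ab_group_add \<Rightarrow> ('g \<Rightarrow> complex) \<Rightarrow> 'g \<Rightarrow> complex"
  where "shift_avg c y \<phi> x = 2 * \<phi> x + c * \<phi> (x + y) + cnj c * \<phi> (x - y)"

text \<open>The form of the new function on ps is the form of \<phi> on ps joined with its translate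
  by y, weighted by c.\<close>

lemma pos_def_shift_avg:
  assumes "pos_def \<phi>" "norm c = 1"
  shows "pos_def (shift_avg c y \<phi>)"
  unfolding pos_def_def
proof (intro conjI allI)
  fix x
  have "\<phi> (- x) = cnj (\<phi> x)" "\<phi> (- x + y) = cnj (\<phi> (x - y))" "\<phi> (- x - y) = cnj (\<phi> (x + y))"
    using pos_def_herm[OF assms(1), of x] pos_def_herm[OF assms(1), of "x - y"] pos_def_herm[OF assms(1), of "x + y"]
    by (simp_all add: algebra_simps)
  then show "shift_avg c y \<phi> (- x) = cnj (shift_avg c y \<phi> x)" by (simp add: shift_avg_def)
next
  fix ps :: "(complex \<times> 'a) list"
  have cc: "c * cnj c = 1" using assms(2) complex_norm_square[of c] by simp
  define qs where "qs = map (\<lambda>p. (c * fst p, snd p + y)) ps"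
  have "herm_form \<phi> (ps @ qs) = herm_form (shift_avg c y \<phi>) ps"
  proof -
    have e: "(\<Sum>p\<leftarrow>ps. \<Sum>q\<leftarrow>ps. F p q) + (\<Sum>p\<leftarrow>ps. \<Sum>q\<leftarrow>ps. G p q) = (\<Sum>p\<leftarrow>ps. \<Sum>q\<leftarrow>ps. F p q + G p q)"
      for F G :: "complex \<times> 'a \<Rightarrow> complex \<times> 'a \<Rightarrow> complex" by (simp add: sum_list_addf)
    have a: "herm_form \<phi> (ps @ qs) = (\<Sum>p\<leftarrow>ps. \<Sum>q\<leftarrow>ps. fst p * cnj (fst q) * \<phi> (snd p - snd q))
      + (\<Sum>p\<leftarrow>ps. \<Sum>q\<leftarrow>ps. fst p * cnj (c * fst q) * \<phi> (snd p - (snd q + y)))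
      + ((\<Sum>p\<leftarrow>ps. \<Sum>q\<leftarrow>ps. (c * fst p) * cnj (fst q) * \<phi> (snd p + y - snd q))
      + (\<Sum>p\<leftarrow>ps. \<Sum>q\<leftarrow>ps. (c * fst p) * cnj (c * fst q) * \<phi> (snd p + y - (snd q + y))))"
      unfolding herm_form_def qs_def by (simp add: sum_list_addf o_def)
    have eq: "fst p * cnj (fst q) * \<phi> (snd p - snd q) + fst p * cnj (c * fst q) * \<phi> (snd p - (snd q + y)) +
         ((c * fst p) * cnj (fst q) * \<phi> (snd p + y - snd q) + (c * fst p) * cnj (c * fst q) * \<phi> (snd p + y - (snd q + y)))
         = fst p * cnj (fst q) * shift_avg c y \<phi> (snd p - snd q)" for p q :: "complex \<times> 'a"
    proof -
      have "(c * fst p) * cnj (c * fst q) = fst p * cnj (fst q)" using cc by (metis complex_cnj_mult mult.assoc mult.commute mult.left_commute mult_1)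
      then show ?thesis
        using cc by (simp add: shift_avg_def algebra_simps)
    qed
    show ?thesis unfolding a e eq herm_form_def[of "shift_avg c y \<phi>"] ..
  qed
  then show "0 \<le> Re (herm_form (shift_avg c y \<phi>) ps)" using pos_def_form[OF assms(1)] by metis
qed

lemma shift_avg_sum: "shift_avg c y \<phi> x + shift_avg (- c) y \<phi> x = 4 * \<phi> x"
  by (simp add: shift_avg_def)

definition character :: "('g::topological_ab_group_add \<Rightarrow> complex) \<Rightarrow> bool"
  where "character \<xi> \<longleftrightarrow> continuous_on UNIV \<xi> \<and> (\<forall>x y. \<xi> (x + y) = \<xi> x * \<xi> y) \<and> (\<forall>x. norm (\<xi> x) = 1)"

text \<open>The cases c = 1 and c = \<i> together express \<phi> (x + y) as a multiple of \<phi> x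
  with a factor independent of x; evaluation at x = 0 identifies the factor.\<close>

lemma multiplicative_of_shift_avg:
  assumes \<phi>: "pos_def \<phi>" "Re (\<phi> 0) > 0"
    and shift: "\<And>c y. norm c = 1 \<Longrightarrow> \<exists>t::real. \<forall>x. shift_avg c y \<phi> x = t * \<phi> x"
  shows "\<phi> (x + y) * \<phi> 0 = \<phi> x * \<phi> y"
proof -
  have r: "\<phi> 0 = complex_of_real (Re (\<phi> 0))" by (rule pos_def_0(3)[OF \<phi>(1)])
  have h: "\<phi> (- y) = cnj (\<phi> y)" by (rule pos_def_herm[OF \<phi>(1)])
  obtain t1 :: complex where t1: "\<And>x. 2 * \<phi> x + \<phi> (x + y) + \<phi> (x - y) = t1 * \<phi> x"
    using shift[of 1 y] by (auto simp: shift_avg_def)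
  obtain t2 :: complex where t2: "\<And>x. 2 * \<phi> x + \<i> * \<phi> (x + y) - \<i> * \<phi> (x - y) = t2 * \<phi> x"
    using shift[of \<i> y] by (auto simp: shift_avg_def)
  have "2 * \<phi> (x + y) = ((t1 - 2) - \<i> * (t2 - 2)) * \<phi> x"
  proof -
    have a: "\<phi> (x + y) + \<phi> (x - y) = (t1 - 2) * \<phi> x" unfolding left_diff_distrib t1[of x, symmetric] by simp
    have "\<i> * (\<phi> (x + y) - \<phi> (x - y)) = (t2 - 2) * \<phi> x" unfolding left_diff_distrib t2[of x, symmetric] by (simp add: right_diff_distrib)
    then have "\<i> * (\<i> * (\<phi> (x + y) - \<phi> (x - y))) = \<i> * ((t2 - 2) * \<phi> x)" by simp
    then have b: "\<phi> (x + y) - \<phi> (x - y) = - (\<i> * (t2 - 2) * \<phi> x)" by (simp add: mult.assoc[symmetric]) (metis minus_diff_eq)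
    have "2 * \<phi> (x + y) = (\<phi> (x + y) + \<phi> (x - y)) + (\<phi> (x + y) - \<phi> (x - y))" by simp
    then show ?thesis unfolding a b by (simp add: algebra_simps)
  qed
  moreover have "((t1 - 2) - \<i> * (t2 - 2)) * \<phi> 0 = 2 * \<phi> y"
  proof -
    have a: "(t1 - 2) * \<phi> 0 = \<phi> y + cnj (\<phi> y)" unfolding left_diff_distrib t1[of 0, symmetric] using h by simp
    have b: "(t2 - 2) * \<phi> 0 = \<i> * \<phi> y - \<i> * cnj (\<phi> y)" unfolding left_diff_distrib t2[of 0, symmetric] using h by simp
    have "((t1 - 2) - \<i> * (t2 - 2)) * \<phi> 0 = (t1 - 2) * \<phi> 0 - \<i> * ((t2 - 2) * \<phi> 0)" by (simp add: algebra_simps)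
    also have "\<dots> = 2 * \<phi> y" unfolding a b by (simp add: algebra_simps mult.assoc[symmetric])
    finally show ?thesis .
  qed
  ultimately have "2 * \<phi> (x + y) * \<phi> 0 = 2 * \<phi> y * \<phi> x" by (metis mult.commute mult.assoc)
  then show ?thesis by (simp add: mult.commute)
qed

text \<open>The quotient has norm at most 1 at x and at - x, and these two values multiply to
  1.\<close>

lemma character_of_multiplicative:
  assumes \<phi>: "pos_def \<phi>" "Re (\<phi> 0) > 0" "continuous_on UNIV \<phi>"
    and mult: "\<And>x y. \<phi> (x + y) * \<phi> 0 = \<phi> x * \<phi> y"
  shows "character (\<lambda>x. \<phi> x / \<phi> 0)"
  unfolding character_def
proof (intro conjI allI)
  have r: "\<phi> 0 = complex_of_real (Re (\<phi> 0))" by (rule pos_def_0(3)[OF \<phi>(1)])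
  then have n0: "\<phi> 0 \<noteq> 0" using \<phi>(2) by auto
  show "continuous_on UNIV (\<lambda>x. \<phi> x / \<phi> 0)" using n0 by (intro continuous_intros \<phi>(3)) auto
  show m: "\<phi> (x + y) / \<phi> 0 = \<phi> x / \<phi> 0 * (\<phi> y / \<phi> 0)" for x y using mult[of x y] n0 by (simp add: field_simps)
  have N0: "norm (\<phi> 0) = Re (\<phi> 0)" using \<phi>(2) by (subst r) simp
  have le: "norm (\<phi> x / \<phi> 0) \<le> 1" for x
    using pos_def_bound[OF \<phi>(1), of x] \<phi>(2) by (simp add: norm_divide N0)
  fix x
  have "norm (\<phi> x / \<phi> 0) * norm (\<phi> (- x) / \<phi> 0) = 1"
    using m[of x "- x"] n0 by (metis add.right_inverse divide_self norm_mult norm_one)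
  moreover have "norm (\<phi> x / \<phi> 0) * norm (\<phi> (- x) / \<phi> 0) \<le> norm (\<phi> x / \<phi> 0)"
    using mult_left_mono[OF le[of "- x"] norm_ge_zero[of "\<phi> x / \<phi> 0"]] by simp
  ultimately show "norm (\<phi> x / \<phi> 0) = 1" using le[of x] by linarith
qed

section \<open>Calculus of the mean and bump functions\<close>

context compact_ab_group
begin

lemma mean_add: "continuous_on UNIV f \<Longrightarrow> continuous_on UNIV g \<Longrightarrow> mean (\<lambda>x. f x + g x) = mean f + mean g"
  for f g :: "'g \<Rightarrow> real"
  by (rule mean_eqI[OF has_mean_add[OF has_mean_real has_mean_real]])

lemma mean_cmult: "continuous_on UNIV f \<Longrightarrow> mean (\<lambda>x. c * f x) = c * mean f" for f :: "'g \<Rightarrow> real"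
  by (rule mean_eqI[OF has_mean_bounded_linear[OF bounded_linear_mult_right has_mean_real]])

lemma mean_const: "mean (\<lambda>_::'g. c) = (c::real)"
  by (rule mean_eqI[OF has_mean_const])

lemma mean_translate: "continuous_on UNIV f \<Longrightarrow> mean (\<lambda>x. f (x + a)) = mean f" for f :: "'g \<Rightarrow> real"
  by (rule mean_eqI[OF has_mean_translate[OF has_mean_real]])

lemma mean_nonneg: "continuous_on UNIV f \<Longrightarrow> (\<And>x. f x \<ge> 0) \<Longrightarrow> mean f \<ge> 0" for f :: "'g \<Rightarrow> real"
  using has_mean_nonneg[OF has_mean_real] by blast

lemma mean_mono:
  fixes f g :: "'g \<Rightarrow> real"
  assumes "continuous_on UNIV f" "continuous_on UNIV g" "\<And>x. f x \<le> g x"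
  shows "mean f \<le> mean g"
proof -
  have "mean (\<lambda>x. g x + - 1 * f x) \<ge> 0" using assms by (intro mean_nonneg continuous_intros) auto
  moreover have "mean (\<lambda>x. g x + - 1 * f x) = mean g + - 1 * mean f"
    unfolding mean_cmult[OF assms(1), symmetric] by (intro mean_add assms continuous_intros)
  ultimately show ?thesis by simp
qed

lemma mean_abs_diff_le:
  fixes f g :: "'g \<Rightarrow> real"
  assumes "continuous_on UNIV f" "continuous_on UNIV g" "\<And>x. \<bar>f x - g x\<bar> \<le> e"
  shows "\<bar>mean f - mean g\<bar> \<le> e"
proof -
  have "mean f \<le> mean (\<lambda>x. g x + e)" by (rule mean_mono) (use assms in \<open>auto intro!: continuous_intros simp: abs_le_iff algebra_simps\<close>)
  moreover have "mean g \<le> mean (\<lambda>x. f x + e)" by (rule mean_mono) (use assms in \<open>auto intro!: continuous_intros simp: abs_le_iff algebra_simps\<close>)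
  ultimately show ?thesis using assms by (simp add: mean_add mean_const abs_le_iff)
qed

definition bump :: "real \<Rightarrow> 'g \<Rightarrow> real" where "bump r x = max 0 (r - M x)"

lemma continuous_on_M [continuous_intros]: "continuous_on A f \<Longrightarrow> continuous_on A (\<lambda>x. M (f x))"
  by (rule continuous_on_compose2[OF continuous]) auto

lemma continuous_on_bump: "continuous_on UNIV (bump r)"
  unfolding bump_def[abs_def] by (intro continuous_intros)

lemma bump_nonneg: "0 \<le> bump r x" by (simp add: bump_def)
lemma bump_le: "0 \<le> r \<Longrightarrow> bump r x \<le> r" by (simp add: bump_def)

lemma bump_lipschitz: "\<bar>bump r (x + z) - bump r x\<bar> \<le> M z"
  using abs_diff_le[of "x + z" x] by (auto simp: bump_def)

lemma mean_bump_pos: "r > 0 \<Longrightarrow> mean (bump r) > 0"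
  by (rule mean_pos[of _ 0]) (auto simp: continuous_on_bump bump_nonneg, simp add: bump_def)

end

text \<open>Inside the cone of positive definite functions, the set \<open>cap\<close> is cut out by an additive functional;
  it is compact, and an extreme point of it spans an extreme ray of the cone, that is, a multiple of a
  character. An extreme point is found by maximising a strictly convex function.\<close>

locale positive_cap = compact_ab_group M for M :: "'g::{topological_ab_group_add, polish_space} \<Rightarrow> real" +
  fixes R :: "nat \<Rightarrow> real" and L :: real
  assumes R_pos: "R j > 0" and L_pos: "L > 0"
begin

definition w :: "nat \<Rightarrow> real" where "w j = mean (bump (R j))"

lemma w_pos: "w j > 0" unfolding w_def by (rule mean_bump_pos[OF R_pos])

text \<open>A mean of the defect Re (\<phi> 0) - Re (\<phi> x), weighted towards 0 and scaled by
  2^j: a penalty at most L means an average defect of at most L / 2^j on the ball of radius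
  \<open>R j\<close>. It is additive in \<phi>, so bounding a sum of penalties still cuts the cone
  along an additive functional.\<close>

definition pen :: "nat \<Rightarrow> ('g \<Rightarrow> complex) \<Rightarrow> real"
  where "pen j \<phi> = 2^j / w j * mean (\<lambda>x. bump (R j) x * (Re (\<phi> 0) - Re (\<phi> x)))"

lemma cont_pen: "continuous_on UNIV \<phi> \<Longrightarrow> continuous_on UNIV (\<lambda>x. bump (R j) x * (Re (\<phi> 0) - Re (\<phi> x)))"
  by (intro continuous_intros continuous_on_bump)

lemma pen_nonneg: "pos_def \<phi> \<Longrightarrow> continuous_on UNIV \<phi> \<Longrightarrow> 0 \<le> pen j \<phi>"
  unfolding pen_def using w_pos[of j]
  by (intro mult_nonneg_nonneg mean_nonneg cont_pen bump_nonneg) (auto simp: pos_def_Re_le)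

lemma pen_add: "continuous_on UNIV \<phi> \<Longrightarrow> continuous_on UNIV \<psi> \<Longrightarrow> pen j (\<lambda>x. \<phi> x + \<psi> x) = pen j \<phi> + pen j \<psi>"
proof -
  assume c: "continuous_on UNIV \<phi>" "continuous_on UNIV \<psi>"
  have "(\<lambda>x. bump (R j) x * (Re (\<phi> 0 + \<psi> 0) - Re (\<phi> x + \<psi> x))) =
    (\<lambda>x. bump (R j) x * (Re (\<phi> 0) - Re (\<phi> x)) + bump (R j) x * (Re (\<psi> 0) - Re (\<psi> x)))"
    by (simp add: fun_eq_iff algebra_simps)
  then show ?thesis unfolding pen_def by (simp add: mean_add cont_pen c distrib_left)
qed

lemma pen_cmult: "continuous_on UNIV \<phi> \<Longrightarrow> pen j (\<lambda>x. complex_of_real r * \<phi> x) = r * pen j \<phi>"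
proof -
  assume c: "continuous_on UNIV \<phi>"
  have "(\<lambda>x. bump (R j) x * (Re (complex_of_real r * \<phi> 0) - Re (complex_of_real r * \<phi> x))) =
    (\<lambda>x. r * (bump (R j) x * (Re (\<phi> 0) - Re (\<phi> x))))"
    by (simp add: fun_eq_iff algebra_simps)
  then show ?thesis unfolding pen_def by (simp only: mean_cmult[OF cont_pen[OF c]]) simp
qed

text \<open>Average \<open>pos_def_triangle\<close> over x with the bump as weight, and move the
  translation by z onto the bump, whose Lipschitz constant is 1. This turns the average bound on the
  defect into a pointwise one.\<close>

lemma equicontinuity:
  assumes \<phi>: "pos_def \<phi>" "continuous_on UNIV \<phi>" and b: "Re (\<phi> 0) \<le> L" "pen j \<phi> \<le> L"
  shows "Re (\<phi> 0) - Re (\<phi> z) \<le> 4 * L * (1/2)^j + 4 * L * M z / w j"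
proof -
  define h where "h x = Re (\<phi> 0) - Re (\<phi> x)" for x
  have ch: "continuous_on UNIV h" unfolding h_def[abs_def] by (intro continuous_intros \<phi>)
  have h: "0 \<le> h x" "h x \<le> 2 * L" for x
    using pos_def_Re_le[OF \<phi>(1), of x] pos_def_Re_ge[OF \<phi>(1), of x] b(1) by (auto simp: h_def)
  define A where "A = mean (\<lambda>x. bump (R j) x * h x)"
  have cA: "continuous_on UNIV (\<lambda>x. bump (R j) x * h x)" by (intro continuous_intros continuous_on_bump ch)
  have cz: "continuous_on UNIV (\<lambda>x. h (x + z))" by (intro continuous_on_compose2[OF ch] continuous_intros) auto
  have cbz: "continuous_on UNIV (\<lambda>x. bump (R j) (x - z))" by (intro continuous_on_compose2[OF continuous_on_bump] continuous_intros) auto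
  have cB: "continuous_on UNIV (\<lambda>x. bump (R j) x * h (x + z))" by (intro continuous_intros continuous_on_bump cz)
  have cC: "continuous_on UNIV (\<lambda>x. bump (R j) (x - z) * h x)" by (intro continuous_intros cbz ch)
  have "h z * w j = mean (\<lambda>x. h z * bump (R j) x)" by (simp add: mean_cmult continuous_on_bump w_def)
  also have "\<dots> \<le> mean (\<lambda>x. 2 * (bump (R j) x * h (x + z)) + 2 * (bump (R j) x * h x))"
  proof (rule mean_mono)
    fix x
    have "h z \<le> 2 * h (x + z) + 2 * h x" unfolding h_def by (rule pos_def_triangle[OF \<phi>(1)])
    then have "bump (R j) x * h z \<le> bump (R j) x * (2 * h (x + z) + 2 * h x)" by (rule mult_left_mono[OF _ bump_nonneg])
    then show "h z * bump (R j) x \<le> 2 * (bump (R j) x * h (x + z)) + 2 * (bump (R j) x * h x)" by (simp add: algebra_simps)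
  qed (intro continuous_intros continuous_on_bump cB cA)+
  also have "\<dots> = 2 * mean (\<lambda>x. bump (R j) x * h (x + z)) + 2 * A"
    unfolding A_def by (subst mean_add) (auto intro!: continuous_intros cA cB simp: mean_cmult cA cB)
  also have "mean (\<lambda>x. bump (R j) x * h (x + z)) = mean (\<lambda>x. bump (R j) (x - z) * h x)"
    using mean_translate[OF cC, of z] by simp
  also have "\<dots> \<le> A + 2 * L * M z"
  proof -
    have "\<bar>mean (\<lambda>x. bump (R j) (x - z) * h x) - A\<bar> \<le> 2 * L * M z" unfolding A_def
    proof (rule mean_abs_diff_le[OF cC cA])
      fix x
      have "\<bar>bump (R j) (x - z) * h x - bump (R j) x * h x\<bar> = \<bar>bump (R j) (x + - z) - bump (R j) x\<bar> * h x"
        using h(1)[of x] by (simp add: left_diff_distrib[symmetric] abs_mult)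
      also have "\<dots> \<le> M (- z) * (2 * L)" by (intro mult_mono bump_lipschitz h) (auto simp: h)
      finally show "\<bar>bump (R j) (x - z) * h x - bump (R j) x * h x\<bar> \<le> 2 * L * M z" by (simp add: mult.commute)
    qed
    then show ?thesis by simp
  qed
  finally have "h z * w j \<le> 4 * A + 4 * L * M z" by simp
  moreover have "A = pen j \<phi> * w j / 2^j" using w_pos[of j] by (simp add: pen_def A_def h_def)
  ultimately have "h z * w j \<le> 4 * (pen j \<phi> * w j / 2^j) + 4 * L * M z" by simp
  then have "h z \<le> 4 * pen j \<phi> / 2^j + 4 * L * M z / w j" using w_pos[of j] by (simp add: field_simps)
  also have "\<dots> \<le> 4 * L / 2^j + 4 * L * M z / w j" using b(2) by (simp add: divide_right_mono)
  finally show ?thesis by (simp add: h_def power_one_over)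
qed

text \<open>An auxiliary compact set. Its conditions survive pointwise limits and force
  equicontinuity, so that the penalties are continuous on it and \<open>cap\<close> is closed in
  it.\<close>

definition C0 :: "('g \<Rightarrow> complex) set"
  where "C0 = {\<phi>. pos_def \<phi> \<and> Re (\<phi> 0) \<le> L \<and> (\<forall>j z. Re (\<phi> 0) - Re (\<phi> z) \<le> 4 * L * (1/2)^j + 4 * L * M z / w j)}"

definition cap :: "('g \<Rightarrow> complex) set"
  where "cap = {\<phi>. pos_def \<phi> \<and> continuous_on UNIV \<phi> \<and> (\<forall>J. Re (\<phi> 0) + (\<Sum>j<J. pen j \<phi>) \<le> L)}"

lemma C0_norm_le: "\<phi> \<in> C0 \<Longrightarrow> norm (\<phi> x) \<le> L"
  using pos_def_bound[of \<phi> x] by (auto simp: C0_def)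

lemma C0_modulus:
  assumes "e > 0"
  shows "\<exists>r>0. \<forall>\<phi>\<in>C0. \<forall>x y. M (x - y) < r \<longrightarrow> norm (\<phi> x - \<phi> y) \<le> e"
proof -
  \<comment> \<open>Chosen so that \<open>pos_def_diff\<close> gives the bound 2 * L * (2 * a) =
    e^2.\<close>
  define a where "a = e\<^sup>2 / (4 * L)"
  have a: "a > 0" using assms L_pos by (simp add: a_def)
  have "(\<lambda>j. 4 * L * (1/2::real)^j) \<longlonglongrightarrow> 4 * L * 0" by (intro tendsto_intros LIMSEQ_realpow_zero) auto
  then have "\<forall>\<^sub>F j in sequentially. 4 * L * (1/2)^j < a" using a by (intro order_tendstoD(2)) auto
  then obtain j where j: "4 * L * (1/2)^j < a" by (auto simp: eventually_sequentially)
  define r where "r = a * w j / (4 * L)"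
  have r: "r > 0" using a w_pos[of j] L_pos by (simp add: r_def)
  have "norm (\<phi> x - \<phi> y) \<le> e" if \<phi>: "\<phi> \<in> C0" and xy: "M (x - y) < r" for \<phi> x y
  proof -
    have "Re (\<phi> 0) - Re (\<phi> (x - y)) \<le> 4 * L * (1/2)^j + 4 * L * M (x - y) / w j" using \<phi> by (auto simp: C0_def)
    moreover have "4 * L * M (x - y) / w j \<le> a" using xy w_pos[of j] L_pos by (simp add: r_def field_simps)
    ultimately have 1: "Re (\<phi> 0) - Re (\<phi> (x - y)) \<le> 2 * a" using j by linarith
    have p: "pos_def \<phi>" "0 \<le> Re (\<phi> 0)" "Re (\<phi> 0) \<le> L" using \<phi> pos_def_0(2) by (auto simp: C0_def)
    have "(norm (\<phi> x - \<phi> y))\<^sup>2 \<le> 2 * Re (\<phi> 0) * (Re (\<phi> 0) - Re (\<phi> (x - y)))" by (rule pos_def_diff[OF p(1)])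
    also have "\<dots> \<le> 2 * L * (2 * a)" using p 1 pos_def_Re_le[OF p(1), of "x - y"] L_pos by (intro mult_mono) auto
    also have "\<dots> = e\<^sup>2" using L_pos by (simp add: a_def)
    finally show ?thesis by (rule power2_le_imp_le) (use assms in simp)
  qed
  then show ?thesis using r by blast
qed

lemma C0_continuous: "\<phi> \<in> C0 \<Longrightarrow> continuous_on UNIV \<phi>"
  unfolding continuous_on_sequentially
proof safe
  fix u :: "nat \<Rightarrow> 'g" and l assume \<phi>: "\<phi> \<in> C0" and u: "u \<longlonglongrightarrow> l"
  show "(\<phi> \<circ> u) \<longlonglongrightarrow> \<phi> l"
  proof (rule tendstoI)
    fix e :: real assume "e > 0"
    then obtain r where r: "r > 0" "\<And>x y. M (x - y) < r \<Longrightarrow> norm (\<phi> x - \<phi> y) \<le> e / 2" using C0_modulus[of "e/2"] \<phi> by auto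
    have "(\<lambda>n. M (u n - l)) \<longlonglongrightarrow> 0" using u by (simp add: tendsto_diff_iff)
    then have "\<forall>\<^sub>F n in sequentially. M (u n - l) < r" using r(1) by (rule order_tendstoD(2))
    then show "\<forall>\<^sub>F n in sequentially. dist ((\<phi> \<circ> u) n) (\<phi> l) < e"
    proof eventually_elim
      case (elim n) then show ?case using r(2)[OF elim] \<open>e > 0\<close> by (simp add: dist_norm)
    qed
  qed
qed

lemma cap_subset: "cap \<subseteq> C0"
proof
  fix \<phi> assume \<phi>: "\<phi> \<in> cap"
  then have p: "pos_def \<phi>" "continuous_on UNIV \<phi>" and s: "\<And>J. Re (\<phi> 0) + (\<Sum>j<J. pen j \<phi>) \<le> L" by (auto simp: cap_def)
  have r0: "Re (\<phi> 0) \<le> L" using s[of 0] by simp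
  have "pen j \<phi> \<le> L" for j
  proof -
    have "pen j \<phi> \<le> (\<Sum>j<Suc j. pen j \<phi>)" using pen_nonneg[OF p] by (simp add: sum_nonneg)
    then show ?thesis using s[of "Suc j"] pos_def_0(2)[OF p(1)] by simp
  qed
  then show "\<phi> \<in> C0" using equicontinuity[OF p r0] p r0 by (auto simp: C0_def)
qed

lemma C0_net:
  assumes "e > 0"
  obtains Y where "finite Y" "\<And>\<phi> \<psi> x. \<phi> \<in> C0 \<Longrightarrow> \<psi> \<in> C0 \<Longrightarrow> (\<forall>y\<in>Y. norm (\<psi> y - \<phi> y) \<le> e) \<Longrightarrow> norm (\<psi> x - \<phi> x) \<le> 3 * e"
proof -
  obtain r where r: "r > 0" "\<And>\<phi> x y. \<phi> \<in> C0 \<Longrightarrow> M (x - y) < r \<Longrightarrow> norm (\<phi> x - \<phi> y) \<le> e" using C0_modulus[OF assms] by blast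
  obtain ys where ys: "\<And>x. \<exists>y\<in>set ys. M (x - y) < r" using finite_net[OF r(1)] by blast
  have "norm (\<psi> x - \<phi> x) \<le> 3 * e" if p: "\<phi> \<in> C0" "\<psi> \<in> C0" "\<forall>y\<in>set ys. norm (\<psi> y - \<phi> y) \<le> e" for \<phi> \<psi> x
  proof -
    obtain y where y: "y \<in> set ys" "M (x - y) < r" using ys by blast
    have e: "\<psi> x - \<phi> x = (\<psi> x - \<psi> y) + (\<psi> y - \<phi> y) - (\<phi> x - \<phi> y)" by simp
    have "norm (\<psi> x - \<phi> x) \<le> norm (\<psi> x - \<psi> y) + norm (\<psi> y - \<phi> y) + norm (\<phi> x - \<phi> y)"
      unfolding e using norm_triangle_ineq4[of "(\<psi> x - \<psi> y) + (\<psi> y - \<phi> y)" "\<phi> x - \<phi> y"] norm_triangle_ineq[of "\<psi> x - \<psi> y" "\<psi> y - \<phi> y"]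
      by linarith
    then show ?thesis using r(2)[OF p(1) y(2)] r(2)[OF p(2) y(2)] bspec[OF p(3) y(1)] by linarith
  qed
  then show ?thesis using that[of "set ys"] by blast
qed

text \<open>On an equicontinuous set, closeness at a finite net is uniform closeness, so a
  functional that is Lipschitz for the uniform norm is continuous for pointwise convergence.\<close>

lemma lipschitz_continuous_on_C0:
  assumes "K > 0"
    and F: "\<And>\<phi> \<psi> e. \<phi> \<in> C0 \<Longrightarrow> \<psi> \<in> C0 \<Longrightarrow> (\<And>x. norm (\<psi> x - \<phi> x) \<le> e) \<Longrightarrow> \<bar>F \<psi> - F \<phi>\<bar> \<le> K * e"
  shows "continuous_on C0 F"
  unfolding continuous_on_def
proof
  fix \<phi> assume \<phi>: "\<phi> \<in> C0"
  show "(F \<longlongrightarrow> F \<phi>) (at \<phi> within C0)"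
  proof (rule tendstoI)
    fix e :: real assume e: "e > 0"
    define e' where "e' = e / (6 * K)"
    have e': "e' > 0" using e assms(1) by (simp add: e'_def)
    obtain Y where Y: "finite Y" "\<And>\<phi> \<psi> x. \<phi> \<in> C0 \<Longrightarrow> \<psi> \<in> C0 \<Longrightarrow> (\<forall>y\<in>Y. norm (\<psi> y - \<phi> y) \<le> e') \<Longrightarrow> norm (\<psi> x - \<phi> x) \<le> 3 * e'"
      using C0_net[OF e'] by blast
    have "\<forall>\<^sub>F \<psi> in at \<phi> within C0. \<forall>y\<in>Y. dist (\<psi> y) (\<phi> y) < e'"
    proof (intro eventually_ball_finite Y(1) ballI)
      fix y
      have "continuous_on C0 (\<lambda>\<psi>. \<psi> y)" by (rule continuous_on_subset[OF continuous_on_product_coordinates]) simp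
      then have "((\<lambda>\<psi>. \<psi> y) \<longlongrightarrow> \<phi> y) (at \<phi> within C0)" using \<phi> by (simp add: continuous_on_def)
      then show "\<forall>\<^sub>F \<psi> in at \<phi> within C0. dist (\<psi> y) (\<phi> y) < e'" using e' by (rule tendstoD)
    qed
    moreover have "\<forall>\<^sub>F \<psi> in at \<phi> within C0. \<psi> \<in> C0" by (simp add: eventually_at_filter)
    ultimately show "\<forall>\<^sub>F \<psi> in at \<phi> within C0. dist (F \<psi>) (F \<phi>) < e"
    proof eventually_elim
      case (elim \<psi>)
      have "norm (\<psi> x - \<phi> x) \<le> 3 * e'" for x using elim by (intro Y(2)[OF \<phi>]) (auto simp: dist_norm less_imp_le)
      then have "\<bar>F \<psi> - F \<phi>\<bar> \<le> K * (3 * e')" by (rule F[OF \<phi> elim(2)])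
      also have "\<dots> < e" using assms(1) e by (simp add: e'_def)
      finally show ?case by (simp add: dist_real_def)
    qed
  qed
qed

lemma continuous_on_pen: "continuous_on C0 (pen j)"
proof (rule lipschitz_continuous_on_C0)
  show "2^j / w j * (2 * R j) > 0" using w_pos[of j] R_pos[of j] by simp
  fix \<phi> \<psi> e assume h: "\<phi> \<in> C0" "\<psi> \<in> C0" "\<And>x. norm (\<psi> x - \<phi> x) \<le> e"
  have "\<bar>mean (\<lambda>x. bump (R j) x * (Re (\<psi> 0) - Re (\<psi> x))) - mean (\<lambda>x. bump (R j) x * (Re (\<phi> 0) - Re (\<phi> x)))\<bar> \<le> R j * (2 * e)"
  proof (rule mean_abs_diff_le)
    fix x
    have b: "\<bar>Re (\<psi> y) - Re (\<phi> y)\<bar> \<le> e" for y using abs_Re_le_cmod[of "\<psi> y - \<phi> y"] h(3)[of y] by simp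
    have "\<bar>bump (R j) x * (Re (\<psi> 0) - Re (\<psi> x)) - bump (R j) x * (Re (\<phi> 0) - Re (\<phi> x))\<bar>
      = bump (R j) x * \<bar>(Re (\<psi> 0) - Re (\<psi> x)) - (Re (\<phi> 0) - Re (\<phi> x))\<bar>"
      using bump_nonneg[of "R j" x] by (simp add: right_diff_distrib[symmetric] abs_mult)
    also have "\<dots> \<le> R j * (2 * e)"
      using b[of 0] b[of x] R_pos[of j] by (intro mult_mono bump_le) (auto simp: less_imp_le)
    finally show "\<bar>bump (R j) x * (Re (\<psi> 0) - Re (\<psi> x)) - bump (R j) x * (Re (\<phi> 0) - Re (\<phi> x))\<bar> \<le> R j * (2 * e)" .
  qed (use h C0_continuous cont_pen in auto)
  then have "2^j / w j * \<bar>mean (\<lambda>x. bump (R j) x * (Re (\<psi> 0) - Re (\<psi> x))) - mean (\<lambda>x. bump (R j) x * (Re (\<phi> 0) - Re (\<phi> x)))\<bar>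
     \<le> 2^j / w j * (R j * (2 * e))" using w_pos[of j] by (intro mult_left_mono) auto
  then show "\<bar>pen j \<psi> - pen j \<phi>\<bar> \<le> 2^j / w j * (2 * R j) * e"
    unfolding pen_def right_diff_distrib[symmetric] abs_mult using w_pos[of j] by (simp add: mult_ac)
qed

lemma continuous_on_eval: "continuous_on A (\<lambda>\<phi>::'g \<Rightarrow> complex. \<phi> x)"
  by (rule continuous_on_subset[OF continuous_on_product_coordinates]) simp

lemma closed_pos_def: "closed {\<phi>::'g \<Rightarrow> complex. pos_def \<phi>}"
proof -
  have "continuous_on UNIV (\<lambda>\<phi>. \<Sum>p\<leftarrow>ps. \<Sum>q\<leftarrow>qs. fst p * cnj (fst q) * \<phi> (snd p - snd q))"
    for ps qs :: "(complex \<times> 'g) list"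
  proof (induction ps)
    case (Cons p ps)
    have "continuous_on UNIV (\<lambda>\<phi>. \<Sum>q\<leftarrow>qs. fst p * cnj (fst q) * \<phi> (snd p - snd q))"
    proof (induction qs)
      case (Cons q qs)
      then show ?case by (auto intro!: continuous_intros continuous_on_eval)
    qed simp
    then show ?case using Cons by (auto intro!: continuous_intros)
  qed simp
  then have c: "continuous_on UNIV (\<lambda>\<phi>. herm_form \<phi> ps)" for ps :: "(complex \<times> 'g) list" unfolding herm_form_def .
  show ?thesis unfolding pos_def_def
    by (intro closed_Collect_conj closed_Collect_all closed_Collect_eq closed_Collect_le continuous_intros c continuous_on_eval)
qed

lemma compact_C0: "compact C0"
proof -
  have "compact {\<phi>::'g \<Rightarrow> complex. \<forall>x. \<phi> x \<in> cball 0 L}" by (rule compact_pointwise_product) simp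
  moreover have "closed {\<phi>::'g \<Rightarrow> complex. Re (\<phi> 0) \<le> L \<and> (\<forall>j z. Re (\<phi> 0) - Re (\<phi> z) \<le> 4 * L * (1/2)^j + 4 * L * M z / w j)}"
    by (intro closed_Collect_conj closed_Collect_all closed_Collect_le continuous_intros continuous_on_eval)
  ultimately have "compact ({\<phi>. \<forall>x. \<phi> x \<in> cball 0 L} \<inter> ({\<phi>. pos_def \<phi>} \<inter> {\<phi>::'g \<Rightarrow> complex. Re (\<phi> 0) \<le> L \<and> (\<forall>j z. Re (\<phi> 0) - Re (\<phi> z) \<le> 4 * L * (1/2)^j + 4 * L * M z / w j)}))"
    by (intro compact_Int_closed closed_Int closed_pos_def)
  also have "({\<phi>. \<forall>x. \<phi> x \<in> cball 0 L} \<inter> ({\<phi>. pos_def \<phi>} \<inter> {\<phi>::'g \<Rightarrow> complex. Re (\<phi> 0) \<le> L \<and> (\<forall>j z. Re (\<phi> 0) - Re (\<phi> z) \<le> 4 * L * (1/2)^j + 4 * L * M z / w j)})) = C0"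
    using C0_norm_le by (auto simp: C0_def)
  finally show ?thesis .
qed

lemma compact_cap: "compact cap"
proof -
  have "closedin (top_of_set C0) (C0 \<inter> (\<lambda>\<phi>. Re (\<phi> 0) + (\<Sum>j<J. pen j \<phi>)) -` {..L})" for J
    by (rule continuous_closedin_preimage)
      (auto intro!: continuous_intros continuous_on_pen continuous_on_eval)
  then have "closedin (top_of_set C0) (\<Inter>J. C0 \<inter> (\<lambda>\<phi>. Re (\<phi> 0) + (\<Sum>j<J. pen j \<phi>)) -` {..L})"
    by (intro closedin_INT) auto
  moreover have "(\<Inter>J. C0 \<inter> (\<lambda>\<phi>. Re (\<phi> 0) + (\<Sum>j<J. pen j \<phi>)) -` {..L}) = cap"
    using cap_subset C0_continuous by (auto simp: cap_def C0_def)
  ultimately show ?thesis using compact_C0 closedin_compact by metis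
qed

definition energy :: "('g \<Rightarrow> complex) \<Rightarrow> real" where "energy \<phi> = mean (\<lambda>x. (norm (\<phi> x))\<^sup>2)"

lemma continuous_on_energy: "continuous_on C0 energy"
proof (rule lipschitz_continuous_on_C0)
  show "2 * L > 0" using L_pos by simp
  fix \<phi> \<psi> e assume h: "\<phi> \<in> C0" "\<psi> \<in> C0" "\<And>x. norm (\<psi> x - \<phi> x) \<le> e"
  show "\<bar>energy \<psi> - energy \<phi>\<bar> \<le> 2 * L * e" unfolding energy_def
  proof (rule mean_abs_diff_le)
    fix x
    have "(norm (\<psi> x))\<^sup>2 - (norm (\<phi> x))\<^sup>2 = (norm (\<psi> x) + norm (\<phi> x)) * (norm (\<psi> x) - norm (\<phi> x))"
      by (simp add: power2_eq_square algebra_simps)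
    then have "\<bar>(norm (\<psi> x))\<^sup>2 - (norm (\<phi> x))\<^sup>2\<bar> = (norm (\<psi> x) + norm (\<phi> x)) * \<bar>norm (\<psi> x) - norm (\<phi> x)\<bar>"
      by (simp add: abs_mult)
    also have "\<dots> \<le> (2 * L) * e"
      using C0_norm_le[OF h(1), of x] C0_norm_le[OF h(2), of x] norm_triangle_ineq3[of "\<psi> x" "\<phi> x"] h(3)[of x] L_pos
      by (intro mult_mono) auto
    finally show "\<bar>(norm (\<psi> x))\<^sup>2 - (norm (\<phi> x))\<^sup>2\<bar> \<le> 2 * L * e" .
  qed (intro continuous_intros C0_continuous h)+
qed

lemma energy_strict_convex:
  assumes c: "continuous_on UNIV \<phi>" "continuous_on UNIV \<psi>" and "\<phi> \<noteq> \<psi>" and a: "0 < a" "a < 1"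
  shows "energy (\<lambda>x. complex_of_real a * \<phi> x + complex_of_real (1 - a) * \<psi> x) < a * energy \<phi> + (1 - a) * energy \<psi>"
proof -
  obtain y where y: "\<phi> y \<noteq> \<psi> y" using \<open>\<phi> \<noteq> \<psi>\<close> by auto
  define D where "D = mean (\<lambda>x. (norm (\<phi> x - \<psi> x))\<^sup>2)"
  have "D > 0" unfolding D_def by (rule mean_pos[of _ y]) (use y in \<open>auto intro!: continuous_intros c\<close>)
  have id: "(norm (complex_of_real a * \<phi> x + complex_of_real (1 - a) * \<psi> x))\<^sup>2 + a * (1 - a) * (norm (\<phi> x - \<psi> x))\<^sup>2
     = a * (norm (\<phi> x))\<^sup>2 + (1 - a) * (norm (\<psi> x))\<^sup>2" for x
    unfolding cmod_power2 by (simp add: power2_eq_square algebra_simps)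
  have "energy (\<lambda>x. complex_of_real a * \<phi> x + complex_of_real (1 - a) * \<psi> x) + a * (1 - a) * D
     = mean (\<lambda>x. (norm (complex_of_real a * \<phi> x + complex_of_real (1 - a) * \<psi> x))\<^sup>2 + a * (1 - a) * (norm (\<phi> x - \<psi> x))\<^sup>2)"
    unfolding energy_def D_def mean_cmult[OF continuous_on_power[OF continuous_on_norm[OF continuous_on_diff[OF c]]], symmetric]
    by (rule mean_add[symmetric]) (intro continuous_intros c)+
  also have "\<dots> = a * energy \<phi> + (1 - a) * energy \<psi>"
    unfolding id energy_def mean_cmult[OF continuous_on_power[OF continuous_on_norm[OF c(1)]], symmetric]
      mean_cmult[OF continuous_on_power[OF continuous_on_norm[OF c(2)]], symmetric]
    by (rule mean_add) (intro continuous_intros c)+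
  finally show ?thesis using mult_pos_pos[OF mult_pos_pos[OF a(1), of "1 - a"] \<open>D > 0\<close>] a(2) by linarith
qed

text \<open>In the functional F the linear term makes the maximiser distinguish x0 from 0, and the
  energy term makes it extreme. The function k only certifies that large values of F occur.\<close>

lemma character_exists:
  assumes k: "k \<in> cap" and x0: "Re (k x0) < Re (k 0)"
  obtains \<xi> where "character \<xi>" "\<xi> x0 \<noteq> 1"
proof -
  define \<kappa> where "\<kappa> = Re (k 0) - Re (k x0)"
  \<comment> \<open>The energy is at most L^2 on the cap, so with this weight it contributes at most
    half of the gap \<kappa>, and the maximiser keeps a gap of at least \<kappa> / 2.\<close>
  define \<delta> where "\<delta> = \<kappa> / (2 * L\<^sup>2)"
  have \<delta>: "\<delta> > 0" using x0 L_pos by (simp add: \<delta>_def \<kappa>_def)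
  define F where "F \<phi> = Re (\<phi> 0) - Re (\<phi> x0) + \<delta> * energy \<phi>" for \<phi>
  have "continuous_on cap F" unfolding F_def
    by (intro continuous_intros continuous_on_eval continuous_on_subset[OF continuous_on_energy cap_subset])
  then obtain \<phi> where \<phi>: "\<phi> \<in> cap" and max: "\<And>\<psi>. \<psi> \<in> cap \<Longrightarrow> F \<psi> \<le> F \<phi>"
    using continuous_attains_sup[OF compact_cap] k by blast
  have p: "pos_def \<phi>" "continuous_on UNIV \<phi>" and s: "\<And>J. Re (\<phi> 0) + (\<Sum>j<J. pen j \<phi>) \<le> L" using \<phi> by (auto simp: cap_def)
  have "continuous_on UNIV k" using k by (simp add: cap_def)
  then have "energy k \<ge> 0" unfolding energy_def by (intro mean_nonneg continuous_intros) auto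
  then have "\<kappa> \<le> F k" using \<delta> by (simp add: F_def \<kappa>_def)
  moreover have "energy \<phi> \<le> L\<^sup>2"
  proof -
    have "energy \<phi> \<le> mean (\<lambda>_::'g. L\<^sup>2)" unfolding energy_def
      by (rule mean_mono) (use C0_norm_le cap_subset \<phi> in \<open>auto intro!: continuous_intros p power_mono\<close>)
    then show ?thesis by (simp add: mean_const)
  qed
  then have "\<delta> * energy \<phi> \<le> \<delta> * L\<^sup>2" using \<delta> by simp
  moreover have "\<delta> * L\<^sup>2 = \<kappa> / 2" using L_pos by (simp add: \<delta>_def)
  moreover have "F k \<le> F \<phi>" by (rule max[OF k])
  ultimately have "\<kappa> / 2 \<le> Re (\<phi> 0) - Re (\<phi> x0)" unfolding F_def by linarith
  moreover have "\<kappa> > 0" using x0 by (simp add: \<kappa>_def)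
  ultimately have lx: "Re (\<phi> x0) < Re (\<phi> 0)" by simp
  have pos: "Re (\<phi> 0) > 0" using pos_def_0(2)[OF p(1)] lx pos_def_Re_ge[OF p(1), of x0] by linarith
  have summ: "summable (\<lambda>j. pen j \<phi>)"
  proof (rule summableI_nonneg_bounded)
    show "0 \<le> pen j \<phi>" for j by (rule pen_nonneg[OF p])
    show "(\<Sum>i<n. pen i \<phi>) \<le> L" for n using s[of n] pos by linarith
  qed
  define P where "P \<psi> = Re (\<psi> 0) + (\<Sum>j. pen j \<psi>)" for \<psi>
  have in_cap: "\<psi> \<in> cap" if \<psi>: "pos_def \<psi>" "continuous_on UNIV \<psi>" "summable (\<lambda>j. pen j \<psi>)" "P \<psi> \<le> L" for \<psi>
  proof -
    have "(\<Sum>j<J. pen j \<psi>) \<le> (\<Sum>j. pen j \<psi>)" for J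
      by (rule sum_le_suminf[OF \<psi>(3)]) (use pen_nonneg[OF \<psi>(1,2)] in auto)
    then have "Re (\<psi> 0) + (\<Sum>j<J. pen j \<psi>) \<le> L" for J using \<psi>(4) unfolding P_def by (meson add_left_mono order_trans)
    then show ?thesis using \<psi> by (auto simp: cap_def)
  qed
  have P\<phi>: "P \<phi> > 0" "P \<phi> \<le> L"
  proof -
    have "(\<Sum>j. pen j \<phi>) \<ge> 0" by (rule suminf_nonneg[OF summ pen_nonneg[OF p]])
    then show "P \<phi> > 0" using pos by (simp add: P_def)
    have "(\<Sum>j. pen j \<phi>) \<le> L - Re (\<phi> 0)"
      by (rule suminf_le_const[OF summ]) (use s in \<open>simp add: algebra_simps\<close>)
    then show "P \<phi> \<le> L" by (simp add: P_def)
  qed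
  have shift: "\<exists>t::real. \<forall>x. shift_avg c y \<phi> x = t * \<phi> x" if c: "norm c = 1" for c y
  proof -
    define u v where "u = shift_avg c y \<phi>" and "v = shift_avg (- c) y \<phi>"
    have pd: "pos_def u" "pos_def v" unfolding u_def v_def by (auto intro!: pos_def_shift_avg p c)
    have tr: "continuous_on UNIV (\<lambda>x. \<phi> (x + a))" for a by (intro continuous_on_compose2[OF p(2)] continuous_intros) auto
    have co: "continuous_on UNIV (shift_avg c y \<phi>)" for c
      unfolding shift_avg_def[abs_def] using tr[of "- y"] by (intro continuous_intros p tr) simp
    have cuv: "continuous_on UNIV u" "continuous_on UNIV v" unfolding u_def v_def by (rule co)+
    have uv: "u x + v x = complex_of_real 4 * \<phi> x" for x using shift_avg_sum[of c y \<phi> x] by (simp add: u_def v_def)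
    have pen_uv: "pen j u + pen j v = 4 * pen j \<phi>" for j
      using pen_add[OF cuv, of j] pen_cmult[OF p(2), of j 4] by (simp add: uv)
    have nn: "0 \<le> pen j u" "0 \<le> pen j v" for j using pen_nonneg pd cuv by auto
    have su: "summable (\<lambda>j. pen j u)" "summable (\<lambda>j. pen j v)"
      by (rule summable_comparison_test'[OF summable_mult[OF summ, of 4]], use nn pen_uv in \<open>smt (verit) real_norm_def\<close>)+
    have PP: "P u + P v = 4 * P \<phi>"
    proof -
      have "(\<Sum>j. pen j u) + (\<Sum>j. pen j v) = 4 * (\<Sum>j. pen j \<phi>)"
        unfolding suminf_add[OF su] pen_uv using suminf_mult[OF summ, of 4] by simp
      moreover have "Re (u 0) + Re (v 0) = 4 * Re (\<phi> 0)" using arg_cong[OF uv[of 0], of Re] by simp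
      ultimately show ?thesis unfolding P_def by simp
    qed
    have Pge: "Re (\<psi> 0) \<le> P \<psi>" if "summable (\<lambda>j. pen j \<psi>)" "\<And>j. 0 \<le> pen j \<psi>" for \<psi>
      using suminf_nonneg[OF that] by (simp add: P_def)
    have Pu: "P u \<ge> 0" "P v \<ge> 0" using Pge[OF su(1) nn(1)] Pge[OF su(2) nn(2)] pos_def_0(2) pd by (auto intro: order_trans)
    consider "P u = 0" | "P v = 0" | "P u > 0" "P v > 0" using Pu by linarith
    then show ?thesis
    proof cases
      case 1
      then have "Re (u 0) = 0" using Pge[OF su(1) nn(1)] pos_def_0(2)[OF pd(1)] by simp
      then have "u x = 0" for x by (rule pos_def_zero[OF pd(1)])
      then show ?thesis unfolding u_def by (intro exI[of _ 0]) auto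
    next
      case 2
      then have "Re (v 0) = 0" using Pge[OF su(2) nn(2)] pos_def_0(2)[OF pd(2)] by simp
      then have "v x = 0" for x by (rule pos_def_zero[OF pd(2)])
      then have "u x = complex_of_real 4 * \<phi> x" for x using uv[of x] by simp
      then show ?thesis unfolding u_def by blast
    next
      case 3
      \<comment> \<open>P is additive, hence P u + P v = 4 * P \<phi>. Rescaling u and v to the
        level P \<phi> keeps them in the cap and writes \<phi> as their convex combination with
        weights a and 1 - a.\<close>
      define a where "a = P u / (4 * P \<phi>)"
      have a: "0 < a" "a < 1" "1 - a = P v / (4 * P \<phi>)" using 3 P\<phi> PP by (auto simp: a_def field_simps)
      define u' v' where "u' = (\<lambda>x. complex_of_real (P \<phi> / P u) * u x)" and "v' = (\<lambda>x. complex_of_real (P \<phi> / P v) * v x)"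
      have scale: "(\<lambda>x. complex_of_real (P \<phi> / P \<psi>) * \<psi> x) \<in> cap"
        if \<psi>: "pos_def \<psi>" "continuous_on UNIV \<psi>" "summable (\<lambda>j. pen j \<psi>)" "P \<psi> > 0" for \<psi>
      proof (rule in_cap)
        show "pos_def (\<lambda>x. complex_of_real (P \<phi> / P \<psi>) * \<psi> x)" using \<psi> P\<phi> by (intro pos_def_cmult) auto
        show "continuous_on UNIV (\<lambda>x. complex_of_real (P \<phi> / P \<psi>) * \<psi> x)" by (intro continuous_intros \<psi>)
        show "summable (\<lambda>j. pen j (\<lambda>x. complex_of_real (P \<phi> / P \<psi>) * \<psi> x))"
          unfolding pen_cmult[OF \<psi>(2)] by (intro summable_mult \<psi>)
        have "P (\<lambda>x. complex_of_real (P \<phi> / P \<psi>) * \<psi> x) = P \<phi> / P \<psi> * P \<psi>"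
          unfolding P_def[of "\<lambda>x. complex_of_real (P \<phi> / P \<psi>) * \<psi> x"] pen_cmult[OF \<psi>(2)] suminf_mult[OF \<psi>(3)]
          by (simp add: P_def[of \<psi>] distrib_left)
        then show "P (\<lambda>x. complex_of_real (P \<phi> / P \<psi>) * \<psi> x) \<le> L" using \<psi>(4) P\<phi>(2) by simp
      qed
      have u'c: "u' \<in> cap" unfolding u'_def by (rule scale[OF pd(1) cuv(1) su(1) 3(1)])
      have v'c: "v' \<in> cap" unfolding v'_def by (rule scale[OF pd(2) cuv(2) su(2) 3(2)])
      have comb: "\<phi> x = complex_of_real a * u' x + complex_of_real (1 - a) * v' x" for x
      proof -
        have "complex_of_real a * u' x + complex_of_real (1 - a) * v' x = complex_of_real (a * (P \<phi> / P u)) * u x + complex_of_real ((1 - a) * (P \<phi> / P v)) * v x"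
          by (simp add: u'_def v'_def mult.assoc)
        also have "a * (P \<phi> / P u) = 1 / 4" using 3 P\<phi> by (simp add: a_def)
        also have "(1 - a) * (P \<phi> / P v) = 1 / 4" unfolding a(3) using 3 P\<phi> by simp
        also have "complex_of_real (1 / 4) * u x + complex_of_real (1 / 4) * v x = complex_of_real (1 / 4) * (u x + v x)" by (simp add: distrib_left)
        also have "\<dots> = \<phi> x" unfolding uv by simp
        finally show ?thesis by simp
      qed
      have "u' = v'"
      proof (rule ccontr)
        assume "u' \<noteq> v'"
        have "continuous_on UNIV u'" "continuous_on UNIV v'" using u'c v'c by (auto simp: cap_def)
        from energy_strict_convex[OF this \<open>u' \<noteq> v'\<close> a(1,2)] have "energy \<phi> < a * energy u' + (1 - a) * energy v'"
          unfolding comb[symmetric] .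
        then have "\<delta> * energy \<phi> < \<delta> * (a * energy u' + (1 - a) * energy v')" using \<delta> by simp
        moreover have "Re (\<phi> 0) - Re (\<phi> x0) = a * (Re (u' 0) - Re (u' x0)) + (1 - a) * (Re (v' 0) - Re (v' x0))"
          unfolding comb[of 0] comb[of x0] by (simp add: algebra_simps)
        ultimately have "F \<phi> < a * F u' + (1 - a) * F v'" unfolding F_def by (simp add: algebra_simps)
        also have "\<dots> \<le> a * F \<phi> + (1 - a) * F \<phi>" using max[OF u'c] max[OF v'c] a by (intro add_mono mult_left_mono) auto
        also have "\<dots> = F \<phi>" by (simp add: algebra_simps)
        finally show False by simp
      qed
      then have "\<phi> x = u' x" for x using comb[of x] by (simp add: algebra_simps)
      then have "u x = complex_of_real (P u / P \<phi>) * \<phi> x" for x unfolding u'_def using 3 P\<phi> by simp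
      then show ?thesis unfolding u_def by blast
    qed
  qed
  have mult: "\<phi> (x + y) * \<phi> 0 = \<phi> x * \<phi> y" for x y by (rule multiplicative_of_shift_avg[OF p(1) pos shift])
  show ?thesis
  proof (rule that)
    show "character (\<lambda>x. \<phi> x / \<phi> 0)" by (rule character_of_multiplicative[OF p(1) pos p(2) mult])
    show "\<phi> x0 / \<phi> 0 \<noteq> 1" using lx by auto
  qed
qed

end

text \<open>The starting function K is the autocorrelation of a bump f of radius B = M x0. Here K 0
  - K x0 is half the mean of (f (x0 + y) - f y)^2, which is positive because f 0 = B while f x0 =
  0.\<close>

theorem (in compact_ab_group) characters_separate:
  fixes x0 :: 'g
  assumes "x0 \<noteq> 0"
  obtains \<xi> where "character \<xi>" "\<xi> x0 \<noteq> 1"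
proof -
  define B where "B = M x0"
  have B: "B > 0" using assms eq_zero_iff[of x0] nonneg[of x0] by (simp add: B_def less_le)
  define f where "f = bump B"
  have cf: "continuous_on UNIV f" unfolding f_def by (rule continuous_on_bump)
  have cfa: "continuous_on UNIV (\<lambda>y. f (a + y))" for a by (intro continuous_on_compose2[OF cf] continuous_intros) auto
  have f: "0 \<le> f y" "f y \<le> B" for y using B by (auto simp: f_def bump_nonneg bump_le)
  define k where "k x = mean (\<lambda>y. f (x + y) * f y)" for x
  have k_shift: "k (a - b) = mean (\<lambda>y. f (a + y) * f (b + y))" for a b
  proof -
    have "continuous_on UNIV (\<lambda>y. f (a - b + y) * f y)" by (intro continuous_intros cfa cf)
    from mean_translate[OF this, of b] show ?thesis by (simp add: k_def algebra_simps)
  qed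
  define K where "K x = complex_of_real (k x)" for x
  have K: "pos_def K" unfolding pos_def_def
  proof (intro conjI allI)
    show "K (- x) = cnj (K x)" for x using k_shift[of 0 x] by (simp add: K_def k_def mult.commute)
    fix ps :: "(complex \<times> 'g) list"
    have hm: "has_mean (\<lambda>y. \<Sum>p\<leftarrow>ps. \<Sum>q\<leftarrow>qs. fst p * cnj (fst q) * complex_of_real (f (snd p + y) * f (snd q + y)))
       (\<Sum>p\<leftarrow>ps. \<Sum>q\<leftarrow>qs. fst p * cnj (fst q) * K (snd p - snd q))" for ps qs :: "(complex \<times> 'g) list"
    proof (induction ps)
      case (Cons p ps)
      have "has_mean (\<lambda>y. \<Sum>q\<leftarrow>qs. fst p * cnj (fst q) * complex_of_real (f (snd p + y) * f (snd q + y)))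
         (\<Sum>q\<leftarrow>qs. fst p * cnj (fst q) * K (snd p - snd q))"
      proof (induction qs)
        case (Cons q qs)
        have "has_mean (\<lambda>y. f (snd p + y) * f (snd q + y)) (k (snd p - snd q))"
          unfolding k_shift by (intro has_mean_real continuous_intros cfa)
        then have "has_mean (\<lambda>y. complex_of_real (f (snd p + y) * f (snd q + y))) (K (snd p - snd q))"
          unfolding K_def by (rule has_mean_bounded_linear[OF bounded_linear_of_real])
        then have "has_mean (\<lambda>y. fst p * cnj (fst q) * complex_of_real (f (snd p + y) * f (snd q + y))) (fst p * cnj (fst q) * K (snd p - snd q))"
          by (rule has_mean_bounded_linear[OF bounded_linear_mult_right])
        from has_mean_add[OF this Cons.IH] show ?case by simp
      qed (simp add: has_mean_const)
      from has_mean_add[OF this Cons.IH] show ?case by simp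
    qed (simp add: has_mean_const)
    have sq: "(\<Sum>p\<leftarrow>ps. \<Sum>q\<leftarrow>ps. fst p * cnj (fst q) * complex_of_real (f (snd p + y) * f (snd q + y))) =
       (\<Sum>p\<leftarrow>ps. fst p * complex_of_real (f (snd p + y))) * cnj (\<Sum>p\<leftarrow>ps. fst p * complex_of_real (f (snd p + y)))" for y
    proof -
      have A: "cnj (\<Sum>q\<leftarrow>qs. fst q * complex_of_real (f (snd q + y))) = (\<Sum>q\<leftarrow>qs. cnj (fst q) * complex_of_real (f (snd q + y)))"
        for qs :: "(complex \<times> 'g) list" by (induction qs) auto
      have B: "(\<Sum>p\<leftarrow>ps. a p * b) = (\<Sum>p\<leftarrow>ps. a p) * b" for a and b :: complex and ps :: "(complex \<times> 'g) list"
        by (induction ps) (simp_all add: distrib_right)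
      show ?thesis unfolding A B[symmetric] sum_list_cmult[symmetric] by (subst sum_list_swap) (simp add: mult_ac)
    qed
    have "has_mean (\<lambda>y. Re (\<Sum>p\<leftarrow>ps. \<Sum>q\<leftarrow>ps. fst p * cnj (fst q) * complex_of_real (f (snd p + y) * f (snd q + y))))
       (Re (herm_form K ps))" unfolding herm_form_def by (rule has_mean_bounded_linear[OF bounded_linear_Re hm])
    moreover have "0 \<le> Re (\<Sum>p\<leftarrow>ps. \<Sum>q\<leftarrow>ps. fst p * cnj (fst q) * complex_of_real (f (snd p + y) * f (snd q + y)))" for y
      unfolding sq complex_norm_square[symmetric] by simp
    ultimately show "0 \<le> Re (herm_form K ps)" by (rule has_mean_nonneg)
  qed
  have kz: "k 0 - k z \<le> B * M z" for z
  proof -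
    have "\<bar>k 0 - k z\<bar> \<le> B * M z" unfolding k_def
    proof (rule mean_abs_diff_le)
      fix y
      have "\<bar>f (0 + y) * f y - f (z + y) * f y\<bar> = \<bar>f (y + z) - f y\<bar> * f y"
        using f(1)[of y] by (simp add: left_diff_distrib[symmetric] abs_mult add.commute abs_minus_commute)
      also have "\<dots> \<le> M z * B" unfolding f_def[symmetric] using f bump_lipschitz[of B y z] by (intro mult_mono) (auto simp: f_def bump_nonneg)
      finally show "\<bar>f (0 + y) * f y - f (z + y) * f y\<bar> \<le> B * M z" by (simp add: mult.commute)
    qed (intro continuous_intros cfa cf)+
    then show ?thesis by simp
  qed
  have cK: "continuous_on UNIV K"
  proof -
    have "continuous_on UNIV k"
      unfolding continuous_on_sequentially
    proof safe
      fix u :: "nat \<Rightarrow> 'g" and l assume "u \<longlonglongrightarrow> l"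
      then have u: "(\<lambda>n. M (u n - l)) \<longlonglongrightarrow> 0" by (simp add: tendsto_diff_iff)
      have b: "(norm (k (u n) - k l))\<^sup>2 \<le> 2 * k 0 * (B * M (u n - l))" for n
      proof -
        have "(norm (K (u n) - K l))\<^sup>2 \<le> 2 * k 0 * (k 0 - k (u n - l))" using pos_def_diff[OF K, of "u n" l] by (simp add: K_def)
        also have "\<dots> \<le> 2 * k 0 * (B * M (u n - l))" using pos_def_0(2)[OF K] kz by (intro mult_left_mono) (auto simp: K_def)
        finally show ?thesis by (simp add: K_def of_real_diff[symmetric] del: of_real_diff)
      qed
      have "(\<lambda>n. 2 * k 0 * (B * M (u n - l))) \<longlonglongrightarrow> 2 * k 0 * (B * 0)" by (intro tendsto_intros u)
      then have lim0: "(\<lambda>n. 2 * k 0 * (B * M (u n - l))) \<longlonglongrightarrow> 0" by simp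
      have "(\<lambda>n. (norm (k (u n) - k l))\<^sup>2) \<longlonglongrightarrow> 0"
        by (rule Lim_null_comparison[OF _ lim0]) (use b in auto)
      from tendsto_real_sqrt[OF this] have "(\<lambda>n. norm (k (u n) - k l)) \<longlonglongrightarrow> 0" by simp
      then have "(\<lambda>n. k (u n) - k l) \<longlonglongrightarrow> 0" by (rule tendsto_norm_zero_cancel)
      then show "(k \<circ> u) \<longlonglongrightarrow> k l" by (simp add: LIM_zero_iff comp_def)
    qed
    then show ?thesis unfolding K_def by (intro continuous_intros)
  qed
  \<comment> \<open>The defect of K at x is at most B * M x, hence at most (1/4)^j where the bump of
    radius \<open>R j\<close> is positive. So pen j K \<le> (1/2)^j, and the penalties add at most 2
    to k 0, which fixes the level of the cap.\<close>
  define R where "R j = (1/4)^j / B" for j :: nat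
  have R: "R j > 0" for j using B by (simp add: R_def)
  have L: "k 0 + 2 > 0" using pos_def_0(2)[OF K] by (simp add: K_def)
  interpret positive_cap M R "k 0 + 2" by unfold_locales (use R L in auto)
  have pen: "pen j K \<le> (1/2)^j" for j
  proof -
    have "mean (\<lambda>x. bump (R j) x * (Re (K 0) - Re (K x))) \<le> mean (\<lambda>x. (1/4)^j * bump (R j) x)"
    proof (rule mean_mono)
      fix x
      show "bump (R j) x * (Re (K 0) - Re (K x)) \<le> (1/4)^j * bump (R j) x"
      proof (cases "M x < R j")
        case True
        then have "B * M x \<le> (1/4)^j" using B by (simp add: R_def field_simps)
        then have "k 0 - k x \<le> (1/4)^j" using kz[of x] by simp
        from mult_left_mono[OF this bump_nonneg[of "R j" x]] show ?thesis by (simp add: K_def mult.commute)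
      next
        case False then show ?thesis by (simp add: bump_def)
      qed
    qed (intro continuous_intros continuous_on_bump cK)+
    also have "\<dots> = (1/4)^j * w j" by (simp add: mean_cmult continuous_on_bump w_def)
    finally have "2^j / w j * mean (\<lambda>x. bump (R j) x * (Re (K 0) - Re (K x))) \<le> 2^j / w j * ((1/4)^j * w j)"
      using w_pos[of j] by (intro mult_left_mono) auto
    also have "\<dots> = 2^j * (1/4)^j" using w_pos[of j] by simp
    also have "\<dots> = (1/2)^j" by (simp add: power_mult_distrib[symmetric])
    finally show ?thesis by (simp add: pen_def)
  qed
  have "K \<in> cap" unfolding cap_def
  proof (intro CollectI conjI allI K cK)
    fix J
    have "(\<Sum>j<J. pen j K) \<le> (\<Sum>j<J. (1/2)^j)" by (intro sum_mono pen)
    also have "\<dots> \<le> 2" by (simp add: sum_gp_strict)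
    finally show "Re (K 0) + (\<Sum>j<J. pen j K) \<le> k 0 + 2" by (simp add: K_def)
  qed
  moreover have "Re (K x0) < Re (K 0)"
  proof -
    have c2: "continuous_on UNIV (\<lambda>y. (f (a + y))\<^sup>2)" for a by (intro continuous_intros cfa)
    have "0 < mean (\<lambda>y. (f (x0 + y) - f y)\<^sup>2)"
    proof (rule mean_pos[of _ 0])
      show "0 < (f (x0 + 0) - f 0)\<^sup>2" using B assms by (simp add: f_def bump_def B_def)
    qed (auto intro!: continuous_intros cfa cf)
    also have "(\<lambda>y. (f (x0 + y) - f y)\<^sup>2) = (\<lambda>y. ((f (x0 + y))\<^sup>2 + (f (0 + y))\<^sup>2) + (- 2) * (f (x0 + y) * f y))"
      by (simp add: fun_eq_iff power2_eq_square algebra_simps)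
    also have "mean \<dots> = (mean (\<lambda>y. (f (x0 + y))\<^sup>2) + mean (\<lambda>y. (f (0 + y))\<^sup>2)) + (- 2) * k x0"
      unfolding k_def mean_cmult[OF continuous_on_mult[OF cfa cf], symmetric] mean_add[OF c2 c2, symmetric]
      by (rule mean_add) (intro continuous_intros cfa cf)+
    also have "mean (\<lambda>y. (f (x0 + y))\<^sup>2) = k 0" using k_shift[of x0 x0] by (simp add: power2_eq_square)
    also have "mean (\<lambda>y. (f (0 + y))\<^sup>2) = k 0" by (simp add: k_def power2_eq_square)
    finally show ?thesis by (simp add: K_def)
  qed
  ultimately show ?thesis using that by (rule character_exists)
qed

subsection \<open>One-parameter subgroups\<close>

lemma character_mult: "character \<xi> \<Longrightarrow> character \<zeta> \<Longrightarrow> character (\<lambda>x. \<xi> x * \<zeta> x)"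
  by (auto simp: character_def norm_mult intro!: continuous_intros)

lemma character_nz: "character \<xi> \<Longrightarrow> \<xi> x \<noteq> 0"
  by (metis character_def norm_zero zero_neq_one)

lemma character_inverse: "character \<xi> \<Longrightarrow> character (\<lambda>x. inverse (\<xi> x))"
  using character_nz[of \<xi>] by (auto simp: character_def norm_inverse intro!: continuous_intros)

lemma character_one: "character (\<lambda>_. 1)" by (simp add: character_def)

lemma character_0: "character \<xi> \<Longrightarrow> \<xi> 0 = 1"
  using character_nz[of \<xi> 0] by (metis character_def add_0 mult_cancel_left1)

lemma character_power_int: "character \<xi> \<Longrightarrow> character (\<lambda>x. \<xi> x powi k)"
  using character_nz[of \<xi>]
  by (auto simp: character_def norm_power_int power_int_mult_distrib intro!: continuous_intros)

lemma inverse_unit: "norm z = 1 \<Longrightarrow> inverse z = cnj z" for z :: complex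
  using complex_norm_square[of z] by (intro inverse_unique) simp

text \<open>The values are roots of unity of a fixed order, hence finitely many, and a continuous
  map with finitely many values on a connected space is constant.\<close>

lemma character_torsion_free:
  fixes \<xi> :: "'g::topological_ab_group_add \<Rightarrow> complex"
  assumes "connected (UNIV :: 'g set)" "character \<xi>" "k \<noteq> 0" "\<And>x. \<xi> x powi k = 1"
  shows "\<xi> x = 1"
proof -
  define n where "n = nat \<bar>k\<bar>"
  have n: "n > 0" using assms(3) by (simp add: n_def)
  have "\<xi> x ^ n = 1" for x
    using assms(4)[of x] by (auto simp: n_def power_int_def abs_if power_inverse split: if_splits)
  then have "range \<xi> \<subseteq> {z. z ^ n = 1}" by auto
  moreover have "finite {z::complex. z ^ n = 1}" using n by (intro finite_roots_unity) simp
  ultimately have "finite (range \<xi>)" by (rule finite_subset)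
  then have "\<xi> constant_on UNIV"
    using assms(1,2) by (intro continuous_finite_range_constant) (auto simp: character_def)
  then show ?thesis using character_0[OF assms(2)] by (metis UNIV_I constant_on_def)
qed

text \<open>Graphs of homomorphisms from groups of characters to the reals; a maximal one is defined on all
  characters because the reals are divisible.\<close>

definition char_graph :: "(('g::topological_ab_group_add \<Rightarrow> complex) \<times> real) set \<Rightarrow> bool"
  where "char_graph \<Gamma> \<longleftrightarrow> (\<forall>\<xi> r. (\<xi>, r) \<in> \<Gamma> \<longrightarrow> character \<xi>) \<and> (\<lambda>_. 1, 0) \<in> \<Gamma> \<and>
    (\<forall>\<xi> r \<zeta> s. (\<xi>, r) \<in> \<Gamma> \<longrightarrow> (\<zeta>, s) \<in> \<Gamma> \<longrightarrow> (\<lambda>x. \<xi> x * \<zeta> x, r + s) \<in> \<Gamma>) \<and>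
    (\<forall>\<xi> r. (\<xi>, r) \<in> \<Gamma> \<longrightarrow> (\<lambda>x. inverse (\<xi> x), - r) \<in> \<Gamma>) \<and>
    (\<forall>r. (\<lambda>_. 1, r) \<in> \<Gamma> \<longrightarrow> r = 0)"

lemma char_graphD:
  assumes "char_graph \<Gamma>"
  shows "(\<xi>, r) \<in> \<Gamma> \<Longrightarrow> character \<xi>" "(\<lambda>_. 1, 0) \<in> \<Gamma>"
    "(\<xi>, r) \<in> \<Gamma> \<Longrightarrow> (\<zeta>, s) \<in> \<Gamma> \<Longrightarrow> (\<lambda>x. \<xi> x * \<zeta> x, r + s) \<in> \<Gamma>"
    "(\<xi>, r) \<in> \<Gamma> \<Longrightarrow> (\<lambda>x. inverse (\<xi> x), - r) \<in> \<Gamma>"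
    "(\<lambda>_. 1, r) \<in> \<Gamma> \<Longrightarrow> r = 0"
  using assms unfolding char_graph_def by blast+

lemma char_graph_unique:
  assumes "char_graph \<Gamma>" "(\<xi>, r) \<in> \<Gamma>" "(\<xi>, s) \<in> \<Gamma>" shows "r = s"
proof -
  have "(\<lambda>x. \<xi> x * inverse (\<xi> x), r + - s) \<in> \<Gamma>"
    by (rule char_graphD(3)[OF assms(1,2) char_graphD(4)[OF assms(1,3)]])
  then have "(\<lambda>_. 1, r - s) \<in> \<Gamma>" using character_nz[OF char_graphD(1)[OF assms(1,2)]] by simp
  then show ?thesis using char_graphD(5)[OF assms(1)] by fastforce
qed

lemma char_graph_power_int:
  assumes "char_graph \<Gamma>" "(\<xi>, r) \<in> \<Gamma>" shows "(\<lambda>x. \<xi> x powi k, of_int k * r) \<in> \<Gamma>"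
proof -
  have nat: "(\<lambda>x. \<xi> x ^ n, real n * r) \<in> \<Gamma>" for n
  proof (induction n)
    case 0 then show ?case using char_graphD(2)[OF assms(1)] by simp
  next
    case (Suc n)
    from char_graphD(3)[OF assms Suc] show ?case by (simp add: algebra_simps)
  qed
  show ?thesis
  proof (cases "k \<ge> 0")
    case True then show ?thesis using nat[of "nat k"] by (simp add: power_int_def)
  next
    case False
    from char_graphD(4)[OF assms(1) nat[of "nat (- k)"]] show ?thesis using False by (simp add: power_int_def power_inverse)
  qed
qed

text \<open>Adjoins \<zeta> with value t. The hypothesis on t is compatibility with all powers of
  \<zeta> already in the domain, which is what single-valuedness at the trivial character
  requires.\<close>

lemma char_graph_extend:
  assumes \<Gamma>: "char_graph \<Gamma>" and \<zeta>: "character \<zeta>"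
    and t: "\<And>k s. (\<lambda>x. \<zeta> x powi k, s) \<in> \<Gamma> \<Longrightarrow> s = of_int k * t"
  obtains \<Gamma>' where "char_graph \<Gamma>'" "\<Gamma> \<subseteq> \<Gamma>'" "(\<zeta>, t) \<in> \<Gamma>'"
proof -
  define \<Gamma>' where "\<Gamma>' = {(\<lambda>x. \<xi> x * \<zeta> x powi k, r + of_int k * t) | \<xi> r k. (\<xi>, r) \<in> \<Gamma>}"
  have I: "(\<eta>, v) \<in> \<Gamma>'" if "(\<xi>, r) \<in> \<Gamma>" "\<And>x. \<eta> x = \<xi> x * \<zeta> x powi k" "v = r + of_int k * t" for \<xi> r k \<eta> v
  proof -
    have "\<eta> = (\<lambda>x. \<xi> x * \<zeta> x powi k)" using that(2) by auto
    then show ?thesis unfolding \<Gamma>'_def using that by blast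
  qed
  have nz: "\<zeta> x \<noteq> 0" for x by (rule character_nz[OF \<zeta>])
  show ?thesis
  proof (rule that)
    show "\<Gamma> \<subseteq> \<Gamma>'" using I[of _ _ _ 0] by force
    show "(\<zeta>, t) \<in> \<Gamma>'" using I[OF char_graphD(2)[OF \<Gamma>], of \<zeta> 1 t] by simp
    show "char_graph \<Gamma>'" unfolding char_graph_def
    proof (intro conjI allI impI)
      fix \<eta> v assume "(\<eta>, v) \<in> \<Gamma>'"
      then obtain \<xi> r k where e: "\<eta> = (\<lambda>x. \<xi> x * \<zeta> x powi k)" "v = r + of_int k * t" "(\<xi>, r) \<in> \<Gamma>" by (auto simp: \<Gamma>'_def)
      show "character \<eta>" unfolding e by (intro character_mult character_power_int \<zeta> char_graphD(1)[OF \<Gamma> e(3)])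
      show "(\<lambda>x. inverse (\<eta> x), - v) \<in> \<Gamma>'"
        by (rule I[OF char_graphD(4)[OF \<Gamma> e(3)], of _ "- k"]) (simp_all add: e power_int_minus)
      fix \<eta>' v' assume "(\<eta>', v') \<in> \<Gamma>'"
      then obtain \<xi>' r' k' where e': "\<eta>' = (\<lambda>x. \<xi>' x * \<zeta> x powi k')" "v' = r' + of_int k' * t" "(\<xi>', r') \<in> \<Gamma>" by (auto simp: \<Gamma>'_def)
      show "(\<lambda>x. \<eta> x * \<eta>' x, v + v') \<in> \<Gamma>'"
        by (rule I[OF char_graphD(3)[OF \<Gamma> e(3) e'(3)], of _ "k + k'"]) (simp_all add: e e' power_int_add nz algebra_simps)
    next
      show "(\<lambda>_. 1, 0) \<in> \<Gamma>'" by (rule I[OF char_graphD(2)[OF \<Gamma>], of _ 0]) simp_all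
    next
      fix v assume "(\<lambda>_. 1, v) \<in> \<Gamma>'"
      then obtain \<xi> r k where e: "(\<lambda>_. 1) = (\<lambda>x. \<xi> x * \<zeta> x powi k)" "v = r + of_int k * t" "(\<xi>, r) \<in> \<Gamma>" by (auto simp: \<Gamma>'_def)
      have "\<xi> x * \<zeta> x powi k = 1" for x using fun_cong[OF e(1), of x] by simp
      then have "\<xi> x = \<zeta> x powi (- k)" for x by (metis inverse_unique mult.commute power_int_minus)
      then have "\<xi> = (\<lambda>x. \<zeta> x powi (- k))" by auto
      then have "r = of_int (- k) * t" using t[of "- k" r] e(3) by simp
      then show "v = 0" using e(2) by simp
    qed
  qed
qed

lemma character_real_hom:
  fixes \<xi>1 :: "'g::topological_ab_group_add \<Rightarrow> complex"
  assumes conn: "connected (UNIV :: 'g set)" and \<xi>1: "character \<xi>1" "\<xi>1 x1 \<noteq> 1"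
  obtains L where "\<And>\<xi> \<zeta>. character \<xi> \<Longrightarrow> character \<zeta> \<Longrightarrow> L (\<lambda>x. \<xi> x * \<zeta> x) = L \<xi> + (L \<zeta> :: real)" "L \<xi>1 = 1"
proof -
  define \<A> where "\<A> = {\<Gamma>. char_graph \<Gamma> \<and> (\<xi>1, 1) \<in> \<Gamma>}"
  have "char_graph {(\<lambda>_::'g. 1, 0)}" by (simp add: char_graph_def character_one)
  \<comment> \<open>Start of the construction: by connectedness \<xi>1 has infinite order, so its
    powers can be sent to the integers.\<close>
  moreover have "s = of_int k * 1" if "(\<lambda>x. \<xi>1 x powi k, s) \<in> {(\<lambda>_::'g. 1, 0)}" for k s
  proof -
    have "s = 0" "\<And>x. \<xi>1 x powi k = 1" using that by (auto dest: fun_cong)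
    then have "k = 0" using character_torsion_free[OF conn \<xi>1(1), of k x1] \<xi>1(2) by auto
    then show ?thesis using \<open>s = 0\<close> by simp
  qed
  ultimately obtain \<Gamma>0 where "char_graph \<Gamma>0" "(\<xi>1, 1) \<in> \<Gamma>0" using char_graph_extend[OF _ \<xi>1(1), of _ 1] by metis
  then have ne: "\<A> \<noteq> {}" by (auto simp: \<A>_def)
  have "\<exists>\<Gamma>\<in>\<A>. \<forall>X\<in>\<A>. \<Gamma> \<subseteq> X \<longrightarrow> X = \<Gamma>"
  proof (rule subset_Zorn_nonempty[OF ne])
    fix C assume C: "C \<noteq> {}" "subset.chain \<A> C"
    have CA: "\<Gamma> \<in> \<A>" if "\<Gamma> \<in> C" for \<Gamma> using C(2) that by (auto simp: subset.chain_def)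
    have g: "char_graph \<Gamma>" if "\<Gamma> \<in> C" for \<Gamma> using CA[OF that] by (simp add: \<A>_def)
    have tot: "\<Gamma> \<subseteq> \<Gamma>' \<or> \<Gamma>' \<subseteq> \<Gamma>" if "\<Gamma> \<in> C" "\<Gamma>' \<in> C" for \<Gamma> \<Gamma>' using C(2) that by (auto simp: subset.chain_def)
    have "char_graph (\<Union>C)" unfolding char_graph_def
    proof (intro conjI allI impI)
      show "(\<lambda>_. 1, 0) \<in> \<Union>C" using C(1) char_graphD(2)[OF g] by blast
      show "character \<xi>" if "(\<xi>, r) \<in> \<Union>C" for \<xi> r using that char_graphD(1)[OF g] by blast
      show "(\<lambda>x. inverse (\<xi> x), - r) \<in> \<Union>C" if "(\<xi>, r) \<in> \<Union>C" for \<xi> r using that char_graphD(4)[OF g] by blast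
      show "r = 0" if "(\<lambda>_. 1, r) \<in> \<Union>C" for r using that char_graphD(5)[OF g] by blast
      show "(\<lambda>x. \<xi> x * \<zeta> x, r + s) \<in> \<Union>C" if h: "(\<xi>, r) \<in> \<Union>C" "(\<zeta>, s) \<in> \<Union>C" for \<xi> r \<zeta> s
      proof -
        obtain \<Gamma> \<Gamma>' where G: "\<Gamma> \<in> C" "\<Gamma>' \<in> C" "(\<xi>, r) \<in> \<Gamma>" "(\<zeta>, s) \<in> \<Gamma>'" using h by blast
        then obtain \<Gamma>'' where "\<Gamma>'' \<in> C" "(\<xi>, r) \<in> \<Gamma>''" "(\<zeta>, s) \<in> \<Gamma>''" using tot[OF G(1,2)] by blast
        then show ?thesis using char_graphD(3)[OF g] by blast
      qed
    qed
    moreover have "(\<xi>1, 1) \<in> \<Union>C" using C(1) CA by (auto simp: \<A>_def)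
    ultimately show "\<Union>C \<in> \<A>" by (simp add: \<A>_def)
  qed
  then obtain \<Gamma> where \<Gamma>: "char_graph \<Gamma>" "(\<xi>1, 1) \<in> \<Gamma>" and max: "\<And>X. X \<in> \<A> \<Longrightarrow> \<Gamma> \<subseteq> X \<Longrightarrow> X = \<Gamma>" by (auto simp: \<A>_def)
  have dom: "\<exists>r. (\<zeta>, r) \<in> \<Gamma>" if \<zeta>: "character \<zeta>" for \<zeta>
  proof -
    \<comment> \<open>If a nonzero power m of \<zeta> already has a value sm, then t = sm / m is
      forced, and it is consistent by comparing powers k * m; otherwise any t would do.\<close>
    have "\<exists>t. \<forall>k s. (\<lambda>x. \<zeta> x powi k, s) \<in> \<Gamma> \<longrightarrow> s = of_int k * t"
    proof (cases "\<exists>m s. m \<noteq> 0 \<and> (\<lambda>x. \<zeta> x powi m, s) \<in> \<Gamma>")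
      case False
      then have "s = of_int k * 0" if "(\<lambda>x. \<zeta> x powi k, s) \<in> \<Gamma>" for k s
        using that char_graphD(5)[OF \<Gamma>(1), of s] by (cases "k = 0") auto
      then show ?thesis by blast
    next
      case True
      then obtain m sm where m: "m \<noteq> 0" "(\<lambda>x. \<zeta> x powi m, sm) \<in> \<Gamma>" by blast
      have "s = of_int k * (sm / of_int m)" if "(\<lambda>x. \<zeta> x powi k, s) \<in> \<Gamma>" for k s
      proof -
        have "(\<lambda>x. \<zeta> x powi (k * m), of_int m * s) \<in> \<Gamma>" using char_graph_power_int[OF \<Gamma>(1) that, of m] by (simp add: power_int_mult)
        moreover have "(\<lambda>x. \<zeta> x powi (k * m), of_int k * sm) \<in> \<Gamma>" using char_graph_power_int[OF \<Gamma>(1) m(2), of k] by (simp add: power_int_mult[symmetric] mult.commute)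
        ultimately have "of_int m * s = of_int k * sm" by (rule char_graph_unique[OF \<Gamma>(1)])
        then show ?thesis using m(1) by (simp add: field_simps)
      qed
      then show ?thesis by blast
    qed
    then obtain t where "\<And>k s. (\<lambda>x. \<zeta> x powi k, s) \<in> \<Gamma> \<Longrightarrow> s = of_int k * t" by blast
    then obtain \<Gamma>' where \<Gamma>': "char_graph \<Gamma>'" "\<Gamma> \<subseteq> \<Gamma>'" "(\<zeta>, t) \<in> \<Gamma>'" using char_graph_extend[OF \<Gamma>(1) \<zeta>] by blast
    then have "\<Gamma>' = \<Gamma>" using \<Gamma>(2) by (intro max) (auto simp: \<A>_def)
    then show ?thesis using \<Gamma>'(3) by blast
  qed
  define L where "L \<xi> = (SOME r. (\<xi>, r) \<in> \<Gamma>)" for \<xi>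
  have L: "(\<xi>, L \<xi>) \<in> \<Gamma>" if "character \<xi>" for \<xi> unfolding L_def using dom[OF that] by (rule someI_ex)
  show ?thesis
  proof (rule that)
    show "L \<xi>1 = 1" by (rule char_graph_unique[OF \<Gamma>(1) L[OF \<xi>1(1)] \<Gamma>(2)])
    show "L (\<lambda>x. \<xi> x * \<zeta> x) = L \<xi> + L \<zeta>" if "character \<xi>" "character \<zeta>" for \<xi> \<zeta>
      by (rule char_graph_unique[OF \<Gamma>(1) L[OF character_mult[OF that]] char_graphD(3)[OF \<Gamma>(1) L[OF that(1)] L[OF that(2)]]])
  qed
qed

text \<open>If \<phi> is evaluation at h, then cnj (\<phi> \<xi>) * \<xi> x = \<xi> (x - h), so the
  first function is the second one translated. For general \<phi> it is a formal translate of a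
  trigonometric polynomial. The relation carries both functions along and so avoids extracting
  coefficients.\<close>

inductive trig :: "(('g::topological_ab_group_add \<Rightarrow> complex) \<Rightarrow> complex) \<Rightarrow> ('g \<Rightarrow> complex) \<Rightarrow> ('g \<Rightarrow> complex) \<Rightarrow> bool"
  for \<phi> where
  gen: "character \<xi> \<Longrightarrow> trig \<phi> (\<lambda>x. c * (cnj (\<phi> \<xi>) * \<xi> x)) (\<lambda>x. c * \<xi> x)"
| add: "trig \<phi> f f' \<Longrightarrow> trig \<phi> g g' \<Longrightarrow> trig \<phi> (\<lambda>x. f x + g x) (\<lambda>x. f' x + g' x)"

locale dual_hom =
  fixes \<phi> :: "('g::topological_ab_group_add \<Rightarrow> complex) \<Rightarrow> complex"
  assumes norm_\<phi>: "character \<xi> \<Longrightarrow> norm (\<phi> \<xi>) = 1"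
    and \<phi>_mult: "character \<xi> \<Longrightarrow> character \<zeta> \<Longrightarrow> \<phi> (\<lambda>x. \<xi> x * \<zeta> x) = \<phi> \<xi> * \<phi> \<zeta>"
begin

lemma \<phi>_one: "\<phi> (\<lambda>_. 1) = 1"
  using \<phi>_mult[OF character_one character_one] norm_\<phi>[OF character_one] by (metis mult_cancel_left1 norm_zero zero_neq_one mult_1)

lemma \<phi>_inverse: "character \<xi> \<Longrightarrow> \<phi> (\<lambda>x. inverse (\<xi> x)) = cnj (\<phi> \<xi>)"
proof -
  assume \<xi>: "character \<xi>"
  have "\<phi> \<xi> * \<phi> (\<lambda>x. inverse (\<xi> x)) = 1"
    using \<phi>_mult[OF \<xi> character_inverse[OF \<xi>]] character_nz[OF \<xi>] \<phi>_one by simp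
  then show ?thesis using inverse_unit[OF norm_\<phi>[OF \<xi>]] inverse_unique by metis
qed

lemma trig_mult_gen: "trig \<phi> g g' \<Longrightarrow> character \<xi> \<Longrightarrow> trig \<phi> (\<lambda>x. c * (cnj (\<phi> \<xi>) * \<xi> x) * g x) (\<lambda>x. c * \<xi> x * g' x)"
proof (induction rule: trig.induct)
  case (gen \<zeta> c')
  have "trig \<phi> (\<lambda>x. (c * c') * (cnj (\<phi> (\<lambda>x. \<xi> x * \<zeta> x)) * (\<xi> x * \<zeta> x))) (\<lambda>x. (c * c') * (\<xi> x * \<zeta> x))"
    by (rule trig.gen[OF character_mult]) (use gen in auto)
  then show ?case using gen by (simp add: \<phi>_mult mult_ac)
next
  case (add f f' g g')
  then show ?case using trig.add by (fastforce simp: distrib_left)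
qed

lemma trig_mult: "trig \<phi> f f' \<Longrightarrow> trig \<phi> g g' \<Longrightarrow> trig \<phi> (\<lambda>x. f x * g x) (\<lambda>x. f' x * g' x)"
proof (induction rule: trig.induct)
  case (gen \<xi> c) then show ?case using trig_mult_gen by blast
next
  case (add f f' h h')
  then show ?case using trig.add[of \<phi> "\<lambda>x. f x * g x" "\<lambda>x. f' x * g' x" "\<lambda>x. h x * g x" "\<lambda>x. h' x * g' x"] by (simp add: distrib_right)
qed

lemma trig_const: "trig \<phi> (\<lambda>_. c) (\<lambda>_. c)"
  using trig.gen[OF character_one, of \<phi> c] by (simp add: \<phi>_one)

lemma trig_power: "trig \<phi> f f' \<Longrightarrow> trig \<phi> (\<lambda>x. f x ^ n) (\<lambda>x. f' x ^ n)"
  by (induction n) (simp_all add: trig_const trig_mult)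

lemma trig_prod: "finite F \<Longrightarrow> (\<And>i. i \<in> F \<Longrightarrow> trig \<phi> (f i) (f' i)) \<Longrightarrow> trig \<phi> (\<lambda>x. \<Prod>i\<in>F. f i x) (\<lambda>x. \<Prod>i\<in>F. f' i x)"
  by (induction F rule: finite_induct) (simp_all add: trig_const trig_mult)

text \<open>The factor takes values in [0, 1] and is 1 only where the character, or its formal
  translate, is 1. It is a trigonometric polynomial since Re z = (z + inverse z) / 2 on the unit
  circle.\<close>

lemma trig_factor:
  assumes \<xi>: "character \<xi>"
  shows "trig \<phi> (\<lambda>x. complex_of_real ((1 + Re (cnj (\<phi> \<xi>) * \<xi> x)) / 2)) (\<lambda>x. complex_of_real ((1 + Re (\<xi> x)) / 2))"
proof -
  have inv: "inverse (\<xi> x) = cnj (\<xi> x)" for x using \<xi> by (intro inverse_unit) (simp add: character_def)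
  have "trig \<phi> (\<lambda>x. 1 / 2 + (1 / 4 * (cnj (\<phi> \<xi>) * \<xi> x) + 1 / 4 * (cnj (\<phi> (\<lambda>x. inverse (\<xi> x))) * inverse (\<xi> x))))
     (\<lambda>x. 1 / 2 + (1 / 4 * \<xi> x + 1 / 4 * inverse (\<xi> x)))"
    by (intro trig.add trig_const trig.gen \<xi> character_inverse)
  then show ?thesis
  proof (rule back_subst[where P = "\<lambda>f. trig \<phi> f _", THEN back_subst[where P = "\<lambda>f. trig \<phi> _ f"]])
    show "(\<lambda>x. 1 / 2 + (1 / 4 * (cnj (\<phi> \<xi>) * \<xi> x) + 1 / 4 * (cnj (\<phi> (\<lambda>x. inverse (\<xi> x))) * inverse (\<xi> x)))) =
      (\<lambda>x. complex_of_real ((1 + Re (cnj (\<phi> \<xi>) * \<xi> x)) / 2))"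
      unfolding \<phi>_inverse[OF \<xi>] by (rule ext) (simp add: inv complex_eq_iff add_divide_distrib[symmetric])
    show "(\<lambda>x. 1 / 2 + (1 / 4 * \<xi> x + 1 / 4 * inverse (\<xi> x))) = (\<lambda>x. complex_of_real ((1 + Re (\<xi> x)) / 2))"
      by (rule ext) (simp add: inv complex_eq_iff)
  qed
qed

end

text \<open>A nontrivial character has mean 0 and \<phi> is 1 at the trivial one, so formal
  translation preserves means.\<close>

lemma (in compact_ab_group) trig_mean:
  assumes "dual_hom \<phi>" "trig \<phi> f f'"
  shows "\<exists>c. has_mean (f :: 'g \<Rightarrow> complex) c \<and> has_mean f' c"
  using assms(2)
proof (induction rule: trig.induct)
  case (gen \<xi> c)
  show ?case
  proof (cases "\<forall>x. \<xi> x = 1")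
    case True
    then have "\<xi> = (\<lambda>_. 1)" by auto
    then show ?thesis using dual_hom.\<phi>_one[OF assms(1)] has_mean_const by auto
  next
    case False
    then obtain a where a: "\<xi> a \<noteq> 1" by blast
    have m: "has_mean \<xi> (mean \<xi>)" using gen by (intro has_mean_complex) (simp add: character_def)
    have "has_mean (\<lambda>x. \<xi> (x + a)) (mean \<xi>)" by (rule has_mean_translate[OF m])
    moreover have "has_mean (\<lambda>x. \<xi> a * \<xi> x) (\<xi> a * mean \<xi>)" by (rule has_mean_bounded_linear[OF bounded_linear_mult_right m])
    moreover have "(\<lambda>x. \<xi> (x + a)) = (\<lambda>x. \<xi> a * \<xi> x)" using gen by (auto simp: character_def)
    ultimately have "mean \<xi> = \<xi> a * mean \<xi>" using has_mean_unique by metis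
    then have "mean \<xi> = 0" using a by simp
    then have "has_mean \<xi> 0" using m by simp
    then have "has_mean (\<lambda>x. c * \<xi> x) (c * 0)" "has_mean (\<lambda>x. (c * cnj (\<phi> \<xi>)) * \<xi> x) (c * cnj (\<phi> \<xi>) * 0)"
      by (blast intro: has_mean_bounded_linear[OF bounded_linear_mult_right])+
    then show ?thesis by (auto simp: mult.assoc)
  qed
next
  case (add f f' g g')
  then show ?case using has_mean_add by blast
qed

text \<open>Compare moments. P1 has value 1 at 0, and P is its formal translate, so their powers
  have equal means. If no h were good, P would be at most 1 - \<eta> everywhere, whereas P1 is at
  least 1 - \<eta> / 2 on a ball; high powers make this impossible.\<close>

lemma (in compact_ab_group) approximate_dual_hom:
  assumes \<phi>: "dual_hom (\<phi> :: ('g \<Rightarrow> complex) \<Rightarrow> complex)" and F: "finite F" "\<And>\<xi>. \<xi> \<in> F \<Longrightarrow> character \<xi>" and e: "e > 0"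
  shows "\<exists>h. \<forall>\<xi>\<in>F. norm (\<xi> h - \<phi> \<xi>) < e"
proof (rule ccontr)
  interpret dual_hom \<phi> by fact
  assume neg: "\<not> ?thesis"
  define f where "f \<xi> x = (1 + Re (cnj (\<phi> \<xi>) * \<xi> x)) / 2" for \<xi> and x :: 'g
  define f1 where "f1 \<xi> x = (1 + Re (\<xi> x)) / 2" for \<xi> and x :: 'g
  define P where "P x = (\<Prod>\<xi>\<in>F. f \<xi> x)" for x
  define P1 where "P1 x = (\<Prod>\<xi>\<in>F. f1 \<xi> x)" for x
  have cont: "continuous_on UNIV \<xi>" "norm (\<xi> x) = 1" if "\<xi> \<in> F" for \<xi> x using F(2)[OF that] by (auto simp: character_def)
  have cP: "continuous_on UNIV P" unfolding P_def f_def by (intro continuous_intros cont) auto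
  have cP1: "continuous_on UNIV P1" unfolding P1_def f1_def by (intro continuous_intros cont) auto
  have mean_eq: "mean (\<lambda>x. P x ^ N) = mean (\<lambda>x. P1 x ^ N)" for N
  proof -
    have "trig \<phi> (\<lambda>x. (\<Prod>\<xi>\<in>F. complex_of_real (f \<xi> x)) ^ N) (\<lambda>x. (\<Prod>\<xi>\<in>F. complex_of_real (f1 \<xi> x)) ^ N)"
      unfolding f_def f1_def by (intro trig_power trig_prod F(1) trig_factor F(2))
    then obtain c where c: "has_mean (\<lambda>x. (\<Prod>\<xi>\<in>F. complex_of_real (f \<xi> x)) ^ N) c" "has_mean (\<lambda>x. (\<Prod>\<xi>\<in>F. complex_of_real (f1 \<xi> x)) ^ N) c"
      using trig_mean[OF \<phi>] by blast
    have "has_mean (\<lambda>x. P x ^ N) (Re c)" "has_mean (\<lambda>x. P1 x ^ N) (Re c)"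
      using has_mean_bounded_linear[OF bounded_linear_Re c(1)] has_mean_bounded_linear[OF bounded_linear_Re c(2)]
      unfolding P_def P1_def by (simp_all add: of_real_prod[symmetric] of_real_power[symmetric] del: of_real_prod of_real_power)
    then show ?thesis by (simp add: mean_eqI)
  qed
  have nz: "norm (cnj (\<phi> \<xi>) * \<xi> x) = 1" if "\<xi> \<in> F" for \<xi> x using cont(2)[OF that] norm_\<phi>[OF F(2)[OF that]] by (simp add: norm_mult)
  have f01: "0 \<le> f \<xi> x" "f \<xi> x \<le> 1" if "\<xi> \<in> F" for \<xi> x
    using abs_Re_le_cmod[of "cnj (\<phi> \<xi>) * \<xi> x"] unfolding nz[OF that] f_def by (simp_all only: abs_le_iff) simp_all
  have f101: "0 \<le> f1 \<xi> x" if "\<xi> \<in> F" for \<xi> x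
    using abs_Re_le_cmod[of "\<xi> x"] unfolding cont(2)[OF that] f1_def by (simp_all only: abs_le_iff) simp_all
  \<comment> \<open>For norm z = 1 one has norm (z - 1)^2 = 2 - 2 * Re z, so norm (z - 1) \<ge> e
    gives (1 + Re z) / 2 \<le> 1 - e^2 / 4.\<close>
  define \<eta> where "\<eta> = e\<^sup>2 / 4"
  have \<eta>: "\<eta> > 0" using e by (simp add: \<eta>_def)
  have P0: "0 \<le> P x" for x unfolding P_def by (intro prod_nonneg) (auto simp: f01)
  have P_le: "P x \<le> 1 - \<eta>" for x
  proof -
    obtain \<xi> where \<xi>: "\<xi> \<in> F" "norm (\<xi> x - \<phi> \<xi>) \<ge> e" using neg by (auto simp: not_less)
    define z where "z = cnj (\<phi> \<xi>) * \<xi> x"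
    have "\<phi> \<xi> * cnj (\<phi> \<xi>) = 1" using complex_norm_square[of "\<phi> \<xi>"] norm_\<phi>[OF F(2)[OF \<xi>(1)]] by simp
    then have "cnj (\<phi> \<xi>) * (\<xi> x - \<phi> \<xi>) = z - 1" by (simp add: z_def algebra_simps)
    then have "norm (z - 1) = norm (\<xi> x - \<phi> \<xi>)" using norm_\<phi>[OF F(2)[OF \<xi>(1)]] by (metis complex_mod_cnj mult_1 norm_mult)
    then have "e\<^sup>2 \<le> (norm (z - 1))\<^sup>2" using \<xi>(2) e by (intro power_mono) auto
    also have "\<dots> = (norm z)\<^sup>2 - 2 * Re z + 1" unfolding cmod_power2 by (simp add: power2_eq_square algebra_simps)
    also have "norm z = 1" unfolding z_def by (rule nz[OF \<xi>(1)])
    finally have "f \<xi> x \<le> 1 - \<eta>" unfolding f_def z_def[symmetric] \<eta>_def by (simp add: field_simps)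
    moreover have "P x = f \<xi> x * (\<Prod>\<zeta>\<in>F - {\<xi>}. f \<zeta> x)" unfolding P_def by (rule prod.remove[OF F(1) \<xi>(1)])
    moreover have "(\<Prod>\<zeta>\<in>F - {\<xi>}. f \<zeta> x) \<le> 1" by (intro prod_le_1) (auto simp: f01)
    moreover have "0 \<le> (\<Prod>\<zeta>\<in>F - {\<xi>}. f \<zeta> x)" by (intro prod_nonneg) (auto simp: f01)
    ultimately show ?thesis using f01[OF \<xi>(1), of x] by (metis mult_left_le order_trans)
  qed
  have \<eta>1: "\<eta> \<le> 1" using P_le[of 0] P0[of 0] by linarith
  have P1_0: "P1 0 = 1" unfolding P1_def f1_def by (rule prod.neutral) (auto simp: character_0[OF F(2)])
  obtain r where r: "r > 0" "\<And>x u. M u < r \<Longrightarrow> dist (P1 (x + u)) (P1 x) < \<eta> / 2" using uniform_small[OF cP1, of "\<eta>/2"] \<eta> by auto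
  define b where "b = mean (bump r) / r"
  have b: "b > 0" using mean_bump_pos[OF r(1)] r(1) by (simp add: b_def)
  have le: "(1 - \<eta>/2)^N * b \<le> (1 - \<eta>)^N" for N
  proof -
    have "(1 - \<eta>/2)^N * b = mean (\<lambda>x. ((1 - \<eta>/2)^N / r) * bump r x)" unfolding mean_cmult[OF continuous_on_bump] by (simp add: b_def)
    also have "\<dots> \<le> mean (\<lambda>x. P1 x ^ N)"
    proof (rule mean_mono)
      fix x
      have p1: "0 \<le> P1 x ^ N" unfolding P1_def by (intro zero_le_power prod_nonneg) (auto simp: f101)
      show "((1 - \<eta>/2)^N / r) * bump r x \<le> P1 x ^ N"
      proof (cases "M x < r")
        case True
        have "\<bar>P1 x - 1\<bar> < \<eta> / 2" using r(2)[OF True, of 0] by (simp add: P1_0 dist_real_def)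
        then have "1 - \<eta> / 2 \<le> P1 x" by linarith
        then have "(1 - \<eta>/2)^N \<le> P1 x ^ N" using \<eta>1 by (intro power_mono) auto
        moreover have "bump r x / r \<le> 1" using bump_le[of r x] r(1) by simp
        then have "(1 - \<eta>/2)^N * (bump r x / r) \<le> (1 - \<eta>/2)^N * 1" using \<eta>1 by (intro mult_left_mono) auto
        ultimately show ?thesis by simp
      next
        case False then show ?thesis using p1 by (simp add: bump_def)
      qed
    qed (intro continuous_intros continuous_on_bump cP1)+
    also have "\<dots> = mean (\<lambda>x. P x ^ N)" by (rule mean_eq[symmetric])
    also have "\<dots> \<le> mean (\<lambda>_::'g. (1 - \<eta>)^N)" by (intro mean_mono continuous_intros cP power_mono P_le P0)
    finally show ?thesis by (simp add: mean_const)
  qed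
  define q where "q = (1 - \<eta>) / (1 - \<eta>/2)"
  have q: "0 \<le> q" "q < 1" using \<eta> \<eta>1 by (auto simp: q_def field_simps)
  have "b \<le> q ^ N" for N
  proof -
    have "(1 - \<eta>/2)^N > 0" using \<eta>1 by (intro zero_less_power) simp
    then show ?thesis using le[of N] unfolding q_def power_divide by (simp only: pos_le_divide_eq mult.commute)
  qed
  moreover have "\<exists>N. q ^ N < b" using q b by (metis real_arch_pow_inv)
  ultimately show False by (meson not_less)
qed

text \<open>Compactness enters twice: it upgrades approximation to equality on finite sets of
  characters, and the finite intersection property then treats all characters at once.\<close>

lemma (in compact_ab_group) dual_hom_evaluation:
  assumes \<phi>: "dual_hom (\<phi> :: ('g \<Rightarrow> complex) \<Rightarrow> complex)"
  obtains h where "\<And>\<xi>. character \<xi> \<Longrightarrow> \<xi> h = \<phi> \<xi>"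
proof -
  have fin: "\<exists>h. \<forall>\<xi>\<in>F. \<xi> h = \<phi> \<xi>" if F: "finite F" "\<And>\<xi>. \<xi> \<in> F \<Longrightarrow> character \<xi>" for F
  proof -
    have "\<exists>h. \<forall>\<xi>\<in>F. norm (\<xi> h - \<phi> \<xi>) < 1 / real (Suc n)" for n by (rule approximate_dual_hom[OF \<phi> F]) auto
    then obtain h where h: "\<And>n \<xi>. \<xi> \<in> F \<Longrightarrow> norm (\<xi> (h n) - \<phi> \<xi>) < 1 / real (Suc n)" by metis
    obtain l r where r: "strict_mono r" "(\<lambda>n. h (r n)) \<longlonglongrightarrow> l" by (rule convergent_subsequence)
    have "\<xi> l = \<phi> \<xi>" if "\<xi> \<in> F" for \<xi>
    proof -
      have "(\<lambda>n. \<xi> (h (r n))) \<longlonglongrightarrow> \<xi> l" using F(2)[OF that] continuous_on_tendsto_compose[OF _ r(2), of UNIV \<xi>] by (auto simp: character_def)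
      moreover have "(\<lambda>n. \<xi> (h n) - \<phi> \<xi>) \<longlonglongrightarrow> 0"
        by (rule Lim_null_comparison[OF _ LIMSEQ_inverse_real_of_nat])
          (use h[OF that] in \<open>auto simp: inverse_eq_divide intro!: always_eventually less_imp_le\<close>)
      then have "(\<lambda>n. \<xi> (h n)) \<longlonglongrightarrow> \<phi> \<xi>" by (simp add: LIM_zero_iff)
      then have "(\<lambda>n. \<xi> (h (r n))) \<longlonglongrightarrow> \<phi> \<xi>" using LIMSEQ_subseq_LIMSEQ[OF _ r(1)] by (auto simp: comp_def)
      ultimately show ?thesis by (rule LIMSEQ_unique)
    qed
    then show ?thesis by blast
  qed
  define S where "S = (\<lambda>\<xi>. {h::'g. \<xi> h = \<phi> \<xi>}) ` {\<xi>. character \<xi>}"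
  have "UNIV \<inter> \<Inter>S \<noteq> {}"
  proof (rule compact_imp_fip[OF compact_UNIV])
    show "closed T" if "T \<in> S" for T
      using that by (auto simp: S_def character_def intro!: closed_Collect_eq continuous_intros)
    fix T assume T: "finite T" "T \<subseteq> S"
    then obtain F where F: "F \<subseteq> {\<xi>. character \<xi>}" "finite F" "T = (\<lambda>\<xi>. {h::'g. \<xi> h = \<phi> \<xi>}) ` F"
      unfolding S_def by (meson finite_subset_image)
    then obtain h where "\<forall>\<xi>\<in>F. \<xi> h = \<phi> \<xi>" using fin[of F] by blast
    then show "UNIV \<inter> \<Inter>T \<noteq> {}" using F(3) by auto
  qed
  then obtain h where "\<And>\<xi>. character \<xi> \<Longrightarrow> \<xi> h = \<phi> \<xi>" unfolding S_def by blast
  then show ?thesis by (rule that)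
qed

text \<open>For each t, composing t * L with \<open>cis\<close> gives a homomorphism from the dual
  to the circle, realised by a point \<sigma> t. Additivity of \<sigma>, and the identification of
  limits that gives its continuity, are tested on characters.\<close>

theorem (in compact_ab_group) one_parameter_subgroup:
  fixes x0 :: 'g
  assumes conn: "connected (UNIV :: 'g set)" and "x0 \<noteq> 0"
  obtains \<sigma> :: "real \<Rightarrow> 'g" where "continuous_on UNIV \<sigma>" "\<And>s t. \<sigma> (s + t) = \<sigma> s + \<sigma> t" "\<exists>t. \<sigma> t \<noteq> 0"
proof -
  obtain \<xi>1 :: "'g \<Rightarrow> complex" where \<xi>1: "character \<xi>1" "\<xi>1 x0 \<noteq> 1" using characters_separate[OF assms(2)] .
  obtain L where L: "\<And>\<xi> \<zeta> :: 'g \<Rightarrow> complex. character \<xi> \<Longrightarrow> character \<zeta> \<Longrightarrow> L (\<lambda>x. \<xi> x * \<zeta> x) = L \<xi> + (L \<zeta> :: real)" "L \<xi>1 = 1"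
    using character_real_hom[OF conn \<xi>1] by blast
  have "\<exists>h. \<forall>\<xi>::'g \<Rightarrow> complex. character \<xi> \<longrightarrow> \<xi> h = cis (t * L \<xi>)" for t
  proof -
    have "dual_hom (\<lambda>\<xi>::'g \<Rightarrow> complex. cis (t * L \<xi>))"
      by unfold_locales (simp_all add: L cis_mult distrib_left)
    then show ?thesis using dual_hom_evaluation by blast
  qed
  then obtain \<sigma> where \<sigma>: "\<And>t (\<xi>::'g \<Rightarrow> complex). character \<xi> \<Longrightarrow> \<xi> (\<sigma> t) = cis (t * L \<xi>)" by metis
  have eq: "a = b" if "\<And>\<xi>::'g \<Rightarrow> complex. character \<xi> \<Longrightarrow> \<xi> a = \<xi> b" for a b
  proof (rule ccontr)
    assume "a \<noteq> b"
    then obtain \<xi> :: "'g \<Rightarrow> complex" where \<xi>: "character \<xi>" "\<xi> (a - b) \<noteq> 1" using characters_separate[of "a - b"] by auto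
    have "\<xi> (a - b) * \<xi> b = \<xi> a" using \<xi>(1) by (metis character_def diff_add_cancel)
    then show False using that[OF \<xi>(1)] \<xi>(2) character_nz[OF \<xi>(1), of b] by simp
  qed
  show ?thesis
  proof (rule that)
    show "\<sigma> (s + t) = \<sigma> s + \<sigma> t" for s t
    proof (rule eq)
      fix \<xi> :: "'g \<Rightarrow> complex" assume \<xi>: "character \<xi>"
      then have "\<xi> (\<sigma> s + \<sigma> t) = \<xi> (\<sigma> s) * \<xi> (\<sigma> t)" by (simp add: character_def)
      then show "\<xi> (\<sigma> (s + t)) = \<xi> (\<sigma> s + \<sigma> t)" by (simp add: \<sigma>[OF \<xi>] cis_mult distrib_right)
    qed
    have "\<xi>1 (\<sigma> pi) \<noteq> \<xi>1 0" using \<sigma>[OF \<xi>1(1), of pi] L(2) character_0[OF \<xi>1(1)] by simp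
    then show "\<exists>t. \<sigma> t \<noteq> 0" by metis
    show "continuous_on UNIV \<sigma>"
      unfolding continuous_on_sequentially
    proof safe
      fix u :: "nat \<Rightarrow> real" and t assume u: "u \<longlonglongrightarrow> t"
      have "(\<lambda>n. M (\<sigma> (u n) - \<sigma> t)) \<longlonglongrightarrow> 0"
      proof (rule tendsto_0_subseq)
        fix q :: "nat \<Rightarrow> nat" assume q: "strict_mono q"
        obtain l r where r: "strict_mono r" "(\<lambda>n. \<sigma> (u (q (r n)))) \<longlonglongrightarrow> l" by (rule convergent_subsequence)
        have "l = \<sigma> t"
        proof (rule eq)
          fix \<xi> :: "'g \<Rightarrow> complex" assume \<xi>: "character \<xi>"
          have "(\<lambda>n. \<xi> (\<sigma> (u (q (r n))))) \<longlonglongrightarrow> \<xi> l" using \<xi> continuous_on_tendsto_compose[OF _ r(2), of UNIV \<xi>] by (auto simp: character_def)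
          moreover have "(\<lambda>n. u (q (r n))) \<longlonglongrightarrow> t" using LIMSEQ_subseq_LIMSEQ[OF LIMSEQ_subseq_LIMSEQ[OF u q] r(1)] by (simp add: comp_def)
          then have "(\<lambda>n. cis (u (q (r n)) * L \<xi>)) \<longlonglongrightarrow> cis (t * L \<xi>)"
            unfolding cis_conv_exp by (intro tendsto_intros)
          ultimately show "\<xi> l = \<xi> (\<sigma> t)" unfolding \<sigma>[OF \<xi>] by (rule LIMSEQ_unique)
        qed
        then have "(\<lambda>n. M (\<sigma> (u (q (r n))) - \<sigma> t)) \<longlonglongrightarrow> 0" using r(2) by (simp add: tendsto_diff_iff)
        then show "\<exists>p. strict_mono p \<and> ((\<lambda>n. M (\<sigma> (u n) - \<sigma> t)) \<circ> q \<circ> p) \<longlonglongrightarrow> 0" using r(1) by (auto simp: comp_def)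
      qed
      then show "(\<sigma> \<circ> u) \<longlonglongrightarrow> \<sigma> t" by (simp add: tendsto_diff_iff comp_def)
    qed
  qed
qed

subsection \<open>The reduction induced by a homomorphism\<close>

lemma (in group_norm) non_archimedeanD:
  assumes "non_archimedean K" "0 \<in> K" "\<rho> > 0"
  obtains V \<alpha> where "is_subgroup V" "V \<subseteq> K" "\<alpha> > 0" "\<And>y. y \<in> V \<Longrightarrow> N y < \<rho>" "\<And>y. y \<in> K \<Longrightarrow> N y < \<alpha> \<Longrightarrow> y \<in> V"
proof -
  define W where "W = K \<inter> {y. N (y - 0) < \<rho>}"
  have "openin (top_of_set K) W" unfolding W_def by (intro openin_open_Int open_ball)
  moreover have "0 \<in> W" using assms by (simp add: W_def)
  ultimately obtain U V where V: "openin (top_of_set K) U" "is_subgroup V" "0 \<in> U" "U \<subseteq> V" "V \<subseteq> W"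
    using assms(1) unfolding non_archimedean_def neighbourhood_base_at_def by metis
  obtain O' where O': "open O'" "U = K \<inter> O'" using V(1) by (auto simp: openin_open)
  obtain \<alpha> where \<alpha>: "\<alpha> > 0" "{y. N (y - 0) < \<alpha>} \<subseteq> O'" using ball_in_open[OF O'(1), of 0] V(3) O'(2) by blast
  show ?thesis
  proof (rule that[OF V(2) _ \<alpha>(1)])
    show "V \<subseteq> K" using V(5) by (auto simp: W_def)
    show "N y < \<rho>" if "y \<in> V" for y using that V(5) by (auto simp: W_def)
    show "y \<in> V" if "y \<in> K" "N y < \<alpha>" for y using that \<alpha>(2) O'(2) V(4) by auto
  qed
qed

text \<open>Merges countably many null sequences into one. The bound (1/2)^i, uniform in n, disposes
  of all large i, so for each e only finitely many pairs can violate it.\<close>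

lemma tendsto_prod_decode:
  fixes a :: "nat \<Rightarrow> nat \<Rightarrow> real"
  assumes bd: "\<And>n i. \<bar>a n i\<bar> \<le> (1/2)^i" and lim: "\<And>i. (\<lambda>n. a n i) \<longlonglongrightarrow> 0"
  shows "(\<lambda>k. a (fst (prod_decode k)) (snd (prod_decode k))) \<longlonglongrightarrow> 0"
proof (rule LIMSEQ_I)
  fix e :: real assume e: "e > 0"
  obtain I where I: "(1/2::real)^I < e" using real_arch_pow_inv[OF e, of "1/2"] by auto
  have "\<exists>m. \<forall>n\<ge>m. \<bar>a n i\<bar> < e" for i using LIMSEQ_D[OF lim e, of i] by auto
  then obtain m where m: "\<And>i n. n \<ge> m i \<Longrightarrow> \<bar>a n i\<bar> < e" by metis
  have "finite (prod_encode ` (\<Union>i<I. {..<m i} \<times> {i}))" by auto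
  then obtain k0 where k0: "prod_encode ` (\<Union>i<I. {..<m i} \<times> {i}) \<subseteq> {..<k0}" using finite_nat_bounded by blast
  have "\<bar>a (fst (prod_decode k)) (snd (prod_decode k))\<bar> < e" if "k \<ge> k0" for k
  proof -
    obtain n i where ni: "prod_decode k = (n, i)" by fastforce
    then have k: "k = prod_encode (n, i)" by (metis prod_decode_inverse)
    have "\<not> (i < I \<and> n < m i)"
    proof
      assume "i < I \<and> n < m i"
      then have "k \<in> prod_encode ` (\<Union>i<I. {..<m i} \<times> {i})" unfolding k by (intro imageI) auto
      then have "k < k0" using k0 by blast
      then show False using that by simp
    qed
    then consider "i \<ge> I" | "n \<ge> m i" by linarith
    then show ?thesis
    proof cases
      case 1
      then have "(1/2::real)^i \<le> (1/2)^I" by (intro power_decreasing) auto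
      then have "\<bar>a n i\<bar> < e" using bd[of n i] I by linarith
      then show ?thesis using ni by simp
    next
      case 2 then show ?thesis using m ni by simp
    qed
  qed
  then show "\<exists>no. \<forall>n\<ge>no. norm (a (fst (prod_decode n)) (snd (prod_decode n)) - 0) < e" by auto
qed

text \<open>Let a be a cluster point of z. Since S (z n) converges, z n is eventually close to the
  coset a + K. Small steps cannot lead away from the part a + V once z is near it, because V
  contains all elements of K smaller than \<alpha>0.\<close>

lemma (in compact_ab_group) convergent_mod_kernel:
  fixes S :: "'g \<Rightarrow> 'h::{topological_ab_group_add, polish_space}"
  assumes S: "continuous_on UNIV S" "Modules.additive S" "non_archimedean (kernel_of S)"
    and Sz: "convergent (\<lambda>n. S (z n))" and step: "(\<lambda>n. z (Suc n) - z n) \<longlonglongrightarrow> 0"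
  shows "convergent z"
proof -
  interpret Modules.additive S by fact
  obtain L where L: "(\<lambda>n. S (z n)) \<longlonglongrightarrow> L" using Sz by (auto simp: convergent_def)
  obtain a r where r: "strict_mono r" "(\<lambda>n. z (r n)) \<longlonglongrightarrow> a" by (rule convergent_subsequence)
  have S_lim: "(\<lambda>n. S (u n)) \<longlonglongrightarrow> S b" if "u \<longlonglongrightarrow> b" for u :: "nat \<Rightarrow> 'g" and b using continuous_on_tendsto_compose[OF S(1) that] by simp
  have "S a = L" using S_lim[OF r(2)] LIMSEQ_subseq_LIMSEQ[OF L r(1)] by (auto simp: comp_def intro: LIMSEQ_unique)
  define K where "K = kernel_of S"
  have K: "0 \<in> K" "y \<in> K \<longleftrightarrow> S y = 0" for y by (auto simp: K_def kernel_of_def zero)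
  have close: "\<forall>\<^sub>F n in sequentially. \<exists>k\<in>K. M (z n - a - k) < \<alpha>" if \<alpha>: "\<alpha> > 0" for \<alpha>
  proof (rule ccontr)
    assume "\<not> ?thesis"
    then have "\<forall>m. \<exists>n\<ge>m. \<not> (\<exists>k\<in>K. M (z n - a - k) < \<alpha>)" by (simp add: eventually_sequentially)
    then have "infinite {n. \<not> (\<exists>k\<in>K. M (z n - a - k) < \<alpha>)}" unfolding infinite_nat_iff_unbounded_le by simp
    then obtain q :: "nat \<Rightarrow> nat" where q: "strict_mono q" "\<And>n. q n \<in> {n. \<not> (\<exists>k\<in>K. M (z n - a - k) < \<alpha>)}" using infinite_enumerate by blast
    obtain b p where p: "strict_mono p" "(\<lambda>n. z (q (p n))) \<longlonglongrightarrow> b" by (rule convergent_subsequence)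
    have "S b = L" using S_lim[OF p(2)] LIMSEQ_subseq_LIMSEQ[OF LIMSEQ_subseq_LIMSEQ[OF L q(1)] p(1)] by (auto simp: comp_def intro: LIMSEQ_unique)
    then have bK: "b - a \<in> K" using \<open>S a = L\<close> by (simp add: K(2) diff)
    have "(\<lambda>n. M (z (q (p n)) - b)) \<longlonglongrightarrow> 0" using p(2) by (simp add: tendsto_diff_iff)
    then have "\<forall>\<^sub>F n in sequentially. M (z (q (p n)) - b) < \<alpha>" using \<alpha> by (rule order_tendstoD(2))
    then obtain n where "M (z (q (p n)) - b) < \<alpha>" by (auto simp: eventually_sequentially)
    then have "M (z (q (p n)) - a - (b - a)) < \<alpha>" by simp
    then show False using q(2)[of "p n"] bK by blast
  qed
  have "(\<lambda>n. M (z n - a)) \<longlonglongrightarrow> 0"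
  proof (rule LIMSEQ_I)
    fix e :: real assume "e > 0"
    then obtain V \<alpha>0 where V: "is_subgroup V" "V \<subseteq> K" "\<alpha>0 > 0" "\<And>y. y \<in> V \<Longrightarrow> M y < e / 2" "\<And>y. y \<in> K \<Longrightarrow> M y < \<alpha>0 \<Longrightarrow> y \<in> V"
      using non_archimedeanD[OF S(3)[folded K_def] K(1), of "e/2"] by (metis half_gt_zero)
    \<comment> \<open>Comparing the kernel approximations of two consecutive terms costs \<alpha>
      three times: at both terms and for the step between them.\<close>
    define \<alpha> where "\<alpha> = min (\<alpha>0 / 3) (e / 2)"
    have \<alpha>: "\<alpha> > 0" "3 * \<alpha> \<le> \<alpha>0" "\<alpha> \<le> e / 2" using V(3) \<open>e > 0\<close> by (auto simp: \<alpha>_def)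
    have "(\<lambda>n. M (z (Suc n) - z n)) \<longlonglongrightarrow> 0" using step by (simp add: tendsto_iff)
    then have "\<forall>\<^sub>F n in sequentially. M (z (Suc n) - z n) < \<alpha>" using \<alpha>(1) by (rule order_tendstoD(2))
    from eventually_conj[OF this close[OF \<alpha>(1)]] obtain n1 where
      n1: "\<And>n. n \<ge> n1 \<Longrightarrow> M (z (Suc n) - z n) < \<alpha>" "\<And>n. n \<ge> n1 \<Longrightarrow> \<exists>k\<in>K. M (z n - a - k) < \<alpha>"
      by (auto simp: eventually_sequentially)
    have "(\<lambda>n. M (z (r n) - a)) \<longlonglongrightarrow> 0" using r(2) by (simp add: tendsto_diff_iff)
    then have "\<forall>\<^sub>F n in sequentially. M (z (r n) - a) < \<alpha>" using \<alpha>(1) by (rule order_tendstoD(2))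
    then obtain n2 where n2: "\<And>n. n \<ge> n2 \<Longrightarrow> M (z (r n) - a) < \<alpha>" by (auto simp: eventually_sequentially)
    \<comment> \<open>An index of the subsequence, where z is close to a itself; the induction can
      start with k = 0 in V.\<close>
    define n0 where "n0 = r (max n1 n2)"
    have n0: "n0 \<ge> n1" "M (z n0 - a) < \<alpha>" using seq_suble[OF r(1), of "max n1 n2"] n2[of "max n1 n2"] by (auto simp: n0_def)
    have near: "\<exists>k\<in>V. M (z n - a - k) < \<alpha>" if "n \<ge> n0" for n
      using that
    proof (induction n rule: dec_induct)
      case base
      show ?case using n0(2) V(1) by (intro bexI[of _ 0]) (auto simp: is_subgroup_def)
    next
      case (step n)
      then obtain k where k: "k \<in> V" "M (z n - a - k) < \<alpha>" by blast
      obtain k' where k': "k' \<in> K" "M (z (Suc n) - a - k') < \<alpha>" using n1(2)[of "Suc n"] step n0 by auto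
      have e: "k' - k = (z (Suc n) - z n) - (z (Suc n) - a - k') + (z n - a - k)" by (simp add: algebra_simps)
      have "M (k' - k) < 3 * \<alpha>" unfolding e
        using triangle[of "(z (Suc n) - z n) - (z (Suc n) - a - k')" "z n - a - k"] diff_le[of "z (Suc n) - z n" "z (Suc n) - a - k'"]
          k(2) k'(2) n1(1)[of n] step(1) n0(1) by linarith
      moreover have "k' - k \<in> K"
        using k(1) k'(1) V(2) by (auto simp: K(2) diff)
      ultimately have "k' - k \<in> V" using \<alpha>(2) V(5) by auto
      then have "k' \<in> V" using k(1) V(1) unfolding is_subgroup_def by (metis diff_add_cancel)
      then show ?case using k'(2) by blast
    qed
    have "M (z n - a) < e" if n: "n \<ge> n0" for n
    proof -
      obtain k where k: "k \<in> V" "M (z n - a - k) < \<alpha>" using near[OF n] by blast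
      show ?thesis using triangle[of "z n - a - k" k] k(2) V(4)[OF k(1)] \<alpha>(3) by simp
    qed
    then show "\<exists>no. \<forall>n\<ge>no. norm (M (z n - a) - 0) < e" by auto
  qed
  then show ?thesis by (auto simp: convergent_def tendsto_diff_iff)
qed

text \<open>Even terms of the image transmit S (x n). Odd terms repeat S (x n) and add a point of
  the path whose parameter codes increments of x, so subtracting neighbouring terms isolates the
  code. The trivial group is treated apart, since it has no nonzero one-parameter subgroup.\<close>

theorem homomorphism_imp_reduction:
  fixes S :: "'g::{topological_ab_group_add, polish_space} \<Rightarrow> 'h::{topological_ab_group_add, polish_space}"
  assumes comp: "compact (UNIV :: 'g set)" and conn: "connected (UNIV :: 'g set)"
    and lcH: "locally_compact_space (euclidean :: 'h topology)"
    and S: "continuous_on UNIV S" "Modules.additive S" "non_archimedean (kernel_of S)"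
  shows "(E_grp :: (nat \<Rightarrow> 'g) \<Rightarrow> (nat \<Rightarrow> 'g) \<Rightarrow> bool) \<le>\<^sub>B (E_grp :: (nat \<Rightarrow> 'h) \<Rightarrow> (nat \<Rightarrow> 'h) \<Rightarrow> bool)"
proof (cases "\<forall>x::'g. x = 0")
  case True
  have "E_grp x y" for x y :: "nat \<Rightarrow> 'g"
  proof -
    have "x n - y n = 0" for n using True by blast
    then show ?thesis by (simp add: E_grp_def convergent_const)
  qed
  moreover have "E_grp (\<lambda>_. 0 :: 'h) (\<lambda>_. 0)" by (simp add: E_grp_def convergent_const)
  ultimately show ?thesis unfolding borel_reducible_def by (intro exI[of _ "\<lambda>_ _. 0"]) simp
next
  case False
  then obtain x0 :: 'g where x0: "x0 \<noteq> 0" by blast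
  interpret S: Modules.additive S by (rule S(2))
  have lcG: "locally_compact_space (euclidean :: 'g topology)"
    unfolding locally_compact_space_def using comp by (auto intro!: exI[of _ UNIV])
  obtain M :: "'g \<Rightarrow> real" where M: "group_norm M" using group_norm_exists[OF lcG] .
  obtain N :: "'h \<Rightarrow> real" where "group_norm N" using group_norm_exists[OF lcH] .
  then interpret N: group_norm N .
  interpret compact_ab_group M by (intro compact_ab_group.intro compact_ab_group_axioms.intro M comp)
  have K0: "0 \<in> kernel_of S" by (simp add: kernel_of_def S.zero)
  obtain \<sigma> :: "real \<Rightarrow> 'g" where \<sigma>: "continuous_on UNIV \<sigma>" "\<And>s t. \<sigma> (s + t) = \<sigma> s + \<sigma> t" "\<exists>t. \<sigma> t \<noteq> 0"
    using one_parameter_subgroup[OF conn x0] by blast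
  define \<tau> where "\<tau> t = S (\<sigma> t)" for t
  have \<tau>_add: "\<tau> (s + t) = \<tau> s + \<tau> t" for s t by (simp add: \<tau>_def \<sigma>(2) S.add)
  have \<sigma>_0: "\<sigma> 0 = 0" using \<sigma>(2)[of 0 0] by simp
  have \<tau>_0: "\<tau> 0 = 0" using \<tau>_add[of 0 0] by simp
  have \<tau>_diff: "\<tau> (s - t) = \<tau> s - \<tau> t" for s t using \<tau>_add[of "s - t" t] by simp
  have \<tau>_cont: "continuous_on UNIV \<tau>" unfolding \<tau>_def[abs_def] by (rule continuous_on_compose2[OF S(1) \<sigma>(1)]) simp
  have \<tau>_lim: "(\<lambda>n. \<tau> (u n)) \<longlonglongrightarrow> \<tau> t" if "u \<longlonglongrightarrow> t" for u :: "nat \<Rightarrow> real" and t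
    using continuous_on_tendsto_compose[OF \<tau>_cont that] by simp
  \<comment> \<open>If S vanished along \<sigma>, a small open subgroup V of the kernel would
    contain \<sigma> (t0 / n) for some n and hence its multiple \<sigma> t0, which is too large for
    V.\<close>
  have "\<exists>t. \<tau> t \<noteq> 0"
  proof (rule ccontr)
    assume "\<not> ?thesis"
    then have ker: "\<sigma> t \<in> kernel_of S" for t by (simp add: \<tau>_def kernel_of_def)
    obtain t0 where t0: "\<sigma> t0 \<noteq> 0" using \<sigma>(3) by blast
    then have "M (\<sigma> t0) > 0" using nonneg[of "\<sigma> t0"] eq_zero_iff[of "\<sigma> t0"] by linarith
    then obtain V \<alpha> where V: "is_subgroup V" "\<alpha> > 0" "\<And>y. y \<in> V \<Longrightarrow> M y < M (\<sigma> t0)" "\<And>y. y \<in> kernel_of S \<Longrightarrow> M y < \<alpha> \<Longrightarrow> y \<in> V"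
      using non_archimedeanD[OF S(3) K0] by metis
    have "(\<lambda>n. t0 * inverse (real (Suc n))) \<longlonglongrightarrow> t0 * 0" by (intro tendsto_intros LIMSEQ_inverse_real_of_nat)
    then have "(\<lambda>n. \<sigma> (t0 * inverse (real (Suc n)))) \<longlonglongrightarrow> 0" using continuous_on_tendsto_compose[OF \<sigma>(1)] \<sigma>_0 by fastforce
    then have "(\<lambda>n. M (\<sigma> (t0 * inverse (real (Suc n))))) \<longlonglongrightarrow> 0" by (simp only: tendsto_iff)
    then have "\<forall>\<^sub>F n in sequentially. M (\<sigma> (t0 * inverse (real (Suc n)))) < \<alpha>" using V(2) by (rule order_tendstoD(2))
    then obtain n where "M (\<sigma> (t0 * inverse (real (Suc n)))) < \<alpha>" by (auto simp: eventually_sequentially)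
    then have s: "\<sigma> (t0 * inverse (real (Suc n))) \<in> V" using V(4) ker by blast
    have "\<sigma> (real k * (t0 * inverse (real (Suc n)))) \<in> V" for k
    proof (induction k)
      case 0 then show ?case using V(1) \<sigma>_0 by (simp add: is_subgroup_def)
    next
      case (Suc k)
      have "real (Suc k) * (t0 * inverse (real (Suc n))) = real k * (t0 * inverse (real (Suc n))) + t0 * inverse (real (Suc n))"
        by (simp add: algebra_simps)
      then show ?case using Suc s V(1) unfolding is_subgroup_def by (metis \<sigma>(2))
    qed
    moreover have "real (Suc n) * (t0 * inverse (real (Suc n))) = t0" by (simp del: of_nat_Suc)
    ultimately have "\<sigma> t0 \<in> V" by metis
    then show False using V(3) by blast
  qed
  then obtain t1 where t1: "\<tau> t1 \<noteq> 0" by blast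
  have "\<tau> \<bar>t1\<bar> \<noteq> 0" using t1 \<tau>_diff[of 0 t1] \<tau>_0 by (auto simp: abs_if)
  \<comment> \<open>Zeros of \<tau> arbitrarily close to 0 have multiples arbitrarily close to |t1|,
    which would force \<tau> to vanish there.\<close>
  have "\<exists>c>0. \<forall>t. 0 < t \<longrightarrow> t \<le> c \<longrightarrow> \<tau> t \<noteq> 0"
  proof (rule ccontr)
    assume neg: "\<not> ?thesis"
    have "\<exists>t. 0 < t \<and> t \<le> inverse (real (Suc n)) \<and> \<tau> t = 0" for n
      using neg by (metis inverse_positive_iff_positive of_nat_0_less_iff zero_less_Suc)
    then obtain u where u: "\<And>n. 0 < u n" "\<And>n. u n \<le> inverse (real (Suc n))" "\<And>n. \<tau> (u n) = 0" by metis
    have mult: "\<tau> (real k * t) = 0" if "\<tau> t = 0" for k t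
      by (induction k) (simp_all add: \<tau>_0 \<tau>_add distrib_right that)
    define v where "v n = real (nat \<lfloor>\<bar>t1\<bar> / u n\<rfloor>) * u n" for n
    have v: "\<bar>v n - \<bar>t1\<bar>\<bar> \<le> inverse (real (Suc n))" for n
    proof -
      have fl: "real (nat \<lfloor>\<bar>t1\<bar> / u n\<rfloor>) = real_of_int \<lfloor>\<bar>t1\<bar> / u n\<rfloor>" using u(1)[of n] by (simp add: of_nat_nat)
      have "real_of_int \<lfloor>\<bar>t1\<bar> / u n\<rfloor> * u n \<le> \<bar>t1\<bar>" using of_int_floor_le[of "\<bar>t1\<bar> / u n"] unfolding pos_le_divide_eq[OF u(1)] .
      moreover have "\<bar>t1\<bar> < (real_of_int \<lfloor>\<bar>t1\<bar> / u n\<rfloor> + 1) * u n" using floor_correct[of "\<bar>t1\<bar> / u n"] unfolding pos_divide_less_eq[OF u(1)] by simp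
      ultimately have "\<bar>v n - \<bar>t1\<bar>\<bar> \<le> u n" unfolding v_def fl by (simp add: distrib_right abs_le_iff)
      then show ?thesis using u(2)[of n] by linarith
    qed
    have "(\<lambda>n. v n - \<bar>t1\<bar>) \<longlonglongrightarrow> 0"
      by (rule Lim_null_comparison[OF _ LIMSEQ_inverse_real_of_nat]) (use v in auto)
    then have "(\<lambda>n. \<tau> (v n)) \<longlonglongrightarrow> \<tau> \<bar>t1\<bar>" by (intro \<tau>_lim) (simp add: LIM_zero_iff)
    moreover have "\<tau> (v n) = 0" for n unfolding v_def by (rule mult[OF u(3)])
    ultimately show False using \<open>\<tau> \<bar>t1\<bar> \<noteq> 0\<close> by (simp add: LIMSEQ_const_iff)
  qed
  then obtain c where c: "c > 0" "\<And>t. 0 < t \<Longrightarrow> t \<le> c \<Longrightarrow> \<tau> t \<noteq> 0" by blast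
  \<comment> \<open>Parameters lie in [0, 1] and their differences in [-1, 1], where \<tau> (c * t)
    vanishes only at t = 0; compactness of that interval yields the convergence.\<close>
  have \<tau>_inj: "u \<longlonglongrightarrow> 0" if bd: "\<And>n. \<bar>u n\<bar> \<le> 1" and lim: "(\<lambda>n. \<tau> (c * u n)) \<longlonglongrightarrow> 0" for u :: "nat \<Rightarrow> real"
  proof (rule tendsto_0_subseq)
    fix q :: "nat \<Rightarrow> nat" assume q: "strict_mono q"
    have "\<forall>n. (u \<circ> q) n \<in> {-1..1}" using bd by (auto simp: abs_le_iff)
    then obtain l p where p: "l \<in> {-1..1}" "strict_mono p" "((u \<circ> q) \<circ> p) \<longlonglongrightarrow> l"
      by (rule seq_compactE[OF compact_imp_seq_compact[OF compact_Icc]])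
    have "(\<lambda>n. \<tau> (c * u (q (p n)))) \<longlonglongrightarrow> \<tau> (c * l)"
      using p(3) by (intro \<tau>_lim tendsto_intros) (simp add: comp_def)
    moreover have "(\<lambda>n. \<tau> (c * u (q (p n)))) \<longlonglongrightarrow> 0" using LIMSEQ_subseq_LIMSEQ[OF LIMSEQ_subseq_LIMSEQ[OF lim q] p(2)] by (simp add: comp_def)
    ultimately have z: "\<tau> (c * l) = 0" by (rule LIMSEQ_unique)
    have "l = 0"
    proof (rule ccontr)
      assume "l \<noteq> 0"
      then consider "l > 0" | "l < 0" by linarith
      then show False
      proof cases
        case 1
        then show False using c(2)[of "c * l"] z p(1) c(1) by auto
      next
        case 2
        have "\<tau> (c * (- l)) = 0" using \<tau>_diff[of 0 "c * l"] z \<tau>_0 by simp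
        moreover have "0 < c * (- l)" using 2 c(1) by (simp add: mult_pos_neg)
        moreover have "c * (- l) \<le> c" using p(1) c(1) mult_left_mono[of "- l" 1 c] by simp
        ultimately show False using c(2) by blast
      qed
    qed
    then show "\<exists>p. strict_mono p \<and> (u \<circ> q \<circ> p) \<longlonglongrightarrow> 0" using p by blast
  qed
  obtain d :: "nat \<Rightarrow> 'g" where d: "closure (range d) = UNIV" by (rule countable_dense_subgroup) (rule that)
  obtain B where B: "\<And>x y :: 'g. dist x y \<le> B" using compact_imp_bounded[OF comp] unfolding bounded_two_points by blast
  define B' where "B' = max B 1"
  have B': "B' > 0" "\<And>x y :: 'g. dist x y \<le> B'" using B by (auto simp: B'_def le_max_iff_disj)
  \<comment> \<open>Scaled distances to a dense sequence embed the compact group into a Hilbert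
    cube. The factor (1/2)^i supplies the uniform bound of
    \<open>tendsto_prod_decode\<close>.\<close>
  define v where "v i g = (1/2)^i * (dist g (d i) / B')" for i g
  have v01: "0 \<le> v i g" "v i g \<le> (1/2)^i" for i g
  proof -
    have "dist g (d i) / B' \<le> 1" using B' by simp
    then show "v i g \<le> (1/2)^i" unfolding v_def by (intro mult_left_le) auto
    show "0 \<le> v i g" using B' by (simp add: v_def)
  qed
  have v_cont: "continuous_on UNIV (v i)" for i unfolding v_def[abs_def] using B' by (intro continuous_intros) auto
  define w where "w x n = x (Suc n) - x n" for x :: "nat \<Rightarrow> 'g" and n
  \<comment> \<open>One index k runs through all pairs (n, i), so each odd term of the image carries
    one coordinate of one increment.\<close>
  define \<delta> where "\<delta> x k = v (snd (prod_decode k)) (w x (fst (prod_decode k)))" for x k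
  define \<theta> where "\<theta> x m = (if even m then S (x (m div 2)) else S (x (m div 2)) + \<tau> (c * \<delta> x (m div 2)))" for x m
  have "continuous_on UNIV \<theta>"
  proof (rule continuous_on_coordinatewise_then_product)
    fix m
    have 1: "continuous_on UNIV (\<lambda>x. S (x k))" for k by (rule continuous_on_compose2[OF S(1)]) (auto intro: continuous_on_product_coordinates)
    have "continuous_on UNIV (\<lambda>x. w x n)" for n unfolding w_def by (intro continuous_intros continuous_on_product_coordinates)
    then have "continuous_on UNIV (\<lambda>x. \<delta> x k)" for k unfolding \<delta>_def by (intro continuous_on_compose2[OF v_cont]) auto
    then have "continuous_on UNIV (\<lambda>x. \<tau> (c * \<delta> x k))" for k by (intro continuous_on_compose2[OF \<tau>_cont] continuous_intros) auto
    then show "continuous_on UNIV (\<lambda>x. \<theta> x m)" using 1 by (cases "even m") (auto simp: \<theta>_def intro!: continuous_intros)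
  qed
  then have meas: "\<theta> \<in> borel_measurable borel" by (rule borel_measurable_continuous_onI)
  have half: "filterlim (\<lambda>m::nat. m div 2) at_top sequentially"
    unfolding filterlim_at_top eventually_sequentially by (metis div_le_mono nonzero_mult_div_cancel_left zero_neq_numeral)
  have "E_grp x y \<longleftrightarrow> E_grp (\<theta> x) (\<theta> y)" for x y
  proof -
    define z where "z n = x n - y n" for n
    define \<epsilon> where "\<epsilon> k = \<delta> x k - \<delta> y k" for k
    have \<theta>_even: "\<theta> x (2 * k) - \<theta> y (2 * k) = S (z k)" for k by (simp add: \<theta>_def z_def S.diff)
    have \<theta>_odd: "\<theta> x (2 * k + 1) - \<theta> y (2 * k + 1) = S (z k) + \<tau> (c * \<epsilon> k)" for k
    proof -
      have "\<tau> (c * \<epsilon> k) = \<tau> (c * \<delta> x k) - \<tau> (c * \<delta> y k)" unfolding \<epsilon>_def right_diff_distrib \<tau>_diff ..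
      then show ?thesis by (simp add: \<theta>_def z_def S.diff algebra_simps)
    qed
    have wz: "w x n - w y n = z (Suc n) - z n" for n by (simp add: w_def z_def algebra_simps)
    have vd: "\<bar>v i g - v i g'\<bar> \<le> (1/2)^i" for i g g' using v01[of i g] v01[of i g'] by (simp add: abs_le_iff)
    show ?thesis
    proof
      assume "E_grp x y"
      then obtain l where l: "z \<longlonglongrightarrow> l" by (auto simp: E_grp_def convergent_def z_def[abs_def])
      have "(\<lambda>n. z (Suc n) - z n) \<longlonglongrightarrow> l - l" by (intro tendsto_diff l LIMSEQ_Suc)
      then have w0: "(\<lambda>n. M (w x n - w y n)) \<longlonglongrightarrow> 0" by (simp add: wz tendsto_iff)
      have "(\<lambda>n. v i (w x n) - v i (w y n)) \<longlonglongrightarrow> 0" for i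
      proof (rule LIMSEQ_I)
        fix e :: real assume "e > 0"
        then obtain r where r: "r > 0" "\<And>g u. M u < r \<Longrightarrow> dist (v i (g + u)) (v i g) < e" using uniform_small[OF v_cont] by blast
        have "\<forall>\<^sub>F n in sequentially. M (w x n - w y n) < r" using w0 r(1) by (rule order_tendstoD(2))
        then obtain n0 where n0: "\<And>n. n \<ge> n0 \<Longrightarrow> M (w x n - w y n) < r" by (auto simp: eventually_sequentially)
        have "norm (v i (w x n) - v i (w y n) - 0) < e" if "n \<ge> n0" for n
          using r(2)[OF n0[OF that], of "w y n"] by (simp add: dist_norm)
        then show "\<exists>no. \<forall>n\<ge>no. norm (v i (w x n) - v i (w y n) - 0) < e" by blast
      qed
      then have "\<epsilon> \<longlonglongrightarrow> 0" unfolding \<epsilon>_def[abs_def] \<delta>_def by (rule tendsto_prod_decode[OF vd])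
      then have "(\<lambda>k. c * \<epsilon> k) \<longlonglongrightarrow> c * 0" by (intro tendsto_intros)
      from \<tau>_lim[OF this] have "(\<lambda>k. \<tau> (c * \<epsilon> k)) \<longlonglongrightarrow> 0" by (simp add: \<tau>_0)
      then have a: "(\<lambda>m. N (\<tau> (c * \<epsilon> (m div 2)))) \<longlonglongrightarrow> 0" using filterlim_compose[OF _ half] unfolding N.tendsto_iff[symmetric] by fast
      have "(\<lambda>k. S (z k)) \<longlonglongrightarrow> S l" using continuous_on_tendsto_compose[OF S(1) l] by simp
      then have b: "(\<lambda>m. N (S (z (m div 2)) - S l)) \<longlonglongrightarrow> 0" using filterlim_compose[OF _ half] unfolding N.tendsto_diff_iff by fast
      have "(\<lambda>m. N ((\<theta> x m - \<theta> y m) - S l)) \<longlonglongrightarrow> 0"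
      proof (rule Lim_null_comparison)
        show "(\<lambda>m. N (S (z (m div 2)) - S l) + N (\<tau> (c * \<epsilon> (m div 2)))) \<longlonglongrightarrow> 0" using tendsto_add[OF b a] by simp
        have "N ((\<theta> x m - \<theta> y m) - S l) \<le> N (S (z (m div 2)) - S l) + N (\<tau> (c * \<epsilon> (m div 2)))" for m
        proof (cases "even m")
          case True
          then have "\<theta> x m - \<theta> y m = S (z (m div 2))" using \<theta>_even[of "m div 2"] by simp
          then show ?thesis by simp
        next
          case False
          then have "\<theta> x m - \<theta> y m = S (z (m div 2)) + \<tau> (c * \<epsilon> (m div 2))" using \<theta>_odd[of "m div 2"] by simp
          then show ?thesis using N.triangle[of "S (z (m div 2)) - S l" "\<tau> (c * \<epsilon> (m div 2))"] by (simp add: algebra_simps)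
        qed
        then show "\<forall>\<^sub>F m in sequentially. norm (N ((\<theta> x m - \<theta> y m) - S l)) \<le> N (S (z (m div 2)) - S l) + N (\<tau> (c * \<epsilon> (m div 2)))" by simp
      qed
      then show "E_grp (\<theta> x) (\<theta> y)" unfolding E_grp_def convergent_def N.tendsto_diff_iff[symmetric] by blast
    next
      assume "E_grp (\<theta> x) (\<theta> y)"
      then obtain l where l: "(\<lambda>m. \<theta> x m - \<theta> y m) \<longlonglongrightarrow> l" by (auto simp: E_grp_def convergent_def)
      have "strict_mono (\<lambda>k::nat. 2 * k)" "strict_mono (\<lambda>k::nat. 2 * k + 1)" by (auto simp: strict_mono_def)
      from LIMSEQ_subseq_LIMSEQ[OF l this(1)] LIMSEQ_subseq_LIMSEQ[OF l this(2)]
      have e: "(\<lambda>k. S (z k)) \<longlonglongrightarrow> l" and o: "(\<lambda>k. S (z k) + \<tau> (c * \<epsilon> k)) \<longlonglongrightarrow> l"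
        unfolding comp_def \<theta>_even \<theta>_odd by auto
      from tendsto_diff[OF o e] have "(\<lambda>k. \<tau> (c * \<epsilon> k)) \<longlonglongrightarrow> 0" by simp
      moreover have "\<bar>\<epsilon> k\<bar> \<le> 1" for k
      proof -
        have "(1/2::real)^i \<le> 1" for i by (rule power_le_one) auto
        then show ?thesis unfolding \<epsilon>_def \<delta>_def using vd order_trans by blast
      qed
      ultimately have \<epsilon>0: "\<epsilon> \<longlonglongrightarrow> 0" by (intro \<tau>_inj)
      have vlim: "(\<lambda>n. v i (w x n) - v i (w y n)) \<longlonglongrightarrow> 0" for i
      proof -
        have "filterlim (\<lambda>n. prod_encode (n, i)) at_top sequentially"
          unfolding filterlim_at_top eventually_sequentially by (meson le_prod_encode_1 order_trans)
        from filterlim_compose[OF \<epsilon>0 this] show ?thesis by (simp add: \<epsilon>_def \<delta>_def)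
      qed
      have "(\<lambda>n. M (w x n - w y n)) \<longlonglongrightarrow> 0"
      proof (rule tendsto_0_subseq)
        fix q :: "nat \<Rightarrow> nat" assume q: "strict_mono q"
        obtain a r where r: "strict_mono r" "(\<lambda>n. w x (q (r n))) \<longlonglongrightarrow> a" by (rule convergent_subsequence)
        obtain b s where s: "strict_mono s" "(\<lambda>n. w y (q (r (s n)))) \<longlonglongrightarrow> b" by (rule convergent_subsequence)
        have a: "(\<lambda>n. w x (q (r (s n)))) \<longlonglongrightarrow> a" using LIMSEQ_subseq_LIMSEQ[OF r(2) s(1)] by (simp add: comp_def)
        have "v i a = v i b" for i
        proof -
          have "(\<lambda>n. v i (w x (q (r (s n)))) - v i (w y (q (r (s n))))) \<longlonglongrightarrow> v i a - v i b"
            using continuous_on_tendsto_compose[OF v_cont a] continuous_on_tendsto_compose[OF v_cont s(2)] by (intro tendsto_diff) auto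
          moreover have "(\<lambda>n. v i (w x (q (r (s n)))) - v i (w y (q (r (s n))))) \<longlonglongrightarrow> 0"
            using LIMSEQ_subseq_LIMSEQ[OF LIMSEQ_subseq_LIMSEQ[OF LIMSEQ_subseq_LIMSEQ[OF vlim q] r(1)] s(1)] by (simp add: comp_def)
          ultimately have "v i a - v i b = 0" by (rule LIMSEQ_unique)
          then show ?thesis by simp
        qed
        then have dab: "dist a (d i) = dist b (d i)" for i using B'(1) by (simp add: v_def)
        have "a = b"
        proof (rule ccontr)
          assume "a \<noteq> b"
          then have "dist a b / 2 > 0" by simp
          moreover have "a \<in> closure (range d)" using d by simp
          ultimately obtain i where i: "dist (d i) a < dist a b / 2" unfolding closure_approachable by blast
          then show False using dist_triangle2[of a b "d i"] dab[of i] by (simp add: dist_commute)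
        qed
        then have "(\<lambda>n. w x (q (r (s n))) - w y (q (r (s n)))) \<longlonglongrightarrow> 0" using tendsto_diff[OF a s(2)] by simp
        then have "(\<lambda>n. M (w x (q (r (s n))) - w y (q (r (s n))))) \<longlonglongrightarrow> 0" by (simp only: tendsto_iff)
        moreover have "strict_mono (r \<circ> s)" using r(1) s(1) by (simp add: strict_mono_o)
        ultimately show "\<exists>p. strict_mono p \<and> ((\<lambda>n. M (w x n - w y n)) \<circ> q \<circ> p) \<longlonglongrightarrow> 0" by (intro exI[of _ "r \<circ> s"]) (simp add: comp_def)
      qed
      then have "(\<lambda>n. z (Suc n) - z n) \<longlonglongrightarrow> 0" by (simp add: wz tendsto_iff)
      moreover have "convergent (\<lambda>k. S (z k))" using e by (auto simp: convergent_def)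
      ultimately have "convergent z" by (intro convergent_mod_kernel[OF S])
      then show "E_grp x y" by (simp add: E_grp_def z_def[abs_def])
    qed
  qed
  then show ?thesis unfolding borel_reducible_def using meas by blast
qed

theorem theorem1p2:
  assumes "compact (UNIV :: 'g::{topological_ab_group_add, polish_space} set)"
    and "connected (UNIV :: 'g set)"
    and "locally_compact_space (euclidean :: 'h::{topological_ab_group_add, polish_space} topology)"
  shows "(E_grp :: (nat \<Rightarrow> 'g) \<Rightarrow> (nat \<Rightarrow> 'g) \<Rightarrow> bool) \<le>\<^sub>B (E_grp :: (nat \<Rightarrow> 'h) \<Rightarrow> (nat \<Rightarrow> 'h) \<Rightarrow> bool) \<longleftrightarrow>
    (\<exists>S :: 'g \<Rightarrow> 'h. continuous_on UNIV S \<and> Modules.additive S \<and> non_archimedean (kernel_of S))"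
proof
  assume "(E_grp :: (nat \<Rightarrow> 'g) \<Rightarrow> (nat \<Rightarrow> 'g) \<Rightarrow> bool) \<le>\<^sub>B (E_grp :: (nat \<Rightarrow> 'h) \<Rightarrow> (nat \<Rightarrow> 'h) \<Rightarrow> bool)"
  then obtain \<theta> :: "(nat \<Rightarrow> 'g) \<Rightarrow> nat \<Rightarrow> 'h" where "\<theta> \<in> borel_measurable borel" "\<And>x y. E_grp x y \<longleftrightarrow> E_grp (\<theta> x) (\<theta> y)"
    unfolding borel_reducible_def by blast
  moreover have "locally_compact_space (euclidean :: 'g topology)"
    unfolding locally_compact_space_def using assms(1) by (auto intro!: exI[of _ UNIV])
  ultimately show "\<exists>S :: 'g \<Rightarrow> 'h. continuous_on UNIV S \<and> Modules.additive S \<and> non_archimedean (kernel_of S)"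
    using assms(2,3) by (intro reduction_imp_homomorphism)
next
  assume "\<exists>S :: 'g \<Rightarrow> 'h. continuous_on UNIV S \<and> Modules.additive S \<and> non_archimedean (kernel_of S)"
  then show "(E_grp :: (nat \<Rightarrow> 'g) \<Rightarrow> (nat \<Rightarrow> 'g) \<Rightarrow> bool) \<le>\<^sub>B (E_grp :: (nat \<Rightarrow> 'h) \<Rightarrow> (nat \<Rightarrow> 'h) \<Rightarrow> bool)"
    using homomorphism_imp_reduction[OF assms] by blast
qed

end
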